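(* Let $t_0<t_1$ be real numbers, let $X$ be a Banach space, let $1\le p<\infty$ and $\alpha>0$. The bounded operator $J^\alpha_{t_0,t}:L^p(t_0,t_1;X)\to L^p(t_0,t_1;X)$ is compact if and only if, for every bounded set $F\subset L^p(t_0,t_1;X)$ and every $t_0^*,t_1^*$ with $t_0<t_0^*<t_1^*<t_1$, the set $$\left\{J^{1+\alpha}_{t_0,t_1^*}f(t_1^* )-J^{1+\alpha}_{t_0,t_0^*}f(t_0^* )\,:\,f\in F\right\}$$ is relatively compact in $X$.
   Context: $L^p(t_0,t_1;X)$ is the Bochner-Lebesgue space on $[t_0,t_1]$ with Lebesgue measure. For $\beta>0$, the Riemann-Liouville fractional integral of order $\beta$ is $J^\beta_{t_0,t}f(t):=\frac{1}{\Gamma(\beta)}\int_{t_0}^t(t-s)^{\beta-1}f(s)\,ds$ (Bochner integral), for every $t$ for which it exists; $J^{\beta}_{t_0,t^*}f(t^* )$ denotes its value at $t=t^*$. $J^\alpha_{t_0,t}$ as an operator sends $f$ to the (a.e. defined) function $t\mapsto J^\alpha_{t_0,t}f(t)$; it is a bounded linear operator from $L^p(t_0,t_1;X)$ into itself. *)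

theory Defs
  imports "HOL-Analysis.Analysis"
begin

section \<open>The Bochner integral in an arbitrary Banach space\<close>

text \<open>
  The library's Bochner integral is restricted to second countable value types, that is, to
  separable spaces. The definitions below follow the library's construction, with Borel
  measurability replaced by strong measurability (a.e. limit of simple functions); this is
  the classical Bochner integral without any separability assumption on the space of values.
\<close>

definition strongly_measurable :: "'s measure \<Rightarrow> ('s \<Rightarrow> 'a::real_normed_vector) \<Rightarrow> bool" where
  "strongly_measurable M f \<longleftrightarrow>
     (\<exists>s. (\<forall>i. simple_function M (s i)) \<and> (AE x in M. (\<lambda>i. s i x) \<longlonglongrightarrow> f x))"

definition has_Bochner_integral ::
    "'s measure \<Rightarrow> ('s \<Rightarrow> 'a) \<Rightarrow> 'a::real_normed_vector \<Rightarrow> bool" where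
  "has_Bochner_integral M f I \<longleftrightarrow>
     strongly_measurable M f \<and>
     (\<exists>s. (\<forall>i. Bochner_Integration.simple_bochner_integrable M (s i)) \<and>
          (\<lambda>i. \<integral>\<^sup>+x. ennreal (norm (f x - s i x)) \<partial>M) \<longlonglongrightarrow> 0 \<and>
          (\<lambda>i. Bochner_Integration.simple_bochner_integral M (s i)) \<longlonglongrightarrow> I)"

text \<open>As for the library's integrals, the value is 0 if the integral does not exist.\<close>

definition Bochner_integral :: "'s measure \<Rightarrow> ('s \<Rightarrow> 'a) \<Rightarrow> 'a::real_normed_vector" where
  "Bochner_integral M f =
     (if \<exists>I. has_Bochner_integral M f I then THE I. has_Bochner_integral M f I else 0)"

lemma strongly_measurable_if_borel_measurable:
  fixes f :: "'s \<Rightarrow> 'a::{real_normed_vector, second_countable_topology}"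
  assumes "f \<in> borel_measurable M"
  shows "strongly_measurable M f"
proof -
  obtain s where "\<And>i. simple_function M (s i)" "\<And>x. x \<in> space M \<Longrightarrow> (\<lambda>i. s i x) \<longlonglongrightarrow> f x"
    using borel_measurable_implies_sequence_metric[OF assms, of 0] by blast
  then show ?thesis
    unfolding strongly_measurable_def by (intro exI[of _ s]) auto
qed

lemma has_Bochner_integral_iff_library:
  fixes f :: "'s \<Rightarrow> 'a::{real_normed_vector, second_countable_topology}"
  assumes "f \<in> borel_measurable M"
  shows "has_Bochner_integral M f I \<longleftrightarrow> has_bochner_integral M f I"
  using assms strongly_measurable_if_borel_measurable[OF assms]
  by (auto simp: has_Bochner_integral_def has_bochner_integral.simps)

lemma Bochner_integral_eq_library:
  fixes f :: "'s \<Rightarrow> 'a::{banach, second_countable_topology}"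
  assumes "f \<in> borel_measurable M"
  shows "Bochner_integral M f = integral\<^sup>L M f"
proof -
  have "has_Bochner_integral M f = has_bochner_integral M f"
    using has_Bochner_integral_iff_library[OF assms] by (intro ext)
  then show ?thesis
    by (simp add: Bochner_integral_def lebesgue_integral_def)
qed


section \<open>Bochner-Lebesgue spaces\<close>

definition Lp_functions :: "'s measure \<Rightarrow> real \<Rightarrow> ('s \<Rightarrow> 'a::real_normed_vector) set" where
  "Lp_functions M p =
     {f. strongly_measurable M f \<and> integrable M (\<lambda>x. norm (f x) powr p)}"

text \<open>
  Points of the \<open>L\<^sup>p\<close> space are classes of functions modulo equality almost everywhere.
\<close>

definition Lp_class ::
    "'s measure \<Rightarrow> real \<Rightarrow> ('s \<Rightarrow> 'a::real_normed_vector) \<Rightarrow> ('s \<Rightarrow> 'a) set" where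
  "Lp_class M p f = {g \<in> Lp_functions M p. AE x in M. g x = f x}"

definition Lp_space :: "'s measure \<Rightarrow> real \<Rightarrow> ('s \<Rightarrow> 'a::real_normed_vector) set set" where
  "Lp_space M p = Lp_class M p ` Lp_functions M p"

definition Lp_rep :: "('s \<Rightarrow> 'a) set \<Rightarrow> 's \<Rightarrow> 'a" where
  "Lp_rep u = (SOME f. f \<in> u)"

definition Lp_dist ::
    "'s measure \<Rightarrow> real \<Rightarrow> ('s \<Rightarrow> 'a::real_normed_vector) set \<Rightarrow> ('s \<Rightarrow> 'a) set \<Rightarrow> real" where
  "Lp_dist M p u v = (\<integral>x. norm (Lp_rep u x - Lp_rep v x) powr p \<partial>M) powr (1 / p)"


section \<open>Compact operators\<close>

text \<open>
  For linear operators between normed spaces, given by their carriers and norm distances: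
  bounded sets are mapped to relatively compact sets.
\<close>

definition compact_operator ::
    "'u set \<Rightarrow> ('u \<Rightarrow> 'u \<Rightarrow> real) \<Rightarrow> 'v set \<Rightarrow> ('v \<Rightarrow> 'v \<Rightarrow> real) \<Rightarrow> ('u \<Rightarrow> 'v) \<Rightarrow> bool" where
  "compact_operator U d V e T \<longleftrightarrow>
     T \<in> U \<rightarrow> V \<and>
     (\<forall>B. Metric_space.mbounded U d B \<longrightarrow>
        compactin (Metric_space.mtopology V e) (Metric_space.mtopology V e closure_of (T ` B)))"


section \<open>The Riemann-Liouville fractional integral\<close>

definition RL_integral :: "real \<Rightarrow> real \<Rightarrow> (real \<Rightarrow> 'a) \<Rightarrow> real \<Rightarrow> 'a::real_normed_vector" where
  "RL_integral \<beta> t\<^sub>0 f t =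
     (1 / Gamma \<beta>) *\<^sub>R
       Bochner_integral (lebesgue_on {t\<^sub>0..t}) (\<lambda>s. (t - s) powr (\<beta> - 1) *\<^sub>R f s)"

text \<open>
  The result does not depend on the chosen representative, and at the null set of points \<open>t\<close>
  where the integral does not exist the value of \<open>RL_integral\<close> is irrelevant.
\<close>

definition RL_operator ::
    "real \<Rightarrow> real \<Rightarrow> real \<Rightarrow> real \<Rightarrow> (real \<Rightarrow> 'a::real_normed_vector) set \<Rightarrow> (real \<Rightarrow> 'a) set" where
  "RL_operator p t\<^sub>0 t\<^sub>1 \<alpha> u =
     Lp_class (lebesgue_on {t\<^sub>0..t\<^sub>1}) p (RL_integral \<alpha> t\<^sub>0 (Lp_rep u))"

end

theory Submission
  imports Defs
begin

text \<open>
  Write \<open>J\<^sup>\<beta>\<close> for the Riemann-Liouville integral of order \<open>\<beta>\<close>. Formally \<open>J\<^sup>1\<^sup>+\<^sup>\<alpha> f\<close> is a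
  primitive of \<open>J\<^sup>\<alpha> f\<close>, so the increments of \<open>J\<^sup>1\<^sup>+\<^sup>\<alpha> f\<close> are the integrals of \<open>J\<^sup>\<alpha> f\<close> over
  subintervals, and the theorem says that compactness of \<open>J\<^sup>\<alpha>\<close> is decided by these integrals.
  The reason is that the images \<open>J\<^sup>\<alpha> f\<close> are equi-regular: the operator that replaces \<open>J\<^sup>\<alpha> f\<close> on
  each cell of a mesh by a mean value tends to \<open>J\<^sup>\<alpha>\<close> in operator norm as the mesh is refined.

  This is seen on the kernels. Up to the factor \<open>1 / \<Gamma>(\<alpha>)\<close>, \<open>J\<^sup>\<alpha>\<close> is the convolution with \<open>k(x)
  = x\<^sup>\<alpha>\<^sup>-\<^sup>1\<close> and \<open>J\<^sup>1\<^sup>+\<^sup>\<alpha>\<close> the convolution with \<open>K(x) = x\<^sup>\<alpha> / \<alpha>\<close>, both cut off at \<open>x \<le> 0\<close>. The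
  difference of \<open>J\<^sup>\<alpha> f(t)\<close> and \<open>(J\<^sup>1\<^sup>+\<^sup>\<alpha> f(b) - J\<^sup>1\<^sup>+\<^sup>\<alpha> f(a)) / (b - a)\<close> is the integral of \<open>f\<close>
  against \<open>k(t - s) - (K(b - s) - K(a - s)) / (b - a)\<close>. If \<open>a\<close> and \<open>b\<close> are within \<open>h\<close> of \<open>t\<close> and
  \<open>b - a\<close> is at least \<open>h / 2\<close>, this is bounded by a function of \<open>t - s\<close> alone whose \<open>L\<^sup>1\<close> norm
  tends to 0 with \<open>h\<close> (\<open>kernel_average_close\<close>, \<open>nn_integral_kernel_gap_le\<close>,
  \<open>kernel_gap_mass_tendsto_0\<close>). Young's inequality for convolutions
  (\<open>nn_integral_convolution_power_le\<close>) turns it into an \<open>L\<^sup>p\<close> bound by a small multiple of the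
  \<open>L\<^sup>p\<close> norm of \<open>f\<close>. The only facts on vector-valued integrals that enter are linearity and the
  triangle inequality; the rest concerns scalar kernels.

  If the increments of \<open>J\<^sup>1\<^sup>+\<^sup>\<alpha>\<close> over bounded sets are relatively compact, fix a fine mesh. On a
  bounded set the finitely many cell averages range over totally bounded sets, and functions
  whose cell averages agree up to a small error have images that are close
  (\<open>Lp_norm_RL_le_if_cell_averages_le\<close>). So the image is totally bounded, and since \<open>L\<^sup>p\<close> is
  complete (\<open>mcomplete_Lp\<close>), it is relatively compact.

  Conversely, the increment of \<open>J\<^sup>1\<^sup>+\<^sup>\<alpha> f\<close> over \<open>[a, b]\<close> is the sum of its increments over small
  cells, each of which is close to the cell length times \<open>J\<^sup>\<alpha> f\<close>. This bounds the norm of the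
  increment by a constant times the \<open>L\<^sup>p\<close> norm of \<open>J\<^sup>\<alpha> f\<close> (\<open>norm_RL_increment_le_Lp_norm\<close>).
  Hence, by linearity, the increment is a Lipschitz function of the image under \<open>J\<^sup>\<alpha>\<close>, and it
  maps totally bounded images to totally bounded sets.
\<close>


section \<open>The Bochner integral without separability\<close>

lemma strongly_measurable_simple_function:
  "simple_function M s \<Longrightarrow> strongly_measurable M s"
  unfolding strongly_measurable_def by (intro exI[of _ "\<lambda>_. s"]) auto

lemma strongly_measurable_compose2:
  fixes h :: "'a::real_normed_vector \<Rightarrow> 'b::real_normed_vector \<Rightarrow> 'c::real_normed_vector"
  assumes f: "strongly_measurable M f" and g: "strongly_measurable M g"
    and h: "continuous_on UNIV (\<lambda>z. h (fst z) (snd z))"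
  shows "strongly_measurable M (\<lambda>x. h (f x) (g x))"
proof -
  obtain s where s: "\<And>i. simple_function M (s i)" "AE x in M. (\<lambda>i. s i x) \<longlonglongrightarrow> f x"
    using f unfolding strongly_measurable_def by blast
  obtain r where r: "\<And>i. simple_function M (r i)" "AE x in M. (\<lambda>i. r i x) \<longlonglongrightarrow> g x"
    using g unfolding strongly_measurable_def by blast
  show ?thesis unfolding strongly_measurable_def
  proof (intro exI[of _ "\<lambda>i x. h (s i x) (r i x)"] conjI allI)
    show "simple_function M (\<lambda>x. h (s i x) (r i x))" for i
      using s(1) r(1) by (rule simple_function_compose2)
    show "AE x in M. (\<lambda>i. h (s i x) (r i x)) \<longlonglongrightarrow> h (f x) (g x)"
      using s(2) r(2)
    proof eventually_elim
      case (elim x)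
      then have lim: "(\<lambda>i. (s i x, r i x)) \<longlonglongrightarrow> (f x, g x)" by (rule tendsto_Pair)
      have "isCont (\<lambda>z. h (fst z) (snd z)) (f x, g x)"
        using h by (simp add: continuous_on_eq_continuous_at)
      from isCont_tendsto_compose[OF this lim] show ?case by simp
    qed
  qed
qed

lemma strongly_measurable_diff:
  "strongly_measurable M f \<Longrightarrow> strongly_measurable M g \<Longrightarrow> strongly_measurable M (\<lambda>x. f x - g x)"
  by (rule strongly_measurable_compose2[where h="\<lambda>x y. x - y"]) (auto intro!: continuous_intros)

lemma strongly_measurable_scaleR:
  "strongly_measurable M f \<Longrightarrow> strongly_measurable M g \<Longrightarrow>
    strongly_measurable M (\<lambda>x. f x *\<^sub>R g x)"
  by (rule strongly_measurable_compose2[where h="\<lambda>x y. x *\<^sub>R y"]) (auto intro!: continuous_intros)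

lemma strongly_measurable_scaleR_add:
  "strongly_measurable M f \<Longrightarrow> strongly_measurable M g \<Longrightarrow>
    strongly_measurable M (\<lambda>x. a *\<^sub>R f x + b *\<^sub>R g x)"
  by (rule strongly_measurable_compose2[where h="\<lambda>x y. a *\<^sub>R x + b *\<^sub>R y"]) (auto intro!: continuous_intros)

text \<open>
  An almost everywhere limit of simple functions is in general only equal almost everywhere to a
  measurable function; completeness of the measure closes the gap. It is what makes norms of
  strongly measurable functions available to the nonnegative integral.
\<close>

lemma (in complete_measure) borel_measurable_if_strongly_measurable:
  fixes f :: "'a \<Rightarrow> real"
  assumes "strongly_measurable M f"
  shows "f \<in> borel_measurable M"
proof -
  obtain s where s: "\<And>i. simple_function M (s i)" "AE x in M. (\<lambda>i. s i x) \<longlonglongrightarrow> f x"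
    using assms unfolding strongly_measurable_def by blast
  define g where "g x = lim (\<lambda>i. s i x)" for x
  have [measurable]: "s i \<in> borel_measurable M" for i
    using s(1) by (rule borel_measurable_simple_function)
  have g[measurable]: "g \<in> borel_measurable M"
    unfolding g_def by measurable
  have eq: "AE x in M. g x = f x"
    using s(2) by eventually_elim (simp add: g_def limI)
  show ?thesis
  proof (rule measurableI)
    fix A :: "real set" assume A: "A \<in> sets borel"
    show "f -` A \<inter> space M \<in> sets M"
    proof (rule in_sets_AE)
      show "AE x in M. x \<in> g -` A \<inter> space M \<longleftrightarrow> x \<in> f -` A \<inter> space M"
        using eq by eventually_elim simp
      show "g -` A \<inter> space M \<in> sets M" using A g by (rule measurable_sets[rotated])
    qed simp
  qed simp
qed

lemma (in complete_measure) borel_measurable_norm_strongly_measurable: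
  assumes "strongly_measurable M f"
  shows "(\<lambda>x. norm (f x)) \<in> borel_measurable M"
proof (rule borel_measurable_if_strongly_measurable)
  show "strongly_measurable M (\<lambda>x. norm (f x))"
    using assms assms by (rule strongly_measurable_compose2[where h="\<lambda>x y. norm x"]) (auto intro!: continuous_intros)
qed

text \<open>
  Cutting the approximating functions to 0 where their norm exceeds \<open>2 \<parallel>f\<parallel>\<close> keeps the limit: the
  cut is eventually inactive where \<open>f \<noteq> 0\<close>, and where \<open>f = 0\<close> the cut functions vanish. The
  bound is what dominated convergence asks for.
\<close>

lemma (in complete_measure) strongly_measurable_dominated_simple:
  assumes f: "strongly_measurable M f"
  obtains s where "\<And>i. simple_function M (s i)"
    "\<And>i x. x \<in> space M \<Longrightarrow> norm (s i x) \<le> 2 * norm (f x)"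
    "AE x in M. (\<lambda>i. s i x) \<longlonglongrightarrow> f x"
proof -
  obtain s where s: "\<And>i. simple_function M (s i)" "AE x in M. (\<lambda>i. s i x) \<longlonglongrightarrow> f x"
    using f unfolding strongly_measurable_def by blast
  have nf[measurable]: "(\<lambda>x. norm (f x)) \<in> borel_measurable M"
    by (rule borel_measurable_norm_strongly_measurable[OF f])
  have ns[measurable]: "(\<lambda>x. norm (s i x)) \<in> borel_measurable M" for i
    using s(1) by (intro borel_measurable_simple_function simple_function_compose1[where g=norm])
  define A where "A i = {x \<in> space M. norm (s i x) \<le> 2 * norm (f x)}" for i
  have A: "A i \<in> sets M" for i unfolding A_def by measurable
  let ?s = "\<lambda>i x. indicat_real (A i) x *\<^sub>R s i x"
  show ?thesis
  proof
    show "simple_function M (?s i)" for i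
      by (rule simple_function_compose2[where h="(*\<^sub>R)"]) (auto intro: s(1) A)
    show "norm (?s i x) \<le> 2 * norm (f x)" if "x \<in> space M" for i x
      using that by (auto simp: A_def indicator_def)
    show "AE x in M. (\<lambda>i. ?s i x) \<longlonglongrightarrow> f x"
      using s(2) AE_space
    proof eventually_elim
      case (elim x)
      show ?case
      proof (cases "f x = 0")
        case True
        then have z: "?s i x = 0" for i by (auto simp: A_def indicator_def)
        show ?thesis unfolding z True by (rule tendsto_const)
      next
        case False
        have "(\<lambda>i. norm (s i x)) \<longlonglongrightarrow> norm (f x)"
          using elim(1) by (rule tendsto_norm)
        moreover have "norm (f x) < 2 * norm (f x)" using False by simp
        ultimately have "eventually (\<lambda>i. norm (s i x) < 2 * norm (f x)) sequentially"
          by (rule order_tendstoD)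
        then have "eventually (\<lambda>i. ?s i x = s i x) sequentially"
          by eventually_elim (use elim(2) in \<open>auto simp: A_def\<close>)
        then show ?thesis using elim(1) by (simp add: tendsto_cong)
      qed
    qed
  qed
qed

lemma (in complete_measure) simple_functions_dense_Lp:
  assumes f: "strongly_measurable M f" and p: "1 \<le> p"
    and fin: "(\<integral>\<^sup>+x. ennreal (norm (f x) powr p) \<partial>M) < \<infinity>"
  obtains s where "\<And>i. simple_function M (s i)"
    "\<And>i x. x \<in> space M \<Longrightarrow> norm (s i x) \<le> 2 * norm (f x)"
    "(\<lambda>i. \<integral>\<^sup>+x. ennreal (norm (f x - s i x) powr p) \<partial>M) \<longlonglongrightarrow> 0"
proof -
  obtain s where s: "\<And>i. simple_function M (s i)"
    "\<And>i x. x \<in> space M \<Longrightarrow> norm (s i x) \<le> 2 * norm (f x)"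
    "AE x in M. (\<lambda>i. s i x) \<longlonglongrightarrow> f x"
    by (rule strongly_measurable_dominated_simple[OF f]) blast
  have nf[measurable]: "(\<lambda>x. norm (f x)) \<in> borel_measurable M"
    by (rule borel_measurable_norm_strongly_measurable[OF f])
  have nd[measurable]: "(\<lambda>x. norm (f x - s i x)) \<in> borel_measurable M" for i
    by (intro borel_measurable_norm_strongly_measurable strongly_measurable_diff f
        strongly_measurable_simple_function s)
  have "(\<lambda>i. \<integral>\<^sup>+x. ennreal (norm (f x - s i x) powr p) \<partial>M) \<longlonglongrightarrow> (\<integral>\<^sup>+x. 0 \<partial>M)"
  proof (rule nn_integral_dominated_convergence[where w="\<lambda>x. ennreal (3 powr p) * ennreal (norm (f x) powr p)"])
    show "AE x in M. ennreal (norm (f x - s i x) powr p)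
        \<le> ennreal (3 powr p) * ennreal (norm (f x) powr p)" for i
    proof (rule AE_I2)
      fix x assume "x \<in> space M"
      have "norm (f x - s i x) \<le> 3 * norm (f x)"
        using s(2)[OF \<open>x \<in> space M\<close>, of i] norm_triangle_ineq4[of "f x" "s i x"] by linarith
      then have "norm (f x - s i x) powr p \<le> (3 * norm (f x)) powr p"
        using p by (intro powr_mono2) auto
      then show "ennreal (norm (f x - s i x) powr p) \<le> ennreal (3 powr p) * ennreal (norm (f x) powr p)"
        by (simp add: powr_mult ennreal_mult[symmetric])
    qed
    show "(\<integral>\<^sup>+x. ennreal (3 powr p) * ennreal (norm (f x) powr p) \<partial>M) < \<infinity>"
      using fin by (subst nn_integral_cmult) (auto simp: ennreal_mult_less_top)
    show "AE x in M. (\<lambda>i. ennreal (norm (f x - s i x) powr p)) \<longlonglongrightarrow> 0"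
      using s(3)
    proof eventually_elim
      case (elim x)
      have "(\<lambda>i. norm (f x - s i x)) \<longlonglongrightarrow> norm (f x - f x)"
        using elim by (intro tendsto_intros)
      then have "(\<lambda>i. norm (f x - s i x) powr p) \<longlonglongrightarrow> 0"
        using p by (intro tendsto_zero_powrI[where b=p]) auto
      then show ?case using tendsto_ennrealI by fastforce
    qed
  qed auto
  then show ?thesis by (intro that[OF s(1,2)]) simp_all
qed

lemma has_Bochner_integral_scaleR_add:
  assumes "complete_measure M" and f: "has_Bochner_integral M f I" and g: "has_Bochner_integral M g J"
  shows "has_Bochner_integral M (\<lambda>x. a *\<^sub>R f x + b *\<^sub>R g x) (a *\<^sub>R I + b *\<^sub>R J)"
proof -
  interpret complete_measure M by fact
  obtain s where fm: "strongly_measurable M f" and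
    s: "\<And>i. Bochner_Integration.simple_bochner_integrable M (s i)"
    "(\<lambda>i. \<integral>\<^sup>+x. ennreal (norm (f x - s i x)) \<partial>M) \<longlonglongrightarrow> 0"
    "(\<lambda>i. Bochner_Integration.simple_bochner_integral M (s i)) \<longlonglongrightarrow> I"
    using f unfolding has_Bochner_integral_def by blast
  obtain r where gm: "strongly_measurable M g" and
    r: "\<And>i. Bochner_Integration.simple_bochner_integrable M (r i)"
    "(\<lambda>i. \<integral>\<^sup>+x. ennreal (norm (g x - r i x)) \<partial>M) \<longlonglongrightarrow> 0"
    "(\<lambda>i. Bochner_Integration.simple_bochner_integral M (r i)) \<longlonglongrightarrow> J"
    using g unfolding has_Bochner_integral_def by blast
  have sf: "simple_function M (s i)" "simple_function M (r i)" for i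
    using s(1) r(1) by (auto simp: simple_bochner_integrable.simps)
  have [measurable]: "(\<lambda>x. norm (f x - s i x)) \<in> borel_measurable M"
    "(\<lambda>x. norm (g x - r i x)) \<in> borel_measurable M" for i
    by (intro borel_measurable_norm_strongly_measurable strongly_measurable_diff fm gm
        strongly_measurable_simple_function sf)+
  let ?t = "\<lambda>i x. a *\<^sub>R s i x + b *\<^sub>R r i x"
  have as: "Bochner_Integration.simple_bochner_integrable M (\<lambda>x. a *\<^sub>R s i x)" "Bochner_Integration.simple_bochner_integrable M (\<lambda>x. b *\<^sub>R r i x)" for i
    using simple_bochner_integrable_compose2[of "\<lambda>x y. a *\<^sub>R x", OF _ s(1) s(1)]
      simple_bochner_integrable_compose2[of "\<lambda>x y. b *\<^sub>R x", OF _ r(1) r(1)] by auto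
  have int: "Bochner_Integration.simple_bochner_integral M (?t i)
      = a *\<^sub>R Bochner_Integration.simple_bochner_integral M (s i) + b *\<^sub>R Bochner_Integration.simple_bochner_integral M (r i)" for i
    using simple_bochner_integral_linear[OF linear_scaleR s(1)]
      simple_bochner_integral_linear[OF linear_scaleR r(1)]
    by (simp add: simple_bochner_integral_add[OF as])
  show ?thesis unfolding has_Bochner_integral_def
  proof (intro conjI exI[of _ ?t] allI)
    show "strongly_measurable M (\<lambda>x. a *\<^sub>R f x + b *\<^sub>R g x)"
      using fm gm by (rule strongly_measurable_scaleR_add)
    show "Bochner_Integration.simple_bochner_integrable M (?t i)" for i
      using s(1) r(1) by (rule simple_bochner_integrable_compose2[rotated]) simp
    show "(\<lambda>i. Bochner_Integration.simple_bochner_integral M (?t i)) \<longlonglongrightarrow> a *\<^sub>R I + b *\<^sub>R J"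
      unfolding int by (intro tendsto_intros s r)
    show "(\<lambda>i. \<integral>\<^sup>+x. ennreal (norm (a *\<^sub>R f x + b *\<^sub>R g x - ?t i x)) \<partial>M) \<longlonglongrightarrow> 0"
    proof (rule tendsto_sandwich[OF _ _ tendsto_const])
      let ?B = "\<lambda>i. ennreal \<bar>a\<bar> * (\<integral>\<^sup>+x. ennreal (norm (f x - s i x)) \<partial>M)
         + ennreal \<bar>b\<bar> * (\<integral>\<^sup>+x. ennreal (norm (g x - r i x)) \<partial>M)"
      have "?B \<longlonglongrightarrow> ennreal \<bar>a\<bar> * 0 + ennreal \<bar>b\<bar> * 0"
        by (intro tendsto_add ennreal_tendsto_cmult s r) auto
      then show "?B \<longlonglongrightarrow> 0" by simp
      show "\<forall>\<^sub>F i in sequentially. (\<integral>\<^sup>+x. ennreal (norm (a *\<^sub>R f x + b *\<^sub>R g x - ?t i x)) \<partial>M) \<le> ?B i"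
      proof (intro always_eventually allI)
        fix i
        have "(\<integral>\<^sup>+x. ennreal (norm (a *\<^sub>R f x + b *\<^sub>R g x - ?t i x)) \<partial>M)
          \<le> (\<integral>\<^sup>+x. ennreal \<bar>a\<bar> * ennreal (norm (f x - s i x)) + ennreal \<bar>b\<bar> * ennreal (norm (g x - r i x)) \<partial>M)"
        proof (rule nn_integral_mono)
          fix x
          have "norm (a *\<^sub>R f x + b *\<^sub>R g x - ?t i x) = norm (a *\<^sub>R (f x - s i x) + b *\<^sub>R (g x - r i x))"
            by (simp add: algebra_simps)
          also have "\<dots> \<le> \<bar>a\<bar> * norm (f x - s i x) + \<bar>b\<bar> * norm (g x - r i x)"
            by (rule norm_triangle_le) simp
          finally show "ennreal (norm (a *\<^sub>R f x + b *\<^sub>R g x - ?t i x))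
            \<le> ennreal \<bar>a\<bar> * ennreal (norm (f x - s i x)) + ennreal \<bar>b\<bar> * ennreal (norm (g x - r i x))"
            by (simp flip: ennreal_mult ennreal_plus)
        qed
        also have "\<dots> = ?B i"
          by (simp add: nn_integral_add nn_integral_cmult)
        finally show "(\<integral>\<^sup>+x. ennreal (norm (a *\<^sub>R f x + b *\<^sub>R g x - ?t i x)) \<partial>M) \<le> ?B i" .
      qed
    qed simp
  qed
qed

lemma norm_simple_bochner_integral_le:
  fixes s :: "'s \<Rightarrow> 'a::real_normed_vector"
  assumes "Bochner_Integration.simple_bochner_integrable M s"
  shows "ennreal (norm (Bochner_Integration.simple_bochner_integral M s)) \<le> (\<integral>\<^sup>+x. ennreal (norm (s x)) \<partial>M)"
proof -
  have "ennreal (norm (Bochner_Integration.simple_bochner_integral M s)) \<le> ennreal (Bochner_Integration.simple_bochner_integral M (\<lambda>x. norm (s x)))"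
    using simple_bochner_integral_norm_bound[OF assms] by (rule ennreal_leI)
  also have "\<dots> = (\<integral>\<^sup>+x. ennreal (norm (s x)) \<partial>M)"
    using simple_bochner_integrable_compose2[of "\<lambda>x y. norm x", OF _ assms assms]
    by (intro simple_bochner_integral_eq_nn_integral) auto
  finally show ?thesis .
qed

lemma norm_Bochner_integral_le:
  assumes "complete_measure M" and f: "has_Bochner_integral M f I"
  shows "ennreal (norm I) \<le> (\<integral>\<^sup>+x. ennreal (norm (f x)) \<partial>M)"
proof -
  interpret complete_measure M by fact
  obtain s where fm: "strongly_measurable M f" and
    s: "\<And>i. Bochner_Integration.simple_bochner_integrable M (s i)"
    "(\<lambda>i. \<integral>\<^sup>+x. ennreal (norm (f x - s i x)) \<partial>M) \<longlonglongrightarrow> 0"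
    "(\<lambda>i. Bochner_Integration.simple_bochner_integral M (s i)) \<longlonglongrightarrow> I"
    using f unfolding has_Bochner_integral_def by blast
  have sf: "simple_function M (s i)" for i
    using s(1) by (auto simp: simple_bochner_integrable.simps)
  have [measurable]: "(\<lambda>x. norm (f x - s i x)) \<in> borel_measurable M" 
    "(\<lambda>x. norm (f x)) \<in> borel_measurable M" for i
    by (intro borel_measurable_norm_strongly_measurable strongly_measurable_diff fm
        strongly_measurable_simple_function sf)+
  show ?thesis
  proof (rule LIMSEQ_le)
    show "(\<lambda>i. ennreal (norm (Bochner_Integration.simple_bochner_integral M (s i)))) \<longlonglongrightarrow> ennreal (norm I)"
      by (intro tendsto_ennrealI tendsto_norm s)
    have "(\<lambda>i. (\<integral>\<^sup>+x. ennreal (norm (f x)) \<partial>M) + (\<integral>\<^sup>+x. ennreal (norm (f x - s i x)) \<partial>M))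
        \<longlonglongrightarrow> (\<integral>\<^sup>+x. ennreal (norm (f x)) \<partial>M) + 0"
      by (intro tendsto_add tendsto_const s)
    then show "(\<lambda>i. (\<integral>\<^sup>+x. ennreal (norm (f x)) \<partial>M) + (\<integral>\<^sup>+x. ennreal (norm (f x - s i x)) \<partial>M))
        \<longlonglongrightarrow> (\<integral>\<^sup>+x. ennreal (norm (f x)) \<partial>M)" by simp
    show "\<exists>N. \<forall>n\<ge>N. ennreal (norm (Bochner_Integration.simple_bochner_integral M (s n)))
       \<le> (\<integral>\<^sup>+x. ennreal (norm (f x)) \<partial>M) + (\<integral>\<^sup>+x. ennreal (norm (f x - s n x)) \<partial>M)"
    proof (intro exI allI impI)
      fix n
      have "ennreal (norm (Bochner_Integration.simple_bochner_integral M (s n))) \<le> (\<integral>\<^sup>+x. ennreal (norm (s n x)) \<partial>M)"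
        by (rule norm_simple_bochner_integral_le[OF s(1)])
      also have "\<dots> \<le> (\<integral>\<^sup>+x. ennreal (norm (f x)) + ennreal (norm (f x - s n x)) \<partial>M)"
      proof (rule nn_integral_mono)
        fix x
        have "norm (s n x) \<le> norm (f x) + norm (f x - s n x)"
          using norm_triangle_ineq4[of "f x" "f x - s n x"] by simp
        then show "ennreal (norm (s n x)) \<le> ennreal (norm (f x)) + ennreal (norm (f x - s n x))"
          by (simp flip: ennreal_plus)
      qed
      also have "\<dots> = (\<integral>\<^sup>+x. ennreal (norm (f x)) \<partial>M) + (\<integral>\<^sup>+x. ennreal (norm (f x - s n x)) \<partial>M)"
        by (rule nn_integral_add) auto
      finally show "ennreal (norm (Bochner_Integration.simple_bochner_integral M (s n)))
        \<le> (\<integral>\<^sup>+x. ennreal (norm (f x)) \<partial>M) + (\<integral>\<^sup>+x. ennreal (norm (f x - s n x)) \<partial>M)" .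
    qed
  qed
qed

text \<open>
  The difference of two integrals of \<open>f\<close> is an integral of the zero function, hence bounded in
  norm by 0.
\<close>

lemma has_Bochner_integral_unique:
  assumes "complete_measure M" and f: "has_Bochner_integral M f I" "has_Bochner_integral M f J"
  shows "I = J"
  using norm_Bochner_integral_le[OF assms(1) has_Bochner_integral_scaleR_add[OF assms(1) f, of 1 "-1"]]
  by simp

lemma Bochner_integral_eqI:
  assumes "complete_measure M" and f: "has_Bochner_integral M f I"
  shows "Bochner_integral M f = I"
proof -
  have "(THE J. has_Bochner_integral M f J) = I"
    using f by (rule the_equality) (rule has_Bochner_integral_unique[OF assms(1) _ f])
  then show ?thesis using f unfolding Bochner_integral_def by auto
qed

text \<open>
  Bochner's criterion. The integrals of \<open>L\<^sup>1\<close>-approximating simple functions form a Cauchy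
  sequence because the integral of simple functions is a contraction from \<open>L\<^sup>1\<close>.
\<close>

lemma has_Bochner_integral_if_finite_norm:
  fixes f :: "'s \<Rightarrow> 'a::banach"
  assumes "complete_measure M" and fm: "strongly_measurable M f"
    and fin: "(\<integral>\<^sup>+x. ennreal (norm (f x)) \<partial>M) < \<infinity>"
  shows "has_Bochner_integral M f (Bochner_integral M f)"
proof -
  interpret complete_measure M by fact
  have "(\<integral>\<^sup>+x. ennreal (norm (f x) powr 1) \<partial>M) < \<infinity>" using fin by simp
  from simple_functions_dense_Lp[OF fm order_refl this]
  obtain s where s: "\<And>i. simple_function M (s i)"
    "\<And>i x. x \<in> space M \<Longrightarrow> norm (s i x) \<le> 2 * norm (f x)"
    "(\<lambda>i. \<integral>\<^sup>+x. ennreal (norm (f x - s i x)) \<partial>M) \<longlonglongrightarrow> 0"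
    by (auto simp: powr_one')
  have [measurable]: "(\<lambda>x. norm (f x - s i x)) \<in> borel_measurable M" 
    "(\<lambda>x. norm (f x)) \<in> borel_measurable M" for i
    by (intro borel_measurable_norm_strongly_measurable strongly_measurable_diff fm
        strongly_measurable_simple_function s)+
  have si: "Bochner_Integration.simple_bochner_integrable M (s i)" for i
  proof (rule simple_bochner_integrableI_bounded[OF s(1)])
    have "(\<integral>\<^sup>+x. ennreal (norm (s i x)) \<partial>M) \<le> (\<integral>\<^sup>+x. 2 * ennreal (norm (f x)) \<partial>M)"
    proof (rule nn_integral_mono)
      fix x assume "x \<in> space M"
      then have "ennreal (norm (s i x)) \<le> ennreal (2 * norm (f x))" by (intro ennreal_leI s(2))
      then show "ennreal (norm (s i x)) \<le> 2 * ennreal (norm (f x))" by (simp add: ennreal_mult')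
    qed
    also have "\<dots> < \<infinity>"
      using fin by (simp add: nn_integral_cmult ennreal_mult_less_top)
    finally show "(\<integral>\<^sup>+x. ennreal (norm (s i x)) \<partial>M) < \<infinity>" .
  qed
  let ?I = "\<lambda>i. Bochner_Integration.simple_bochner_integral M (s i)"
  let ?e = "\<lambda>i. \<integral>\<^sup>+x. ennreal (norm (f x - s i x)) \<partial>M"
  have bd: "ennreal (norm (?I i - ?I j)) \<le> ?e i + ?e j" for i j
  proof -
    have "ennreal (norm (?I i - ?I j)) = ennreal (norm (Bochner_Integration.simple_bochner_integral M (\<lambda>x. s i x - s j x)))"
      by (simp add: simple_bochner_integral_diff si)
    also have "\<dots> \<le> (\<integral>\<^sup>+x. ennreal (norm (s i x - s j x)) \<partial>M)"
      by (rule norm_simple_bochner_integral_le)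
        (rule simple_bochner_integrable_compose2[where p="\<lambda>x y. x - y", OF _ si si], simp)
    also have "\<dots> \<le> (\<integral>\<^sup>+x. ennreal (norm (f x - s i x)) + ennreal (norm (f x - s j x)) \<partial>M)"
    proof (rule nn_integral_mono)
      fix x
      have "norm (s i x - s j x) \<le> norm (f x - s i x) + norm (f x - s j x)"
        using norm_triangle_ineq4[of "f x - s j x" "f x - s i x"] by simp
      then show "ennreal (norm (s i x - s j x)) \<le> ennreal (norm (f x - s i x)) + ennreal (norm (f x - s j x))"
        by (simp flip: ennreal_plus)
    qed
    also have "\<dots> = ?e i + ?e j" by (rule nn_integral_add) auto
    finally show ?thesis .
  qed
  have "Cauchy ?I"
  proof (rule CauchyI)
    fix e :: real assume "0 < e"
    then have "eventually (\<lambda>i. ?e i < ennreal (e/2)) sequentially"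
      using s(3) by (intro order_tendstoD) auto
    then obtain N where N: "\<And>i. i \<ge> N \<Longrightarrow> ?e i < ennreal (e/2)"
      unfolding eventually_sequentially by blast
    show "\<exists>K. \<forall>m\<ge>K. \<forall>n\<ge>K. norm (?I m - ?I n) < e"
    proof (intro exI allI impI)
      fix m n assume "m \<ge> N" "n \<ge> N"
      have "ennreal (norm (?I m - ?I n)) \<le> ?e m + ?e n" by (rule bd)
      also have "\<dots> < ennreal (e/2) + ennreal (e/2)"
        using N[OF \<open>m \<ge> N\<close>] N[OF \<open>n \<ge> N\<close>] by (rule add_strict_mono)
      also have "\<dots> = ennreal e" using \<open>0 < e\<close> by (simp flip: ennreal_plus)
      finally show "norm (?I m - ?I n) < e" by (simp add: ennreal_less_iff)
    qed
  qed
  then obtain I where "?I \<longlonglongrightarrow> I" by (auto simp: Cauchy_convergent_iff convergent_def)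
  then have "has_Bochner_integral M f I"
    unfolding has_Bochner_integral_def using fm si s(3) by blast
  then show ?thesis using Bochner_integral_eqI[OF assms(1)] by metis
qed

lemma strongly_measurable_restrict_space_iff:
  assumes A: "A \<in> sets M"
  shows "strongly_measurable (restrict_space M A) f \<longleftrightarrow> strongly_measurable M (\<lambda>x. indicat_real A x *\<^sub>R f x)"
proof
  assume "strongly_measurable (restrict_space M A) f"
  then obtain s where s: "\<And>i. simple_function (restrict_space M A) (s i)"
    "AE x in restrict_space M A. (\<lambda>i. s i x) \<longlonglongrightarrow> f x"
    unfolding strongly_measurable_def by blast
  show "strongly_measurable M (\<lambda>x. indicat_real A x *\<^sub>R f x)"
    unfolding strongly_measurable_def
  proof (intro exI[of _ "\<lambda>i x. indicat_real A x *\<^sub>R s i x"] conjI allI)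
    show "simple_function M (\<lambda>x. indicat_real A x *\<^sub>R s i x)" for i
      using s(1)[of i] A by (subst (asm) simple_function_restrict_space) auto
    show "AE x in M. (\<lambda>i. indicat_real A x *\<^sub>R s i x) \<longlonglongrightarrow> indicat_real A x *\<^sub>R f x"
    proof -
      have "AE x in M. x \<in> A \<longrightarrow> (\<lambda>i. s i x) \<longlonglongrightarrow> f x"
        using s(2) A by (simp add: AE_restrict_space_iff)
      then show ?thesis by eventually_elim (auto simp: indicator_def)
    qed
  qed
next
  assume "strongly_measurable M (\<lambda>x. indicat_real A x *\<^sub>R f x)"
  then obtain s where s: "\<And>i. simple_function M (s i)"
    "AE x in M. (\<lambda>i. s i x) \<longlonglongrightarrow> indicat_real A x *\<^sub>R f x"
    unfolding strongly_measurable_def by blast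
  show "strongly_measurable (restrict_space M A) f"
    unfolding strongly_measurable_def
  proof (intro exI[of _ s] conjI allI)
    show "simple_function (restrict_space M A) (s i)" for i
    proof -
      have "simple_function M (\<lambda>x. indicat_real A x *\<^sub>R s i x)"
        by (rule simple_function_compose2[where h="(*\<^sub>R)"]) (auto intro: s(1) A)
      then show ?thesis using A by (subst simple_function_restrict_space) auto
    qed
    show "AE x in restrict_space M A. (\<lambda>i. s i x) \<longlonglongrightarrow> f x"
    proof -
      have "AE x in M. x \<in> A \<longrightarrow> (\<lambda>i. s i x) \<longlonglongrightarrow> f x"
        using s(2) by eventually_elim (auto simp: indicator_def)
      then show ?thesis using A by (simp add: AE_restrict_space_iff)
    qed
  qed
qed

lemma complete_measure_restrict_space:
  assumes "complete_measure M" and A: "A \<in> sets M"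
  shows "complete_measure (restrict_space M A)"
proof
  interpret complete_measure M by fact
  fix B C assume "B \<subseteq> C" "C \<in> null_sets (restrict_space M A)"
  then have "C \<in> null_sets M" "C \<subseteq> A" using A by (auto simp: null_sets_restrict_space)
  then have "B \<in> sets M" "B \<subseteq> A" using complete \<open>B \<subseteq> C\<close> by blast+
  then show "B \<in> sets (restrict_space M A)" using A by (simp add: sets_restrict_space_iff)
qed

text \<open>
  This allows integrals over the variable domain \<open>[t\<^sub>0, t]\<close> to be compared for different \<open>t\<close>:
  all of them become integrals over the real line.
\<close>

lemma Bochner_integral_restrict_space:
  fixes f :: "'s \<Rightarrow> 'a::banach"
  assumes M: "complete_measure M" and A: "A \<in> sets M"
    and fm: "strongly_measurable M (\<lambda>x. indicat_real A x *\<^sub>R f x)"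
    and fin: "(\<integral>\<^sup>+x. ennreal (norm (indicat_real A x *\<^sub>R f x)) \<partial>M) < \<infinity>"
  shows "Bochner_integral (restrict_space M A) f = Bochner_integral M (\<lambda>x. indicat_real A x *\<^sub>R f x)"
proof -
  let ?R = "restrict_space M A"
  have nn: "(\<integral>\<^sup>+x. ennreal (norm (g x)) \<partial>?R) = (\<integral>\<^sup>+x. ennreal (norm (indicat_real A x *\<^sub>R g x)) \<partial>M)"
    for g :: "'s \<Rightarrow> 'a"
    using A by (subst nn_integral_restrict_space) (auto intro!: nn_integral_cong simp: indicator_def)
  have fR: "strongly_measurable ?R f"
    using fm A by (simp add: strongly_measurable_restrict_space_iff)
  have "has_Bochner_integral ?R f (Bochner_integral ?R f)"
    using fin by (intro has_Bochner_integral_if_finite_norm complete_measure_restrict_space M A fR)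
      (simp add: nn)
  then obtain s where
    s: "\<And>i. Bochner_Integration.simple_bochner_integrable ?R (s i)"
    "(\<lambda>i. \<integral>\<^sup>+x. ennreal (norm (f x - s i x)) \<partial>?R) \<longlonglongrightarrow> 0"
    "(\<lambda>i. Bochner_Integration.simple_bochner_integral ?R (s i)) \<longlonglongrightarrow> Bochner_integral ?R f"
    unfolding has_Bochner_integral_def by blast
  have "has_Bochner_integral M (\<lambda>x. indicat_real A x *\<^sub>R f x) (Bochner_integral ?R f)"
    unfolding has_Bochner_integral_def
  proof (intro conjI exI[of _ "\<lambda>i x. indicat_real A x *\<^sub>R s i x"] allI fm)
    show "Bochner_Integration.simple_bochner_integrable M (\<lambda>x. indicat_real A x *\<^sub>R s i x)" for i
      using s(1)[of i] A by (simp add: simple_bochner_integrable_restrict_space)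
    show "(\<lambda>i. Bochner_Integration.simple_bochner_integral M (\<lambda>x. indicat_real A x *\<^sub>R s i x)) \<longlonglongrightarrow> Bochner_integral ?R f"
      using s(3) A by (simp add: simple_bochner_integral_restrict_space[OF _ s(1)])
    show "(\<lambda>i. \<integral>\<^sup>+x. ennreal (norm (indicat_real A x *\<^sub>R f x - indicat_real A x *\<^sub>R s i x)) \<partial>M) \<longlonglongrightarrow> 0"
      using s(2) by (simp add: nn scaleR_diff_right)
  qed
  then show ?thesis using Bochner_integral_eqI[OF M] by metis
qed


section \<open>Completeness of the Bochner-Lebesgue spaces\<close>

text \<open>
  The graph of the convex function \<open>y \<mapsto> y\<^sup>p\<close> lies above its tangent at \<open>c\<close>. Integrated with a
  suitable \<open>c\<close>, this one inequality yields convexity, the embedding into \<open>L\<^sup>1\<close> and Young's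
  inequality.
\<close>

lemma powr_tangent_le:
  fixes y c p :: real
  assumes "0 < c" "0 \<le> y" "1 \<le> p"
  shows "p * c powr (p - 1) * y \<le> y powr p + (p - 1) * c powr p"
proof (cases "y = 0")
  case True
  then show ?thesis using assms by simp
next
  case False
  then have y: "0 < y" using assms by simp
  have "(y powr p) powr (1/p) * (c powr p) powr (1 - 1/p) \<le> 1/p * y powr p + (1 - 1/p) * c powr p"
    using y assms by (intro Youngs_inequality_0) auto
  moreover have "(y powr p) powr (1/p) = y" using y assms by (simp add: powr_powr)
  moreover have "(c powr p) powr (1 - 1/p) = c powr (p - 1)"
    using assms by (simp add: powr_powr right_diff_distrib)
  ultimately have "y * c powr (p - 1) \<le> 1/p * y powr p + (1 - 1/p) * c powr p" by simp
  then have "p * (y * c powr (p - 1)) \<le> p * (1/p * y powr p + (1 - 1/p) * c powr p)"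
    using assms by (intro mult_left_mono) auto
  also have "\<dots> = y powr p + (p - 1) * c powr p" using assms by (simp add: field_simps)
  finally show ?thesis by (simp add: mult_ac)
qed

lemma powr_weighted_mean_le:
  fixes x y p l :: real
  assumes "0 \<le> x" "0 \<le> y" "1 \<le> p" "0 \<le> l" "l \<le> 1"
  shows "(l * x + (1 - l) * y) powr p \<le> l * x powr p + (1 - l) * y powr p"
proof (cases "l * x + (1 - l) * y = 0")
  case True
  then show ?thesis using assms by simp
next
  case False
  define c where "c = l * x + (1 - l) * y"
  have "0 \<le> c" unfolding c_def using assms by simp
  then have c: "0 < c" using False c_def by linarith
  have "c powr (p - 1) * c = c powr p"
    using c powr_add[of c "p - 1" 1] by simp
  moreover have "l * (p * c powr (p - 1) * x) + (1 - l) * (p * c powr (p - 1) * y) = p * (c powr (p - 1) * c)"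
    by (simp add: c_def algebra_simps)
  ultimately have "p * c powr p = l * (p * c powr (p - 1) * x) + (1 - l) * (p * c powr (p - 1) * y)"
    by simp
  also have "\<dots> \<le> l * (x powr p + (p - 1) * c powr p) + (1 - l) * (y powr p + (p - 1) * c powr p)"
    using assms c by (intro add_mono mult_left_mono powr_tangent_le) auto
  also have "\<dots> = l * x powr p + (1 - l) * y powr p + (p * c powr p - c powr p)"
    by (simp add: algebra_simps)
  finally show ?thesis unfolding c_def[symmetric] by linarith
qed

definition Lp_norm :: "'s measure \<Rightarrow> real \<Rightarrow> ('s \<Rightarrow> 'a::real_normed_vector) \<Rightarrow> real" where
  "Lp_norm M p f = (\<integral>x. norm (f x) powr p \<partial>M) powr (1 / p)"

lemma Lp_dist_eq_Lp_norm: "Lp_dist M p u v = Lp_norm M p (\<lambda>x. Lp_rep u x - Lp_rep v x)"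
  by (simp add: Lp_dist_def Lp_norm_def)

lemma Lp_norm_nonneg [simp]: "0 \<le> Lp_norm M p f"
  by (simp add: Lp_norm_def)

locale Lp_setting = complete_measure M for M :: "'s measure" +
  fixes p :: real
  assumes p: "1 \<le> p"
begin

lemma Lp_functions_iff:
  "f \<in> Lp_functions M p \<longleftrightarrow>
    strongly_measurable M f \<and> (\<integral>\<^sup>+x. ennreal (norm (f x) powr p) \<partial>M) < \<infinity>"
proof -
  have "(\<lambda>x. norm (f x) powr p) \<in> borel_measurable M" if "strongly_measurable M f"
    using borel_measurable_norm_strongly_measurable[OF that] by measurable
  then show ?thesis by (auto simp: Lp_functions_def integrable_iff_bounded)
qed

lemma Lp_norm_le_iff:
  assumes fin: "f \<in> Lp_functions M p" and a: "0 \<le> a"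
  shows "Lp_norm M p f \<le> a \<longleftrightarrow> (\<integral>\<^sup>+x. ennreal (norm (f x) powr p) \<partial>M) \<le> ennreal (a powr p)"
proof -
  let ?I = "\<integral>x. norm (f x) powr p \<partial>M"
  have int: "integrable M (\<lambda>x. norm (f x) powr p)" using fin by (simp add: Lp_functions_def)
  have I0: "0 \<le> ?I" by (intro Bochner_Integration.integral_nonneg) simp
  have "(\<integral>\<^sup>+x. ennreal (norm (f x) powr p) \<partial>M) = ennreal ?I"
    by (rule nn_integral_eq_integral[OF int]) simp
  moreover have "?I powr (1/p) \<le> a \<longleftrightarrow> ?I \<le> a powr p"
  proof
    assume "?I powr (1/p) \<le> a"
    then have "(?I powr (1/p)) powr p \<le> a powr p" using p by (intro powr_mono2) auto
    then show "?I \<le> a powr p" using p I0 by (simp add: powr_powr)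
  next
    assume "?I \<le> a powr p"
    then have "?I powr (1/p) \<le> (a powr p) powr (1/p)" using p I0 by (intro powr_mono2) auto
    then show "?I powr (1/p) \<le> a" using p a by (simp add: powr_powr)
  qed
  ultimately show ?thesis unfolding Lp_norm_def by simp
qed

lemma Lp_norm_leI:
  assumes f: "strongly_measurable M f" and a: "0 \<le> a"
    and le: "(\<integral>\<^sup>+x. ennreal (norm (f x) powr p) \<partial>M) \<le> ennreal (a powr p)"
  shows "f \<in> Lp_functions M p" "Lp_norm M p f \<le> a"
proof -
  show fL: "f \<in> Lp_functions M p"
    using f le by (auto simp: Lp_functions_iff elim!: order_le_less_trans)
  show "Lp_norm M p f \<le> a" using Lp_norm_le_iff[OF fL a] le by simp
qed

lemma nn_integral_powr_le_Lp_norm: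
  assumes "f \<in> Lp_functions M p" "Lp_norm M p f \<le> a"
  shows "(\<integral>\<^sup>+x. ennreal (norm (f x) powr p) \<partial>M) \<le> ennreal (a powr p)"
  using assms Lp_norm_le_iff[of f a] Lp_norm_nonneg[of M p f] by simp

text \<open>
  Minkowski's inequality. For \<open>a\<close>, \<open>b\<close> above the norms of \<open>f\<close> and \<open>g\<close>, write \<open>(\<parallel>f\<parallel> + \<parallel>g\<parallel>) / (a +
  b)\<close> as a weighted mean of \<open>\<parallel>f\<parallel> / a\<close> and \<open>\<parallel>g\<parallel> / b\<close> and apply convexity of the \<open>p\<close>-th power. The
  value types may differ, so that \<open>g\<close> can be a scalar error bound for a vector-valued \<open>f\<close>.
\<close>

lemma Lp_norm_triangle:
  assumes f: "f \<in> Lp_functions M p" and g: "g \<in> Lp_functions M p" and h: "strongly_measurable M h"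
    and le: "AE x in M. norm (h x) \<le> norm (f x) + norm (g x)"
  shows "h \<in> Lp_functions M p" "Lp_norm M p h \<le> Lp_norm M p f + Lp_norm M p g"
proof -
  have [measurable]: "(\<lambda>x. norm (f x)) \<in> borel_measurable M" "(\<lambda>x. norm (g x)) \<in> borel_measurable M"
    using f g by (auto simp: Lp_functions_iff intro: borel_measurable_norm_strongly_measurable)
  have bd: "(\<integral>\<^sup>+x. ennreal (norm (h x) powr p) \<partial>M) \<le> ennreal ((a + b) powr p)"
    if a: "Lp_norm M p f \<le> a" "0 < a" and b: "Lp_norm M p g \<le> b" "0 < b" for a b
  proof -
    let ?l = "a / (a + b)"
    have l: "0 \<le> ?l" "?l \<le> 1" "1 - ?l = b / (a + b)"
      using a b by (auto simp: field_simps)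
    \<comment> \<open>The factors are chosen such that \<open>?A * a\<^sup>p + ?B * b\<^sup>p = (a + b)\<^sup>p\<close>.\<close>
    let ?A = "ennreal ((a + b) powr p * ?l / a powr p)"
    let ?B = "ennreal ((a + b) powr p * (1 - ?l) / b powr p)"
    have "(\<integral>\<^sup>+x. ennreal (norm (h x) powr p) \<partial>M)
      \<le> (\<integral>\<^sup>+x. ?A * ennreal (norm (f x) powr p) + ?B * ennreal (norm (g x) powr p) \<partial>M)"
    proof (rule nn_integral_mono_AE, use le in eventually_elim)
      fix x assume hx: "norm (h x) \<le> norm (f x) + norm (g x)"
      let ?u = "norm (f x) / a" and ?v = "norm (g x) / b"
      have "norm (h x) \<le> (a + b) * (?l * ?u + (1 - ?l) * ?v)"
      proof -
        have "(a + b) * (?l * ?u) = norm (f x)" "(a + b) * ((1 - ?l) * ?v) = norm (g x)"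
          unfolding l(3) using a b by simp_all
        then show ?thesis using hx by (simp add: distrib_left)
      qed
      then have "norm (h x) powr p \<le> ((a + b) * (?l * ?u + (1 - ?l) * ?v)) powr p"
        using p by (intro powr_mono2) auto
      also have "\<dots> = (a + b) powr p * (?l * ?u + (1 - ?l) * ?v) powr p"
        using a b l by (intro powr_mult)
      also have "\<dots> \<le> (a + b) powr p * (?l * ?u powr p + (1 - ?l) * ?v powr p)"
        using a b l p by (intro mult_left_mono powr_weighted_mean_le) auto
      also have "\<dots> = (a + b) powr p * ?l / a powr p * norm (f x) powr p
            + (a + b) powr p * (1 - ?l) / b powr p * norm (g x) powr p"
        using a b by (simp add: powr_divide distrib_left)
      finally show "ennreal (norm (h x) powr p)
          \<le> ?A * ennreal (norm (f x) powr p) + ?B * ennreal (norm (g x) powr p)"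
        using a b l by (simp flip: ennreal_mult ennreal_plus)
    qed
    also have "\<dots> = ?A * (\<integral>\<^sup>+x. ennreal (norm (f x) powr p) \<partial>M) + ?B * (\<integral>\<^sup>+x. ennreal (norm (g x) powr p) \<partial>M)"
      by (simp add: nn_integral_add nn_integral_cmult)
    also have "\<dots> \<le> ?A * ennreal (a powr p) + ?B * ennreal (b powr p)"
      using a b f g by (intro add_mono mult_left_mono nn_integral_powr_le_Lp_norm) auto
    also have "\<dots> = ennreal ((a + b) powr p * ?l / a powr p * a powr p
            + (a + b) powr p * (1 - ?l) / b powr p * b powr p)"
      using a b l by (subst (1 2) ennreal_mult[symmetric]) (auto intro!: ennreal_plus[symmetric] mult_nonneg_nonneg)
    also have "(a + b) powr p * ?l / a powr p * a powr p
            + (a + b) powr p * (1 - ?l) / b powr p * b powr p = (a + b) powr p"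
      using a b by (simp add: right_diff_distrib)
    finally show ?thesis .
  qed
  have "(\<integral>\<^sup>+x. ennreal (norm (h x) powr p) \<partial>M)
      \<le> ennreal ((Lp_norm M p f + 1 + (Lp_norm M p g + 1)) powr p)"
    by (rule bd) (auto intro: add_nonneg_pos)
  then show hL: "h \<in> Lp_functions M p"
    using h by (intro Lp_norm_leI(1)) auto
  show "Lp_norm M p h \<le> Lp_norm M p f + Lp_norm M p g"
  proof (rule field_le_epsilon)
    fix e :: real assume "0 < e"
    have "(\<integral>\<^sup>+x. ennreal (norm (h x) powr p) \<partial>M)
        \<le> ennreal ((Lp_norm M p f + e/2 + (Lp_norm M p g + e/2)) powr p)"
      by (rule bd) (use \<open>0 < e\<close> in \<open>auto intro: add_nonneg_pos\<close>)
    then have "Lp_norm M p h \<le> Lp_norm M p f + e/2 + (Lp_norm M p g + e/2)"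
      using h \<open>0 < e\<close> by (intro Lp_norm_leI(2)) auto
    then show "Lp_norm M p h \<le> Lp_norm M p f + Lp_norm M p g + e" by simp
  qed
qed

lemma Lp_norm_mono_AE:
  assumes f: "f \<in> Lp_functions M p" and h: "strongly_measurable M h"
    and le: "AE x in M. norm (h x) \<le> norm (f x)"
  shows "h \<in> Lp_functions M p" "Lp_norm M p h \<le> Lp_norm M p f"
proof -
  have "(\<integral>\<^sup>+x. ennreal (norm (h x) powr p) \<partial>M) \<le> (\<integral>\<^sup>+x. ennreal (norm (f x) powr p) \<partial>M)"
    by (rule nn_integral_mono_AE, use le in eventually_elim) (use p in \<open>auto intro!: ennreal_leI powr_mono2\<close>)
  also have "\<dots> \<le> ennreal (Lp_norm M p f powr p)"
    using f by (rule nn_integral_powr_le_Lp_norm) simp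
  finally show "h \<in> Lp_functions M p" "Lp_norm M p h \<le> Lp_norm M p f"
    using Lp_norm_leI[OF h Lp_norm_nonneg] by auto
qed

text \<open>
  The embedding of \<open>L\<^sup>p\<close> into \<open>L\<^sup>1\<close> over a finite measure space, with the constant that the
  tangent inequality at \<open>c\<close> yields directly instead of the optimal one.
\<close>

lemma nn_integral_norm_le_Lp_norm:
  assumes f: "f \<in> Lp_functions M p" and c: "Lp_norm M p f \<le> c" "0 < c"
    and T: "emeasure M (space M) = ennreal T" "0 \<le> T"
  shows "(\<integral>\<^sup>+x. ennreal (norm (f x)) \<partial>M) \<le> ennreal ((1 + (p - 1) * T) / p * c)"
proof -
  have [measurable]: "(\<lambda>x. norm (f x)) \<in> borel_measurable M"
    using f by (auto simp: Lp_functions_iff intro: borel_measurable_norm_strongly_measurable)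
  let ?A = "c powr (1 - p) / p" and ?B = "(p - 1) / p * c"
  have "(\<integral>\<^sup>+x. ennreal (norm (f x)) \<partial>M)
    \<le> (\<integral>\<^sup>+x. ennreal ?A * ennreal (norm (f x) powr p) + ennreal ?B \<partial>M)"
  proof (rule nn_integral_mono)
    fix x
    have "c powr (1 - p) * (p * c powr (p - 1) * norm (f x))
        \<le> c powr (1 - p) * (norm (f x) powr p + (p - 1) * c powr p)"
      using c p by (intro mult_left_mono powr_tangent_le) auto
    moreover have "c powr (1 - p) * c powr (p - 1) = 1" "c powr (1 - p) * c powr p = c"
      using c by (simp_all flip: powr_add)
    ultimately have "p * norm (f x) \<le> c powr (1 - p) * norm (f x) powr p + (p - 1) * c"
      by (simp add: algebra_simps)
    then have "p * norm (f x) / p \<le> (c powr (1 - p) * norm (f x) powr p + (p - 1) * c) / p"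
      using p by (intro divide_right_mono) auto
    then have "norm (f x) \<le> ?A * norm (f x) powr p + ?B"
      using p by (simp add: add_divide_distrib)
    then show "ennreal (norm (f x)) \<le> ennreal ?A * ennreal (norm (f x) powr p) + ennreal ?B"
      using p c by (simp flip: ennreal_mult ennreal_plus)
  qed
  also have "\<dots> = ennreal ?A * (\<integral>\<^sup>+x. ennreal (norm (f x) powr p) \<partial>M) + ennreal ?B * ennreal T"
    by (simp add: nn_integral_add nn_integral_cmult T)
  also have "\<dots> \<le> ennreal ?A * ennreal (c powr p) + ennreal ?B * ennreal T"
    by (intro add_mono mult_left_mono nn_integral_powr_le_Lp_norm f c) auto
  also have "\<dots> = ennreal (?A * c powr p + ?B * T)"
    using p c T by (simp flip: ennreal_mult ennreal_plus)
  also have "?A * c powr p + ?B * T = (1 + (p - 1) * T) / p * c"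
  proof -
    have "c powr (1 - p) * c powr p = c" using c by (simp flip: powr_add)
    then have "?A * c powr p = c / p" by simp
    then show ?thesis using p by (simp add: field_simps)
  qed
  finally show ?thesis .
qed

lemma Lp_diff:
  assumes f: "f \<in> Lp_functions M p" and g: "g \<in> Lp_functions M p"
  shows "(\<lambda>x. f x - g x) \<in> Lp_functions M p"
  using f g by (intro Lp_norm_triangle(1)[OF f g])
    (auto simp: Lp_functions_iff intro!: strongly_measurable_diff norm_triangle_ineq4)

lemma Lp_norm_diff_triangle:
  assumes f: "f \<in> Lp_functions M p" and g: "g \<in> Lp_functions M p" and h: "h \<in> Lp_functions M p"
  shows "Lp_norm M p (\<lambda>x. f x - h x) \<le> Lp_norm M p (\<lambda>x. f x - g x) + Lp_norm M p (\<lambda>x. g x - h x)"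
proof (rule Lp_norm_triangle(2)[OF Lp_diff[OF f g] Lp_diff[OF g h]])
  show "strongly_measurable M (\<lambda>x. f x - h x)"
    using Lp_diff[OF f h] by (simp add: Lp_functions_iff)
  show "AE x in M. norm (f x - h x) \<le> norm (f x - g x) + norm (g x - h x)"
    by (intro AE_I2 norm_diff_triangle_ineq[of _ 0 _ 0, simplified] order_trans[OF _ norm_triangle_ineq]) simp
qed

lemma Lp_norm_diff_commute: "Lp_norm M p (\<lambda>x. f x - g x) = Lp_norm M p (\<lambda>x. g x - f x)"
  by (simp add: Lp_norm_def norm_minus_commute)

lemma Lp_norm_cong_AE:
  assumes "strongly_measurable M f" "strongly_measurable M g" "AE x in M. norm (f x) = norm (g x)"
  shows "Lp_norm M p f = Lp_norm M p g"
proof -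
  have [measurable]: "(\<lambda>x. norm (f x)) \<in> borel_measurable M" "(\<lambda>x. norm (g x)) \<in> borel_measurable M"
    using assms by (auto intro: borel_measurable_norm_strongly_measurable)
  have "(\<integral>x. norm (f x) powr p \<partial>M) = (\<integral>x. norm (g x) powr p \<partial>M)"
    by (rule integral_cong_AE) (use assms(3) in auto)
  then show ?thesis by (simp add: Lp_norm_def)
qed

lemma Lp_norm_eq_0:
  assumes f: "f \<in> Lp_functions M p" and 0: "Lp_norm M p f = 0"
  shows "AE x in M. f x = 0"
proof -
  have [measurable]: "(\<lambda>x. norm (f x)) \<in> borel_measurable M"
    using f by (auto simp: Lp_functions_iff intro: borel_measurable_norm_strongly_measurable)
  have "(\<integral>\<^sup>+x. ennreal (norm (f x) powr p) \<partial>M) \<le> ennreal (0 powr p)"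
    using 0 by (intro nn_integral_powr_le_Lp_norm f) simp
  then have "(\<integral>\<^sup>+x. ennreal (norm (f x) powr p) \<partial>M) = 0" by simp
  then have "AE x in M. ennreal (norm (f x) powr p) = 0"
    by (subst (asm) nn_integral_0_iff_AE) auto
  then show ?thesis by eventually_elim (auto simp: ennreal_eq_0_iff)
qed

lemma Lp_class_eq_iff:
  assumes "f \<in> Lp_functions M p"
  shows "Lp_class M p f = Lp_class M p g \<longleftrightarrow> (AE x in M. f x = g x)"
proof
  assume "Lp_class M p f = Lp_class M p g"
  moreover have "f \<in> Lp_class M p f" using assms by (simp add: Lp_class_def)
  ultimately have "f \<in> Lp_class M p g" by simp
  then show "AE x in M. f x = g x" by (simp add: Lp_class_def)
next
  assume *: "AE x in M. f x = g x"
  have "(AE x in M. h x = f x) \<longleftrightarrow> (AE x in M. h x = g x)" for h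
  proof
    assume "AE x in M. h x = f x"
    then show "AE x in M. h x = g x" using * by eventually_elim simp
  next
    assume "AE x in M. h x = g x"
    then show "AE x in M. h x = f x" using * by eventually_elim simp
  qed
  then show "Lp_class M p f = Lp_class M p g" by (simp add: Lp_class_def)
qed

lemma Lp_rep_in_Lp:
  assumes "u \<in> Lp_space M p"
  shows "Lp_rep u \<in> Lp_functions M p" "Lp_class M p (Lp_rep u) = u"
proof -
  obtain f where f: "f \<in> Lp_functions M p" "u = Lp_class M p f"
    using assms by (auto simp: Lp_space_def)
  then have "f \<in> u" by (simp add: Lp_class_def)
  then have "Lp_rep u \<in> u" unfolding Lp_rep_def by (rule someI[of "\<lambda>f. f \<in> u"])
  then have *: "Lp_rep u \<in> Lp_functions M p" "AE x in M. Lp_rep u x = f x"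
    using f(2) by (auto simp: Lp_class_def)
  then show "Lp_rep u \<in> Lp_functions M p" by simp
  show "Lp_class M p (Lp_rep u) = u"
    unfolding f(2) using * f(2) by (simp add: Lp_class_eq_iff)
qed

lemma Lp_class_in_Lp_space: "f \<in> Lp_functions M p \<Longrightarrow> Lp_class M p f \<in> Lp_space M p"
  by (simp add: Lp_space_def)

lemma AE_Lp_rep_Lp_class:
  assumes "f \<in> Lp_functions M p"
  shows "AE x in M. Lp_rep (Lp_class M p f) x = f x"
  using Lp_rep_in_Lp[OF Lp_class_in_Lp_space[OF assms]] by (simp add: Lp_class_eq_iff)

lemma Lp_dist_Lp_class:
  assumes f: "f \<in> Lp_functions M p" and g: "g \<in> Lp_functions M p"
  shows "Lp_dist M p (Lp_class M p f) (Lp_class M p g) = Lp_norm M p (\<lambda>x. f x - g x)"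
  unfolding Lp_dist_eq_Lp_norm
proof (rule Lp_norm_cong_AE)
  have "Lp_rep (Lp_class M p f) \<in> Lp_functions M p" "Lp_rep (Lp_class M p g) \<in> Lp_functions M p"
    using f g by (auto intro!: Lp_rep_in_Lp Lp_class_in_Lp_space)
  then show "strongly_measurable M (\<lambda>x. Lp_rep (Lp_class M p f) x - Lp_rep (Lp_class M p g) x)"
    using Lp_diff by (auto simp: Lp_functions_iff)
  show "strongly_measurable M (\<lambda>x. f x - g x)"
    using Lp_diff[OF f g] by (simp add: Lp_functions_iff)
  show "AE x in M. norm (Lp_rep (Lp_class M p f) x - Lp_rep (Lp_class M p g) x) = norm (f x - g x)"
    using AE_Lp_rep_Lp_class[OF f] AE_Lp_rep_Lp_class[OF g] by eventually_elim simp
qed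

lemma Metric_space_Lp: "Metric_space (Lp_space M p :: ('s \<Rightarrow> 'a::real_normed_vector) set set) (Lp_dist M p)"
proof
  fix u v w :: "('s \<Rightarrow> 'a) set"
  show "0 \<le> Lp_dist M p u v" by (simp add: Lp_dist_eq_Lp_norm)
  show "Lp_dist M p u v = Lp_dist M p v u"
    by (simp add: Lp_dist_def norm_minus_commute)
  assume u: "u \<in> Lp_space M p" and v: "v \<in> Lp_space M p"
  note U = Lp_rep_in_Lp[OF u] and V = Lp_rep_in_Lp[OF v]
  show "Lp_dist M p u v = 0 \<longleftrightarrow> u = v"
  proof
    assume "Lp_dist M p u v = 0"
    then have "AE x in M. Lp_rep u x - Lp_rep v x = 0"
      using Lp_norm_eq_0[OF Lp_diff[OF U(1) V(1)]] by (simp add: Lp_dist_eq_Lp_norm)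
    then have "Lp_class M p (Lp_rep u) = Lp_class M p (Lp_rep v)"
      using U(1) by (subst Lp_class_eq_iff) auto
    then show "u = v" using U V by simp
  next
    assume "u = v"
    then show "Lp_dist M p u v = 0" using p by (simp add: Lp_dist_def)
  qed
  assume w: "w \<in> Lp_space M p"
  show "Lp_dist M p u w \<le> Lp_dist M p u v + Lp_dist M p v w"
    unfolding Lp_dist_eq_Lp_norm
    by (intro Lp_norm_diff_triangle U V Lp_rep_in_Lp(1)[OF w])
qed

text \<open>
  The \<open>p\<close>-th powers of the functions \<open>2\<^sup>n g\<^sub>n\<close> have a summable series of integrals, so almost
  everywhere they tend to 0.
\<close>

lemma AE_eventually_small_if_fast:
  fixes g :: "nat \<Rightarrow> 's \<Rightarrow> 'a::real_normed_vector"
  assumes g: "\<And>n. g n \<in> Lp_functions M p"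
    and fast: "\<And>n. Lp_norm M p (g n) \<le> C * (1/4) ^ n"
  shows "AE x in M. eventually (\<lambda>n. norm (g n x) \<le> (1/2) ^ n) sequentially"
proof -
  let ?w = "\<lambda>n x. ennreal ((2 ^ n * norm (g n x)) powr p)"
  have [measurable]: "(\<lambda>x. norm (g n x)) \<in> borel_measurable M" for n
    using g by (intro borel_measurable_norm_strongly_measurable) (simp add: Lp_functions_iff)
  have C: "0 \<le> C" using order_trans[OF Lp_norm_nonneg fast[of 0]] by simp
  have int: "(\<integral>\<^sup>+x. ?w n x \<partial>M) \<le> ennreal (C powr p * (1/2) ^ n)" for n
  proof -
    have "(\<integral>\<^sup>+x. ?w n x \<partial>M)
      = ennreal ((2 ^ n) powr p) * (\<integral>\<^sup>+x. ennreal (norm (g n x) powr p) \<partial>M)"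
      by (subst nn_integral_cmult[symmetric]) (auto simp: powr_mult ennreal_mult)
    also have "\<dots> \<le> ennreal ((2 ^ n) powr p) * ennreal ((C * (1/4) ^ n) powr p)"
      by (intro mult_left_mono nn_integral_powr_le_Lp_norm g fast) simp
    also have "\<dots> = ennreal ((2 ^ n * (C * (1/4) ^ n)) powr p)"
      using C by (simp add: powr_mult ennreal_mult)
    also have "(2 ^ n * (C * (1/4) ^ n)) = C * (1/2::real) ^ n"
      by (simp add: power_divide field_simps flip: power_mult_distrib)
    also have "(C * (1/2::real) ^ n) powr p = C powr p * ((1/2) ^ n) powr p"
      using C by (intro powr_mult)
    also have "\<dots> \<le> C powr p * ((1/2) ^ n) powr 1"
      using p by (intro mult_left_mono powr_mono') (auto simp: power_le_one)
    finally show ?thesis by (simp add: ennreal_leI)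
  qed
  have "(\<integral>\<^sup>+x. (\<Sum>n. ?w n x) \<partial>M) = (\<Sum>n. \<integral>\<^sup>+x. ?w n x \<partial>M)"
    by (intro nn_integral_suminf) auto
  also have "\<dots> \<le> (\<Sum>n. ennreal (C powr p * (1/2) ^ n))"
    using int by (intro suminf_le) auto
  also have "\<dots> = ennreal (\<Sum>n. C powr p * (1/2) ^ n)"
    by (intro suminf_ennreal2 summable_mult summable_geometric) auto
  also have "\<dots> < \<infinity>" by simp
  finally have "AE x in M. (\<Sum>n. ?w n x) \<noteq> \<infinity>"
    by (intro nn_integral_noteq_infinite) auto
  then show ?thesis
  proof eventually_elim
    case (elim x)
    have "summable (\<lambda>n. (2 ^ n * norm (g n x)) powr p)"
      using elim by (intro summable_suminf_not_top) auto
    then have "(\<lambda>n. (2 ^ n * norm (g n x)) powr p) \<longlonglongrightarrow> 0"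
      by (rule summable_LIMSEQ_zero)
    then have "eventually (\<lambda>n. (2 ^ n * norm (g n x)) powr p < 1) sequentially"
      by (rule order_tendstoD) simp
    then show ?case
    proof eventually_elim
      case (elim n)
      have "2 ^ n * norm (g n x) \<le> 1"
      proof (rule ccontr)
        assume "\<not> ?thesis"
        then have "1 powr p \<le> (2 ^ n * norm (g n x)) powr p"
          using p by (intro powr_mono2) auto
        with elim show False by simp
      qed
      then show ?case by (simp add: power_divide field_simps)
    qed
  qed
qed

lemma AE_convergent_if_fast_Cauchy:
  fixes s :: "nat \<Rightarrow> 's \<Rightarrow> 'a::banach"
  assumes s: "\<And>n. s n \<in> Lp_functions M p"
    and fast: "\<And>n. Lp_norm M p (\<lambda>x. s (Suc n) x - s n x) \<le> C * (1/4) ^ n"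
  shows "AE x in M. convergent (\<lambda>n. s n x)"
  using AE_eventually_small_if_fast[OF Lp_diff[OF s s] fast]
proof eventually_elim
  case (elim x)
  then have "summable (\<lambda>n. s (Suc n) x - s n x)"
    by (rule summable_comparison_test_ev) (intro summable_geometric, simp)
  then have "convergent (\<lambda>n. \<Sum>i<n. s (Suc i) x - s i x)"
    by (simp add: summable_iff_convergent)
  moreover have "(\<Sum>i<n. s (Suc i) x - s i x) = s n x - s 0 x" for n
    by (rule sum_lessThan_telescope)
  ultimately have "convergent (\<lambda>n. s n x - s 0 x)" by simp
  then have "convergent (\<lambda>n. (s n x - s 0 x) + s 0 x)"
    by (intro convergent_add convergent_const)
  then show ?case by simp
qed

lemma simple_function_near_Lp:
  assumes f: "f \<in> Lp_functions M p" and e: "0 < e"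
  obtains s where "simple_function M s" "s \<in> Lp_functions M p" "Lp_norm M p (\<lambda>x. f x - s x) \<le> e"
proof -
  have f': "strongly_measurable M f" "(\<integral>\<^sup>+x. ennreal (norm (f x) powr p) \<partial>M) < \<infinity>"
    using f by (auto simp: Lp_functions_iff)
  obtain s where s: "\<And>i. simple_function M (s i)"
    "\<And>i x. x \<in> space M \<Longrightarrow> norm (s i x) \<le> 2 * norm (f x)"
    "(\<lambda>i. \<integral>\<^sup>+x. ennreal (norm (f x - s i x) powr p) \<partial>M) \<longlonglongrightarrow> 0"
    by (rule simple_functions_dense_Lp[OF f'(1) p f'(2)]) blast
  have "eventually (\<lambda>i. (\<integral>\<^sup>+x. ennreal (norm (f x - s i x) powr p) \<partial>M) < ennreal (e powr p)) sequentially"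
    using s(3) e by (intro order_tendstoD) auto
  then obtain i where i: "(\<integral>\<^sup>+x. ennreal (norm (f x - s i x) powr p) \<partial>M) < ennreal (e powr p)"
    by (auto simp: eventually_sequentially)
  have d: "strongly_measurable M (\<lambda>x. f x - s i x)"
    by (intro strongly_measurable_diff f' strongly_measurable_simple_function s)
  show ?thesis
  proof
    show "simple_function M (s i)" by (rule s)
    show "s i \<in> Lp_functions M p"
      by (rule Lp_norm_triangle(1)[OF f f])
        (auto intro!: AE_I2 strongly_measurable_simple_function s(1) order_trans[OF s(2)])
    show "Lp_norm M p (\<lambda>x. f x - s i x) \<le> e"
      using d e i by (intro Lp_norm_leI(2)) auto
  qed
qed

text \<open>
  The Riesz-Fischer theorem. Strong measurability of the limit is not automatic without
  separability: the limit is taken of simple functions close to the members of a rapidly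
  converging subsequence, so that it is strongly measurable by definition.
\<close>

lemma mcomplete_Lp:
  "Metric_space.mcomplete (Lp_space M p :: ('s \<Rightarrow> 'a::banach) set set) (Lp_dist M p)"
proof -
  interpret L: Metric_space "Lp_space M p :: ('s \<Rightarrow> 'a) set set" "Lp_dist M p"
    by (rule Metric_space_Lp)
  show ?thesis unfolding L.mcomplete_def
  proof (intro allI impI)
    fix \<sigma> :: "nat \<Rightarrow> ('s \<Rightarrow> 'a) set" assume \<sigma>: "L.MCauchy \<sigma>"
    then have \<sigma>L: "\<sigma> n \<in> Lp_space M p" for n by (auto simp: L.MCauchy_def)
    have "\<exists>N. \<forall>m m'. N \<le> m \<longrightarrow> N \<le> m' \<longrightarrow> Lp_dist M p (\<sigma> m) (\<sigma> m') < (1/4) ^ n" for n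
      using \<sigma> unfolding L.MCauchy_def by (meson zero_less_power zero_less_divide_1_iff zero_less_numeral)
    then obtain N where N: "\<And>n m m'. N n \<le> m \<Longrightarrow> N n \<le> m' \<Longrightarrow> Lp_dist M p (\<sigma> m) (\<sigma> m') < (1/4) ^ n"
      by metis
    \<comment> \<open>A strictly increasing sequence above \<open>N\<close>.\<close>
    define r where "r n = (\<Sum>i\<le>n. N i) + n" for n
    have r: "strict_mono r" by (simp add: strict_mono_Suc_iff r_def)
    have rN: "N n \<le> r m" if "n \<le> m" for n m
      using that member_le_sum[of n "{..m}" N] by (simp add: r_def trans_le_add1)
    define f where "f n = Lp_rep (\<sigma> (r n))" for n
    have f: "f n \<in> Lp_functions M p" for n
      unfolding f_def by (intro Lp_rep_in_Lp \<sigma>L)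
    have ff: "Lp_norm M p (\<lambda>x. f n x - f m x) \<le> (1/4) ^ n" if "n \<le> m" for n m
      using N[OF rN[of n n] rN[OF that]] by (simp add: Lp_dist_eq_Lp_norm f_def)
    have "\<exists>s. simple_function M s \<and> s \<in> Lp_functions M p \<and> Lp_norm M p (\<lambda>x. f n x - s x) \<le> (1/4) ^ n" for n
      using simple_function_near_Lp[OF f[of n], of "(1/4) ^ n"] by (metis zero_less_power zero_less_divide_1_iff zero_less_numeral)
    then obtain s where s: "\<And>n. simple_function M (s n)" "\<And>n. s n \<in> Lp_functions M p"
      "\<And>n. Lp_norm M p (\<lambda>x. f n x - s n x) \<le> (1/4) ^ n" by metis
    have ss: "Lp_norm M p (\<lambda>x. s m x - s n x) \<le> 3 * (1/4) ^ n" if "n \<le> m" for n m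
    proof -
      have "Lp_norm M p (\<lambda>x. s m x - s n x)
          \<le> Lp_norm M p (\<lambda>x. s m x - f m x) + Lp_norm M p (\<lambda>x. f m x - s n x)"
        by (intro Lp_norm_diff_triangle s f)
      also have "Lp_norm M p (\<lambda>x. f m x - s n x)
          \<le> Lp_norm M p (\<lambda>x. f m x - f n x) + Lp_norm M p (\<lambda>x. f n x - s n x)"
        by (intro Lp_norm_diff_triangle s f)
      finally have "Lp_norm M p (\<lambda>x. s m x - s n x) \<le> (1/4) ^ m + ((1/4) ^ n + (1/4) ^ n)"
        using s(3)[of m] s(3)[of n] ff[OF that] Lp_norm_diff_commute[of "s m" "f m"]
          Lp_norm_diff_commute[of "f m" "f n"] by linarith
      moreover have "(1/4) ^ m \<le> (1/4::real) ^ n" using that by (intro power_decreasing) auto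
      ultimately show ?thesis by linarith
    qed
    define g where "g x = lim (\<lambda>n. s n x)" for x
    have "AE x in M. convergent (\<lambda>n. s n x)"
      by (rule AE_convergent_if_fast_Cauchy[of s 3]) (auto intro: s ss)
    then have lim: "AE x in M. (\<lambda>n. s n x) \<longlonglongrightarrow> g x"
      by eventually_elim (simp add: g_def convergent_LIMSEQ_iff)
    have gm: "strongly_measurable M g"
      unfolding strongly_measurable_def using s(1) lim by blast
    have sg: "(\<integral>\<^sup>+x. ennreal (norm (s n x - g x) powr p) \<partial>M) \<le> ennreal ((3 * (1/4) ^ n) powr p)" for n
    proof -
      have [measurable]: "(\<lambda>x. norm (s m x - s n x)) \<in> borel_measurable M" for m
        using Lp_diff[OF s(2) s(2)] by (intro borel_measurable_norm_strongly_measurable) (simp add: Lp_functions_iff)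
      have "(\<integral>\<^sup>+x. ennreal (norm (s n x - g x) powr p) \<partial>M)
          = (\<integral>\<^sup>+x. liminf (\<lambda>m. ennreal (norm (s m x - s n x) powr p)) \<partial>M)"
      proof (rule nn_integral_cong_AE, use lim in eventually_elim)
        fix x assume "(\<lambda>n. s n x) \<longlonglongrightarrow> g x"
        then have "(\<lambda>m. ennreal (norm (s m x - s n x) powr p)) \<longlonglongrightarrow> ennreal (norm (g x - s n x) powr p)"
          using p by (intro tendsto_ennrealI tendsto_powr2 tendsto_intros) auto
        from lim_imp_Liminf[OF trivial_limit_sequentially this]
        show "ennreal (norm (s n x - g x) powr p) = liminf (\<lambda>m. ennreal (norm (s m x - s n x) powr p))"
          by (simp add: norm_minus_commute)
      qed
      also have "\<dots> \<le> liminf (\<lambda>m. \<integral>\<^sup>+x. ennreal (norm (s m x - s n x) powr p) \<partial>M)"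
        by (rule nn_integral_liminf) auto
      also have "\<dots> \<le> limsup (\<lambda>m. \<integral>\<^sup>+x. ennreal (norm (s m x - s n x) powr p) \<partial>M)"
        by (rule Liminf_le_Limsup) simp
      also have "\<dots> \<le> ennreal ((3 * (1/4) ^ n) powr p)"
      proof (rule Limsup_bounded)
        show "\<forall>\<^sub>F m in sequentially. (\<integral>\<^sup>+x. ennreal (norm (s m x - s n x) powr p) \<partial>M) \<le> ennreal ((3 * (1/4) ^ n) powr p)"
          using eventually_ge_at_top[of n]
          by eventually_elim (intro nn_integral_powr_le_Lp_norm Lp_diff s ss)
      qed
      finally show ?thesis .
    qed
    have sgm: "strongly_measurable M (\<lambda>x. s n x - g x)" for n
      by (intro strongly_measurable_diff strongly_measurable_simple_function s gm)
    have sgL: "(\<lambda>x. s n x - g x) \<in> Lp_functions M p" "Lp_norm M p (\<lambda>x. s n x - g x) \<le> 3 * (1/4) ^ n" for n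
      using Lp_norm_leI[OF sgm _ sg] by auto
    have gL: "g \<in> Lp_functions M p"
    proof (rule Lp_norm_triangle(1)[OF s(2)[of 0] sgL(1)[of 0] gm])
      show "AE x in M. norm (g x) \<le> norm (s 0 x) + norm (s 0 x - g x)"
      proof (rule AE_I2)
        fix x show "norm (g x) \<le> norm (s 0 x) + norm (s 0 x - g x)"
          using norm_triangle_ineq4[of "s 0 x" "s 0 x - g x"] by simp
      qed
    qed
    have dist: "Lp_dist M p (\<sigma> (r n)) (Lp_class M p g) \<le> 4 * (1/4) ^ n" for n
    proof -
      have "Lp_dist M p (\<sigma> (r n)) (Lp_class M p g) = Lp_norm M p (\<lambda>x. f n x - g x)"
        using Lp_dist_Lp_class[OF f[of n] gL] Lp_rep_in_Lp(2)[OF \<sigma>L] by (simp add: f_def)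
      also have "\<dots> \<le> Lp_norm M p (\<lambda>x. f n x - s n x) + Lp_norm M p (\<lambda>x. s n x - g x)"
        by (intro Lp_norm_diff_triangle f s gL)
      also have "\<dots> \<le> 4 * (1/4) ^ n" using s(3)[of n] sgL(2)[of n] by simp
      finally show ?thesis .
    qed
    have "limitin L.mtopology (\<sigma> \<circ> r) (Lp_class M p g) sequentially"
    proof (subst L.limit_metric_sequentially, intro conjI allI impI)
      show "Lp_class M p g \<in> Lp_space M p" by (rule Lp_class_in_Lp_space[OF gL])
      fix e :: real assume "0 < e"
      have "(\<lambda>n. 4 * (1/4::real) ^ n) \<longlonglongrightarrow> 4 * 0"
        by (intro tendsto_intros LIMSEQ_power_zero) auto
      then have "eventually (\<lambda>n. 4 * (1/4::real) ^ n < e) sequentially"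
        using \<open>0 < e\<close> by (intro order_tendstoD) auto
      then obtain K where "\<And>n. K \<le> n \<Longrightarrow> 4 * (1/4::real) ^ n < e"
        by (auto simp: eventually_sequentially)
      then show "\<exists>N. \<forall>n\<ge>N. (\<sigma> \<circ> r) n \<in> Lp_space M p \<and> Lp_dist M p ((\<sigma> \<circ> r) n) (Lp_class M p g) < e"
        using dist \<sigma>L by (intro exI[of _ K]) (auto intro: order_le_less_trans)
    qed
    then show "\<exists>x. limitin L.mtopology \<sigma> x sequentially"
      using L.MCauchy_convergent_subsequence[OF \<sigma> r] by blast
  qed
qed

end


section \<open>Convolution estimates and the averaged Abel kernel\<close>

lemma nn_integral_reflect_shift:
  fixes f :: "real \<Rightarrow> ennreal"
  assumes [measurable]: "f \<in> borel_measurable borel"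
  shows "(\<integral>\<^sup>+s. f (t - s) \<partial>lborel) = (\<integral>\<^sup>+s. f s \<partial>lborel)"
    and "(\<integral>\<^sup>+s. f (s - t) \<partial>lborel) = (\<integral>\<^sup>+s. f s \<partial>lborel)"
  using nn_integral_real_affine[of f "-1" t] nn_integral_real_affine[of f "1" "-t"] by simp_all

text \<open>
  Young's inequality \<open>\<parallel>D * \<phi>\<parallel>\<^sub>p \<le> \<parallel>D\<parallel>\<^sub>1 \<parallel>\<phi>\<parallel>\<^sub>p\<close>. With \<open>e = (D * \<phi>)(t)\<close>, the tangent inequality at
  \<open>c = e / m\<close>, integrated against \<open>D(t - s) ds\<close>, gives \<open>e\<^sup>p \<le> m\<^sup>p\<^sup>-\<^sup>1 (D * \<phi>\<^sup>p)(t)\<close>; then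
  Tonelli's theorem applies.
\<close>

lemma nn_integral_convolution_power_le:
  fixes D \<phi> :: "real \<Rightarrow> real"
  assumes D[measurable]: "D \<in> borel_measurable borel" and D0: "\<And>x. 0 \<le> D x"
    and Dm: "(\<integral>\<^sup>+x. ennreal (D x) \<partial>lborel) \<le> ennreal m" and m: "0 < m"
    and \<phi>[measurable]: "\<phi> \<in> borel_measurable borel" and \<phi>0: "\<And>x. 0 \<le> \<phi> x" and p: "1 \<le> p"
    and fin: "(\<integral>\<^sup>+x. ennreal (\<phi> x powr p) \<partial>lborel) < \<infinity>"
  shows "(\<lambda>t. \<integral>\<^sup>+s. ennreal (D (t - s) * \<phi> s) \<partial>lborel) \<in> borel_measurable borel"
    and "AE t in lborel. (\<integral>\<^sup>+s. ennreal (D (t - s) * \<phi> s) \<partial>lborel) < \<infinity>"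
    and "(\<integral>\<^sup>+t. ennreal (enn2real (\<integral>\<^sup>+s. ennreal (D (t - s) * \<phi> s) \<partial>lborel) powr p) \<partial>lborel)
      \<le> ennreal (m powr p) * (\<integral>\<^sup>+x. ennreal (\<phi> x powr p) \<partial>lborel)"
proof -
  let ?C = "\<lambda>t. \<integral>\<^sup>+s. ennreal (D (t - s) * \<phi> s) \<partial>lborel"
  let ?Q = "\<lambda>t. \<integral>\<^sup>+s. ennreal (D (t - s) * \<phi> s powr p) \<partial>lborel"
  show C[measurable]: "?C \<in> borel_measurable borel" by measurable
  have Q[measurable]: "?Q \<in> borel_measurable borel" by measurable
  have Dt: "(\<integral>\<^sup>+s. ennreal (D (t - s)) \<partial>lborel) \<le> ennreal m" for t
    using Dm nn_integral_reflect_shift(1)[of "\<lambda>x. ennreal (D x)" t] by simp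
  have intQ: "(\<integral>\<^sup>+t. ?Q t \<partial>lborel) \<le> ennreal m * (\<integral>\<^sup>+x. ennreal (\<phi> x powr p) \<partial>lborel)"
  proof -
    have "(\<integral>\<^sup>+t. ?Q t \<partial>lborel) = (\<integral>\<^sup>+s. \<integral>\<^sup>+t. ennreal (D (t - s) * \<phi> s powr p) \<partial>lborel \<partial>lborel)"
      by (rule lborel_pair.Fubini') measurable
    also have "\<dots> = (\<integral>\<^sup>+s. (\<integral>\<^sup>+t. ennreal (D (t - s)) \<partial>lborel) * ennreal (\<phi> s powr p) \<partial>lborel)"
      by (intro nn_integral_cong) (simp add: ennreal_mult D0 nn_integral_multc)
    also have "\<dots> \<le> (\<integral>\<^sup>+s. ennreal m * ennreal (\<phi> s powr p) \<partial>lborel)"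
      using Dm nn_integral_reflect_shift(2)[of "\<lambda>x. ennreal (D x)"]
      by (intro nn_integral_mono mult_right_mono) auto
    also have "\<dots> = ennreal m * (\<integral>\<^sup>+x. ennreal (\<phi> x powr p) \<partial>lborel)"
      by (rule nn_integral_cmult) measurable
    finally show ?thesis .
  qed
  also have "\<dots> < \<infinity>" using fin by (simp add: ennreal_mult_less_top)
  finally have "AE t in lborel. ?Q t \<noteq> \<infinity>" by (intro nn_integral_noteq_infinite) auto
  then show "AE t in lborel. ?C t < \<infinity>"
  proof eventually_elim
    case (elim t)
    have "?C t \<le> (\<integral>\<^sup>+s. ennreal (D (t - s)) + ennreal (D (t - s) * \<phi> s powr p) \<partial>lborel)"
    proof (rule nn_integral_mono)
      fix s
      have "\<phi> s \<le> 1 + \<phi> s powr p"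
      proof (cases "\<phi> s \<le> 1")
        case False
        then have "\<phi> s powr 1 \<le> \<phi> s powr p" using p by (intro powr_mono) auto
        then show ?thesis using False by simp
      qed (simp add: add_increasing2)
      then have "D (t - s) * \<phi> s \<le> D (t - s) * (1 + \<phi> s powr p)"
        by (intro mult_left_mono D0)
      then show "ennreal (D (t - s) * \<phi> s) \<le> ennreal (D (t - s)) + ennreal (D (t - s) * \<phi> s powr p)"
        by (simp add: D0 distrib_left ennreal_leI flip: ennreal_plus)
    qed
    also have "\<dots> = (\<integral>\<^sup>+s. ennreal (D (t - s)) \<partial>lborel) + ?Q t"
      by (rule nn_integral_add) measurable
    also have "\<dots> < \<infinity>"
      using elim order_le_less_trans[OF Dt[of t] ennreal_less_top] by (simp add: less_top)
    finally show ?case .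
  qed
  have pw: "ennreal (enn2real (?C t) powr p) \<le> ennreal (m powr (p - 1)) * ?Q t" for t
  proof (cases "enn2real (?C t) = 0 \<or> ?Q t = \<infinity>")
    case True
    then show ?thesis
    proof
      assume "?Q t = \<infinity>"
      then show ?thesis using m by (simp add: ennreal_mult_top)
    qed simp
  next
    case False
    define e where "e = enn2real (?C t)"
    have e: "0 < e" "?C t = ennreal e"
      using False unfolding e_def
      by (auto simp: less_le) (metis ennreal_enn2real_if enn2real_top)
    obtain q where q: "?Q t = ennreal q" "0 \<le> q" using False by (cases "?Q t") auto
    define c where "c = e / m"
    have c: "0 < c" "e = c * m" using e m by (auto simp: c_def)
    have "ennreal (p * c powr (p - 1) * e) = ennreal (p * c powr (p - 1)) * ?C t"
      using e p by (simp add: ennreal_mult)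
    also have "\<dots> = (\<integral>\<^sup>+s. ennreal (p * c powr (p - 1)) * ennreal (D (t - s) * \<phi> s) \<partial>lborel)"
      by (rule nn_integral_cmult[symmetric]) measurable
    also have "\<dots> \<le> (\<integral>\<^sup>+s. ennreal (D (t - s) * \<phi> s powr p) + ennreal ((p - 1) * c powr p) * ennreal (D (t - s)) \<partial>lborel)"
    proof (rule nn_integral_mono)
      fix s
      have "D (t - s) * (p * c powr (p - 1) * \<phi> s) \<le> D (t - s) * (\<phi> s powr p + (p - 1) * c powr p)"
        using c p \<phi>0 by (intro mult_left_mono D0 powr_tangent_le)
      then have "p * c powr (p - 1) * (D (t - s) * \<phi> s) \<le> D (t - s) * \<phi> s powr p + (p - 1) * c powr p * D (t - s)"
        by (simp add: algebra_simps)
      then show "ennreal (p * c powr (p - 1)) * ennreal (D (t - s) * \<phi> s)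
          \<le> ennreal (D (t - s) * \<phi> s powr p) + ennreal ((p - 1) * c powr p) * ennreal (D (t - s))"
        using p D0 \<phi>0 by (simp flip: ennreal_mult ennreal_plus)
    qed
    also have "\<dots> = ?Q t + ennreal ((p - 1) * c powr p) * (\<integral>\<^sup>+s. ennreal (D (t - s)) \<partial>lborel)"
      by (simp add: nn_integral_add nn_integral_cmult)
    also have "\<dots> \<le> ennreal q + ennreal ((p - 1) * c powr p) * ennreal m"
      using q Dt by (intro add_mono mult_left_mono) auto
    also have "\<dots> = ennreal (q + (p - 1) * c powr p * m)"
      using q p m by (simp flip: ennreal_mult ennreal_plus)
    finally have "p * c powr (p - 1) * e \<le> q + (p - 1) * c powr p * m"
      using q p m by (subst (asm) ennreal_le_iff) auto
    moreover have "c powr (p - 1) * c = c powr p"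
      using c powr_add[of c "p - 1" 1] by simp
    then have "p * c powr (p - 1) * e = p * c powr p * m"
      by (subst c(2)) (metis mult.assoc)
    ultimately have "p * c powr p * m \<le> q + (p - 1) * c powr p * m" by simp
    then have "c powr p * m \<le> q" by (simp add: algebra_simps)
    then have "m powr (p - 1) * (c powr p * m) \<le> m powr (p - 1) * q"
      by (intro mult_left_mono) auto
    moreover have "m powr (p - 1) * (c powr p * m) = (m powr (p - 1) * m powr 1) * c powr p"
      using m by simp
    moreover have "m powr (p - 1) * m powr 1 = m powr p"
      by (simp only: powr_add[symmetric]) simp
    moreover have "e powr p = m powr p * c powr p"
      using c m by (simp add: powr_mult)
    ultimately have "e powr p \<le> m powr (p - 1) * q" by simp
    then show ?thesis unfolding e_def[symmetric] q(1) using q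
      by (simp add: ennreal_leI flip: ennreal_mult)
  qed
  have "(\<integral>\<^sup>+t. ennreal (enn2real (?C t) powr p) \<partial>lborel) \<le> (\<integral>\<^sup>+t. ennreal (m powr (p - 1)) * ?Q t \<partial>lborel)"
    by (intro nn_integral_mono pw)
  also have "\<dots> = ennreal (m powr (p - 1)) * (\<integral>\<^sup>+t. ?Q t \<partial>lborel)"
    by (rule nn_integral_cmult) measurable
  also have "\<dots> \<le> ennreal (m powr (p - 1)) * (ennreal m * (\<integral>\<^sup>+x. ennreal (\<phi> x powr p) \<partial>lborel))"
    using intQ by (intro mult_left_mono) auto
  also have "\<dots> = ennreal (m powr (p - 1) * m powr 1) * (\<integral>\<^sup>+x. ennreal (\<phi> x powr p) \<partial>lborel)"
    using m by (simp add: ennreal_mult mult.assoc)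
  also have "m powr (p - 1) * m powr 1 = m powr p"
    by (simp only: powr_add[symmetric]) simp
  finally show "(\<integral>\<^sup>+t. ennreal (enn2real (?C t) powr p) \<partial>lborel)
      \<le> ennreal (m powr p) * (\<integral>\<^sup>+x. ennreal (\<phi> x powr p) \<partial>lborel)" .
qed

text \<open>
  Tonelli's theorem needs Borel functions, while the norm of a strongly measurable function is
  only Lebesgue measurable; for fixed \<open>t\<close> the convolution does not see the difference.
\<close>

lemma nn_integral_convolution_power_le_lebesgue:
  fixes D \<phi> :: "real \<Rightarrow> real"
  assumes D[measurable]: "D \<in> borel_measurable borel" and D0: "\<And>x. 0 \<le> D x"
    and Dm: "(\<integral>\<^sup>+x. ennreal (D x) \<partial>lborel) \<le> ennreal m" and m: "0 < m"
    and \<phi>: "\<phi> \<in> borel_measurable lebesgue" and \<phi>0: "\<And>x. 0 \<le> \<phi> x" and p: "1 \<le> p"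
    and fin: "(\<integral>\<^sup>+x. ennreal (\<phi> x powr p) \<partial>lebesgue) < \<infinity>"
  shows "(\<lambda>t. \<integral>\<^sup>+s. ennreal (D (t - s) * \<phi> s) \<partial>lebesgue) \<in> borel_measurable borel"
    and "AE t in lebesgue. (\<integral>\<^sup>+s. ennreal (D (t - s) * \<phi> s) \<partial>lebesgue) < \<infinity>"
    and "(\<integral>\<^sup>+t. ennreal (enn2real (\<integral>\<^sup>+s. ennreal (D (t - s) * \<phi> s) \<partial>lebesgue) powr p) \<partial>lebesgue)
      \<le> ennreal (m powr p) * (\<integral>\<^sup>+x. ennreal (\<phi> x powr p) \<partial>lebesgue)"
proof -
  obtain \<phi>' where \<phi>': "\<phi>' \<in> borel_measurable lborel" "AE x in lborel. \<phi> x = \<phi>' x"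
    using completion_ex_borel_measurable_real[OF \<phi>] by auto
  define \<psi> where "\<psi> x = max 0 (\<phi>' x)" for x
  have \<psi>: "\<psi> \<in> borel_measurable borel" unfolding \<psi>_def using \<phi>'(1) by simp
  have eq: "AE x in lborel. \<phi> x = \<psi> x"
    using \<phi>'(2) by eventually_elim (metis \<psi>_def \<phi>0 max_absorb2)
  have conv: "(\<integral>\<^sup>+s. ennreal (D (t - s) * \<phi> s) \<partial>lebesgue) = (\<integral>\<^sup>+s. ennreal (D (t - s) * \<psi> s) \<partial>lborel)" for t
    unfolding nn_integral_completion
    by (rule nn_integral_cong_AE, use eq in eventually_elim) simp
  have pow: "(\<integral>\<^sup>+s. ennreal (\<phi> s powr p) \<partial>lebesgue) = (\<integral>\<^sup>+s. ennreal (\<psi> s powr p) \<partial>lborel)"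
    unfolding nn_integral_completion
    by (rule nn_integral_cong_AE, use eq in eventually_elim) simp
  have \<psi>0: "0 \<le> \<psi> x" for x by (simp add: \<psi>_def)
  note * = nn_integral_convolution_power_le[OF D D0 Dm m \<psi> \<psi>0 p fin[unfolded pow]]
  show "(\<lambda>t. \<integral>\<^sup>+s. ennreal (D (t - s) * \<phi> s) \<partial>lebesgue) \<in> borel_measurable borel"
    unfolding conv by (rule *(1))
  show "AE t in lebesgue. (\<integral>\<^sup>+s. ennreal (D (t - s) * \<phi> s) \<partial>lebesgue) < \<infinity>"
    unfolding conv by (rule AE_completion[OF *(2)])
  show "(\<integral>\<^sup>+t. ennreal (enn2real (\<integral>\<^sup>+s. ennreal (D (t - s) * \<phi> s) \<partial>lebesgue) powr p) \<partial>lebesgue)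
      \<le> ennreal (m powr p) * (\<integral>\<^sup>+x. ennreal (\<phi> x powr p) \<partial>lebesgue)"
    unfolding conv pow using *(3) by (simp add: nn_integral_completion)
qed

text \<open>
  The truncated power, which vanishes on the negative half line also for \<open>a \<le> 0\<close>. For \<open>a = \<alpha> -
  1\<close> it is the kernel of \<open>J\<^sup>\<alpha>\<close>, for \<open>a = \<alpha>\<close> that of \<open>J\<^sup>1\<^sup>+\<^sup>\<alpha>\<close>, both up to a constant.
\<close>

definition tpower :: "real \<Rightarrow> real \<Rightarrow> real" where
  "tpower a x = max 0 x powr a"

text \<open>
  A bound for the distance of the kernel of \<open>J\<^sup>\<alpha>\<close> at \<open>x\<close> from its mean values over intervals of
  length at least \<open>h / 2\<close> inside \<open>[x - h, x + h]\<close>. To the right of \<open>h\<close> the kernel is monotone on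
  the whole interval and its oscillation is the bound; near the singularity at 0 the kernel and
  its mean value are bounded separately.
\<close>

definition kernel_gap :: "real \<Rightarrow> real \<Rightarrow> real \<Rightarrow> real" where
  "kernel_gap \<alpha> h x =
    (if h < x then \<bar>tpower (\<alpha> - 1) (x - h) - tpower (\<alpha> - 1) (x + h)\<bar>
     else if - h < x then tpower (\<alpha> - 1) x + 2 * tpower \<alpha> (2 * h) / (\<alpha> * h)
     else 0)"

definition kernel_gap_mass :: "real \<Rightarrow> real \<Rightarrow> real \<Rightarrow> real" where
  "kernel_gap_mass \<alpha> T h =
    \<bar>tpower \<alpha> (T - h) - tpower \<alpha> (T + h) + tpower \<alpha> (2 * h)\<bar> / \<alpha>
      + (tpower \<alpha> h + 4 * tpower \<alpha> (2 * h)) / \<alpha>"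

lemma tpower_nonneg [simp]: "0 \<le> tpower a x" by (simp add: tpower_def)
lemma tpower_eq_0 [simp]: "x \<le> 0 \<Longrightarrow> tpower a x = 0" by (simp add: tpower_def max_absorb1)
lemma tpower_eq_powr: "0 \<le> x \<Longrightarrow> tpower a x = x powr a" by (simp add: tpower_def max_absorb2)
lemma tpower_mono: "0 \<le> a \<Longrightarrow> x \<le> y \<Longrightarrow> tpower a x \<le> tpower a y"
  unfolding tpower_def by (intro powr_mono2) auto
lemma tpower_measurable [measurable]: "tpower a \<in> borel_measurable borel"
  unfolding tpower_def[abs_def] by measurable
lemma continuous_on_tpower: "0 < a \<Longrightarrow> continuous_on S (tpower a)"
  unfolding tpower_def[abs_def] by (intro continuous_on_powr' continuous_intros) auto
lemma kernel_gap_measurable [measurable]: "kernel_gap \<alpha> h \<in> borel_measurable borel"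
  unfolding kernel_gap_def[abs_def] by measurable
lemma kernel_gap_nonneg: "0 < \<alpha> \<Longrightarrow> 0 < h \<Longrightarrow> 0 \<le> kernel_gap \<alpha> h x"
  by (simp add: kernel_gap_def)

lemma DERIV_tpower: "0 < x \<Longrightarrow> (tpower a has_real_derivative a * tpower (a - 1) x) (at x)"
proof -
  assume x: "0 < x"
  have "((\<lambda>x. x powr a) has_real_derivative a * x powr (a - 1)) (at x)"
    using x by (rule has_real_derivative_powr)
  then show ?thesis
  proof (rule DERIV_cong_ev[OF refl _ _, THEN iffD1, rotated 2])
    show "\<forall>\<^sub>F x in nhds x. x powr a = tpower a x"
      using eventually_nhds_in_open[of "{0<..}" x] x
      by (auto elim!: eventually_mono simp: tpower_eq_powr)
    show "a * x powr (a - 1) = a * tpower (a - 1) x" using x by (simp add: tpower_eq_powr)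
  qed
qed

lemma tpower_between:
  assumes "0 < u" "u \<le> y" "y \<le> v" "u \<le> z" "z \<le> v"
  shows "\<bar>tpower a y - tpower a z\<bar> \<le> \<bar>tpower a u - tpower a v\<bar>"
proof (cases "0 \<le> a")
  case True
  then have "tpower a u \<le> tpower a y" "tpower a y \<le> tpower a v" "tpower a u \<le> tpower a z" "tpower a z \<le> tpower a v"
    using assms by (auto intro: tpower_mono)
  then show ?thesis by linarith
next
  case False
  have anti: "tpower a y \<le> tpower a x" if "0 < x" "x \<le> y" for x y
    using that False by (auto simp: tpower_eq_powr intro!: powr_mono2')
  then have "tpower a y \<le> tpower a u" "tpower a v \<le> tpower a y" "tpower a z \<le> tpower a u" "tpower a v \<le> tpower a z"
    using assms by auto
  then show ?thesis by linarith
qed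

text \<open>
  For \<open>t - s > h\<close> the mean value of the kernel is attained at an intermediate point, by the mean
  value theorem.
\<close>

lemma kernel_average_close:
  assumes \<alpha>: "0 < \<alpha>" and h: "0 < h" "h / 2 \<le> b - a"
    and t: "\<bar>a - t\<bar> \<le> h" "\<bar>b - t\<bar> \<le> h"
  shows "\<bar>tpower (\<alpha> - 1) (t - s) - (tpower \<alpha> (b - s) - tpower \<alpha> (a - s)) / (\<alpha> * (b - a))\<bar>
    \<le> kernel_gap \<alpha> h (t - s)"
proof -
  have ab: "a < b" using h by linarith
  let ?avg = "(tpower \<alpha> (b - s) - tpower \<alpha> (a - s)) / (\<alpha> * (b - a))"
  consider "t - s \<le> - h" | "- h < t - s" "t - s \<le> h" | "h < t - s" by linarith
  then show ?thesis
  proof cases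
    case 1
    then have "a - s \<le> 0" "b - s \<le> 0" "t - s \<le> 0" using t h by linarith+
    then show ?thesis using 1 h by (simp add: kernel_gap_def)
  next
    case 2
    have "tpower \<alpha> (b - s) \<le> tpower \<alpha> (2 * h)" "tpower \<alpha> (a - s) \<le> tpower \<alpha> (b - s)"
      using 2 t ab \<alpha> by (auto intro!: tpower_mono)
    then have *: "0 \<le> tpower \<alpha> (b - s) - tpower \<alpha> (a - s)" "tpower \<alpha> (b - s) - tpower \<alpha> (a - s) \<le> tpower \<alpha> (2 * h)"
      using tpower_nonneg[of \<alpha> "a - s"] by linarith+
    then have "?avg \<le> tpower \<alpha> (2 * h) / (\<alpha> * (h / 2))"
      using \<alpha> h by (intro frac_le mult_left_mono) auto
    moreover have "0 \<le> ?avg" using * \<alpha> ab by simp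
    moreover have "tpower \<alpha> (2 * h) / (\<alpha> * (h / 2)) = 2 * tpower \<alpha> (2 * h) / (\<alpha> * h)" by simp
    moreover have "\<bar>k - v\<bar> \<le> k + c" if "v \<le> c" "0 \<le> v" "0 \<le> k" for k v c :: real
      using that by linarith
    ultimately have "\<bar>tpower (\<alpha> - 1) (t - s) - ?avg\<bar> \<le> tpower (\<alpha> - 1) (t - s) + 2 * tpower \<alpha> (2 * h) / (\<alpha> * h)"
      by (metis tpower_nonneg)
    then show ?thesis using 2 by (simp add: kernel_gap_def)
  next
    case 3
    have as: "0 < a - s" using 3 t by linarith
    have "\<exists>z>a - s. z < b - s \<and>
      tpower \<alpha> (b - s) - tpower \<alpha> (a - s) = ((b - s) - (a - s)) * (\<alpha> * tpower (\<alpha> - 1) z)"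
      using as ab by (intro MVT2) (auto intro!: DERIV_tpower)
    then obtain z where z: "a - s < z" "z < b - s"
      "tpower \<alpha> (b - s) - tpower \<alpha> (a - s) = ((b - s) - (a - s)) * (\<alpha> * tpower (\<alpha> - 1) z)"
      by blast
    have "?avg = tpower (\<alpha> - 1) z" unfolding z(3) using ab \<alpha> by simp
    moreover have "\<bar>tpower (\<alpha> - 1) (t - s) - tpower (\<alpha> - 1) z\<bar>
        \<le> \<bar>tpower (\<alpha> - 1) (t - s - h) - tpower (\<alpha> - 1) (t - s + h)\<bar>"
      using 3 z t h by (intro tpower_between) auto
    ultimately show ?thesis using 3 by (simp add: kernel_gap_def)
  qed
qed

lemma nn_integral_Icc_FTC:
  fixes f :: "real \<Rightarrow> real"
  assumes "a \<le> b" "continuous_on {a..b} F" "\<And>x. 0 \<le> f x"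
    and "\<And>x. a < x \<Longrightarrow> x < b \<Longrightarrow> (F has_real_derivative f x) (at x)"
  shows "(\<integral>\<^sup>+x. ennreal (f x) * indicator {a..b} x \<partial>lborel) = ennreal (F b - F a)"
proof -
  have "(f has_integral (F b - F a)) {a..b}"
    using assms by (intro fundamental_theorem_of_calculus_interior)
      (auto simp: has_real_derivative_iff_has_vector_derivative)
  from nn_integral_has_integral_lebesgue[OF assms(3) this]
  have "(\<integral>\<^sup>+x. ennreal (indicator {a..b} x * f x) \<partial>lborel) = ennreal (F b - F a)" .
  moreover have "ennreal (indicator {a..b} x * f x) = ennreal (f x) * indicator {a..b} x" for x
    by (simp add: indicator_def)
  ultimately show ?thesis by simp
qed

lemma nn_integral_tpower:
  assumes "0 < \<alpha>" "0 \<le> b"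
  shows "(\<integral>\<^sup>+x. ennreal (tpower (\<alpha> - 1) x) * indicator {0..b} x \<partial>lborel) = ennreal (tpower \<alpha> b / \<alpha>)"
proof -
  have "(\<integral>\<^sup>+x. ennreal (tpower (\<alpha> - 1) x) * indicator {0..b} x \<partial>lborel)
      = ennreal (tpower \<alpha> b / \<alpha> - tpower \<alpha> 0 / \<alpha>)"
  proof (rule nn_integral_Icc_FTC)
    show "((\<lambda>x. tpower \<alpha> x / \<alpha>) has_real_derivative tpower (\<alpha> - 1) x) (at x)" if "0 < x" for x
      using DERIV_cdivide[OF DERIV_tpower[OF that, of \<alpha>], of \<alpha>] assms by simp
  qed (use assms in \<open>auto intro!: continuous_intros continuous_on_tpower\<close>)
  then show ?thesis by simp
qed

text \<open>
  The oscillation term has a constant sign, because the kernel is increasing for \<open>\<alpha> \<ge> 1\<close> and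
  decreasing otherwise, so its integral telescopes to boundary values of the primitive \<open>x\<^sup>\<alpha> /
  \<alpha>\<close>.
\<close>

lemma nn_integral_kernel_gap_le:
  assumes \<alpha>: "0 < \<alpha>" and h: "0 < h" "h \<le> T"
  shows "(\<integral>\<^sup>+x. ennreal (kernel_gap \<alpha> h x * indicator {-T..T} x) \<partial>lborel) \<le> ennreal (kernel_gap_mass \<alpha> T h)"
proof -
  let ?k = "tpower (\<alpha> - 1)" and ?\<kappa> = "\<lambda>x. tpower \<alpha> x / \<alpha>"
  let ?c = "2 * tpower \<alpha> (2 * h) / (\<alpha> * h)"
  have "(\<integral>\<^sup>+x. ennreal (kernel_gap \<alpha> h x * indicator {-T..T} x) \<partial>lborel)
    \<le> (\<integral>\<^sup>+x. ennreal \<bar>?k (x - h) - ?k (x + h)\<bar> * indicator {h..T} x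
        + (ennreal (?k x) * indicator {0..h} x + ennreal ?c * indicator {-h..h} x) \<partial>lborel)"
  proof (rule nn_integral_mono)
    fix x :: real
    consider "h < x" | "x \<le> h" "0 \<le> x" | "-h < x" "x < 0" | "x \<le> - h" by linarith
    then show "ennreal (kernel_gap \<alpha> h x * indicator {-T..T} x)
      \<le> ennreal \<bar>?k (x - h) - ?k (x + h)\<bar> * indicator {h..T} x
        + (ennreal (?k x) * indicator {0..h} x + ennreal ?c * indicator {-h..h} x)"
    proof cases
      case 1 then show ?thesis by (auto simp: kernel_gap_def indicator_def)
    next
      case 2 
      then have "ennreal (kernel_gap \<alpha> h x * indicator {-T..T} x) = ennreal (?k x + ?c)"
        using h by (simp add: kernel_gap_def indicator_def)
      also have "\<dots> = ennreal (?k x) + ennreal ?c"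
        using \<alpha> h by (intro ennreal_plus) auto
      also have "\<dots> \<le> ennreal \<bar>?k (x - h) - ?k (x + h)\<bar> * indicator {h..T} x
        + (ennreal (?k x) * indicator {0..h} x + ennreal ?c * indicator {-h..h} x)"
      proof -
        have "indicator {0..h} x = (1::ennreal)" "indicator {-h..h} x = (1::ennreal)" using 2 h by auto
        then show ?thesis by (simp only: mult_1_right) (rule add_increasing, auto)
      qed
      finally show ?thesis .
    next
      case 3 then show ?thesis using h by (auto simp: kernel_gap_def indicator_def)
    next
      case 4 then show ?thesis using h by (auto simp: kernel_gap_def)
    qed
  qed
  also have "\<dots> = (\<integral>\<^sup>+x. ennreal \<bar>?k (x - h) - ?k (x + h)\<bar> * indicator {h..T} x \<partial>lborel)
        + ((\<integral>\<^sup>+x. ennreal (?k x) * indicator {0..h} x \<partial>lborel) + ennreal ?c * emeasure lborel {-h..h})"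
    by (simp add: nn_integral_add nn_integral_cmult_indicator)
  also have "(\<integral>\<^sup>+x. ennreal \<bar>?k (x - h) - ?k (x + h)\<bar> * indicator {h..T} x \<partial>lborel)
     \<le> ennreal (\<bar>tpower \<alpha> (T - h) - tpower \<alpha> (T + h) + tpower \<alpha> (2 * h)\<bar> / \<alpha>)"
  proof -
    define \<sigma> :: real where "\<sigma> = (if 1 \<le> \<alpha> then -1 else 1)"
    have sgn: "\<bar>?k (x - h) - ?k (x + h)\<bar> = \<sigma> * (?k (x - h) - ?k (x + h))" if "h < x" for x
    proof (cases "1 \<le> \<alpha>")
      case True
      then have "?k (x - h) \<le> ?k (x + h)" using h by (intro tpower_mono) auto
      then show ?thesis using True by (simp add: \<sigma>_def)
    next
      case False
      have "?k (x + h) \<le> ?k (x - h)"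
        using that h False by (simp add: tpower_eq_powr) (intro powr_mono2', auto)
      then show ?thesis using False by (simp add: \<sigma>_def)
    qed
    let ?F = "\<lambda>x. \<sigma> * (tpower \<alpha> (x - h) / \<alpha> - tpower \<alpha> (x + h) / \<alpha>)"
    have "(\<integral>\<^sup>+x. ennreal \<bar>?k (x - h) - ?k (x + h)\<bar> * indicator {h..T} x \<partial>lborel) = ennreal (?F T - ?F h)"
    proof (rule nn_integral_Icc_FTC)
      show "continuous_on {h..T} ?F"
        using \<alpha> by (auto intro!: continuous_intros continuous_on_compose2[OF continuous_on_tpower[of \<alpha> UNIV]])
      fix x assume x: "h < x"
      have sh: "((\<lambda>x. tpower \<alpha> (x + y) / \<alpha>) has_real_derivative ?k (x + y)) (at x)" if "0 < x + y" for y
      proof -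
        have "(tpower \<alpha> has_real_derivative \<alpha> * ?k (x + y)) (at (x + y))"
          using that by (rule DERIV_tpower)
        then have "((\<lambda>x. tpower \<alpha> (x + y)) has_real_derivative \<alpha> * ?k (x + y)) (at x)"
          by (simp add: DERIV_shift)
        from DERIV_cdivide[OF this, of \<alpha>] show ?thesis using \<alpha> by simp
      qed
      show "(?F has_real_derivative \<bar>?k (x - h) - ?k (x + h)\<bar>) (at x)"
        unfolding sgn[OF x] using sh[of "-h"] sh[of h] x h
        by (intro DERIV_cmult DERIV_diff) auto
    qed (use h in auto)
    also have "?F T - ?F h = \<sigma> * ((tpower \<alpha> (T - h) - tpower \<alpha> (T + h) + tpower \<alpha> (2 * h)) / \<alpha>)"
      by (simp add: algebra_simps add_divide_distrib diff_divide_distrib)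
    also have "\<dots> \<le> \<bar>tpower \<alpha> (T - h) - tpower \<alpha> (T + h) + tpower \<alpha> (2 * h)\<bar> / \<alpha>"
      using \<alpha> by (auto simp: \<sigma>_def intro: divide_right_mono)
    finally show ?thesis by (simp add: ennreal_leI)
  qed
  also have "(\<integral>\<^sup>+x. ennreal (?k x) * indicator {0..h} x \<partial>lborel) = ennreal (tpower \<alpha> h / \<alpha>)"
    using \<alpha> h by (intro nn_integral_tpower) auto
  also have "ennreal ?c * emeasure lborel {-h..h} = ennreal (4 * tpower \<alpha> (2 * h) / \<alpha>)"
    using h \<alpha> by (simp flip: ennreal_mult)
  finally show ?thesis
    using \<alpha> unfolding kernel_gap_mass_def by (simp add: add_divide_distrib flip: ennreal_plus)
qed

lemma kernel_gap_mass_pos: "0 < \<alpha> \<Longrightarrow> 0 < h \<Longrightarrow> 0 < kernel_gap_mass \<alpha> T h"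
  unfolding kernel_gap_mass_def
  by (intro add_nonneg_pos divide_nonneg_pos divide_pos_pos add_pos_nonneg) (auto simp: tpower_eq_powr)

lemma kernel_gap_mass_tendsto_0:
  assumes \<alpha>: "0 < \<alpha>" and h: "h \<longlonglongrightarrow> 0"
  shows "(\<lambda>n. kernel_gap_mass \<alpha> T (h n)) \<longlonglongrightarrow> 0"
proof -
  have tp: "(\<lambda>n. tpower \<alpha> (g n)) \<longlonglongrightarrow> tpower \<alpha> l" if "g \<longlonglongrightarrow> l" for g l
    using continuous_on_tpower[OF \<alpha>, of UNIV] that
    by (auto simp: continuous_on_eq_continuous_at intro: isCont_tendsto_compose)
  have "(\<lambda>n. kernel_gap_mass \<alpha> T (h n)) \<longlonglongrightarrow>
     \<bar>tpower \<alpha> (T - 0) - tpower \<alpha> (T + 0) + tpower \<alpha> (2 * 0)\<bar> / \<alpha>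
      + (tpower \<alpha> 0 + 4 * tpower \<alpha> (2 * 0)) / \<alpha>"
    unfolding kernel_gap_mass_def using \<alpha> by (intro tendsto_intros tp h) auto
  then show ?thesis by simp
qed


section \<open>Riemann-Liouville integrals as convolutions\<close>

lemma complete_measure_lebesgue: "complete_measure lebesgue"
  by (rule completion.complete_measure_axioms)

locale RL_setting =
  fixes t\<^sub>0 t\<^sub>1 p \<alpha> :: real
  assumes t01: "t\<^sub>0 < t\<^sub>1" and p1: "1 \<le> p" and \<alpha>: "0 < \<alpha>"
begin

abbreviation M where "M \<equiv> lebesgue_on {t\<^sub>0..t\<^sub>1}"

sublocale Lp_setting M p
  by (intro Lp_setting.intro complete_measure_restrict_space complete_measure_lebesgue)
    (auto simp: Lp_setting_axioms_def p1)

abbreviation T where "T \<equiv> t\<^sub>1 - t\<^sub>0"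

lemma emeasure_M: "emeasure M (space M) = ennreal T" "0 \<le> T"
  using t01 by (simp_all add: emeasure_restrict_space)

lemma emeasure_M_Icc: "emeasure M {t\<^sub>0..t\<^sub>1} = ennreal T"
  using emeasure_M(1) by simp

definition zero_ext :: "(real \<Rightarrow> 'a::real_normed_vector) \<Rightarrow> real \<Rightarrow> 'a" where
  "zero_ext f s = indicat_real {t\<^sub>0..t\<^sub>1} s *\<^sub>R f s"

text \<open>
  The scalar convolution of the kernel \<open>w\<close> with the norm of \<open>f\<close>. It dominates all vector-valued
  convolutions.
\<close>

definition conv_norm :: "(real \<Rightarrow> real) \<Rightarrow> (real \<Rightarrow> 'a::real_normed_vector) \<Rightarrow> real \<Rightarrow> ennreal" where
  "conv_norm w f t = (\<integral>\<^sup>+s. ennreal (w (t - s) * norm (zero_ext f s)) \<partial>lebesgue)"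

lemma strongly_measurable_zero_ext: "strongly_measurable M f \<Longrightarrow> strongly_measurable lebesgue (zero_ext f)"
  unfolding zero_ext_def[abs_def] by (simp add: strongly_measurable_restrict_space_iff)

lemma measurable_norm_zero_ext: "strongly_measurable M f \<Longrightarrow> (\<lambda>s. norm (zero_ext f s)) \<in> borel_measurable lebesgue"
  by (intro complete_measure.borel_measurable_norm_strongly_measurable complete_measure_lebesgue
      strongly_measurable_zero_ext)

lemma nn_integral_zero_ext:
  fixes g :: "real \<Rightarrow> ennreal"
  assumes "g 0 = 0"
  shows "(\<integral>\<^sup>+s. g (norm (zero_ext f s)) \<partial>lebesgue) = (\<integral>\<^sup>+s. g (norm (f s)) \<partial>M)"
proof -
  have "(\<integral>\<^sup>+s. g (norm (f s)) \<partial>M) = (\<integral>\<^sup>+s. g (norm (f s)) * indicator {t\<^sub>0..t\<^sub>1} s \<partial>lebesgue)"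
    by (rule nn_integral_restrict_space) simp
  also have "\<dots> = (\<integral>\<^sup>+s. g (norm (zero_ext f s)) \<partial>lebesgue)"
    by (rule nn_integral_cong) (auto simp: zero_ext_def assms indicator_def)
  finally show ?thesis by simp
qed

lemma conv_norm_cong:
  assumes t: "t \<in> {t\<^sub>0..t\<^sub>1}" and eq: "\<And>x. \<bar>x\<bar> \<le> T \<Longrightarrow> v x = w x"
  shows "conv_norm v f t = conv_norm w f t"
  unfolding conv_norm_def
proof (rule nn_integral_cong)
  fix s
  show "ennreal (v (t - s) * norm (zero_ext f s)) = ennreal (w (t - s) * norm (zero_ext f s))"
    using t eq[of "t - s"] by (cases "s \<in> {t\<^sub>0..t\<^sub>1}") (auto simp: zero_ext_def)
qed

text \<open>
  Young's inequality for the kernel cut off outside \<open>[-T, T]\<close>, which for arguments in \<open>[t\<^sub>0,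
  t\<^sub>1]\<close> gives the same convolution.
\<close>

lemma conv_norm_Lp:
  assumes f: "f \<in> Lp_functions M p"
    and w[measurable]: "w \<in> borel_measurable borel" and w0: "\<And>x. 0 \<le> w x"
    and m: "(\<integral>\<^sup>+x. ennreal (w x * indicator {-T..T} x) \<partial>lborel) \<le> ennreal m" "0 < m"
  shows "AE t in M. conv_norm w f t < \<infinity>"
    and "(\<lambda>t. enn2real (conv_norm w f t)) \<in> Lp_functions M p"
    and "Lp_norm M p (\<lambda>t. enn2real (conv_norm w f t)) \<le> m * Lp_norm M p f"
proof -
  let ?D = "\<lambda>x. w x * indicator {-T..T} x"
  let ?N = "Lp_norm M p f"
  have fm: "strongly_measurable M f" using f by (simp add: Lp_functions_iff)
  have pow: "(\<integral>\<^sup>+s. ennreal (norm (zero_ext f s) powr p) \<partial>lebesgue) = (\<integral>\<^sup>+s. ennreal (norm (f s) powr p) \<partial>M)"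
    by (rule nn_integral_zero_ext[of "\<lambda>y. ennreal (y powr p)"]) simp
  have fin: "(\<integral>\<^sup>+s. ennreal (norm (zero_ext f s) powr p) \<partial>lebesgue) < \<infinity>"
    unfolding pow using f by (simp add: Lp_functions_iff)
  have D: "?D \<in> borel_measurable borel" "\<And>x. 0 \<le> ?D x" using w0 by auto
  note * = nn_integral_convolution_power_le_lebesgue[OF D m measurable_norm_zero_ext[OF fm] norm_ge_zero p fin]
  have eq: "conv_norm w f t = conv_norm ?D f t" if "t \<in> {t\<^sub>0..t\<^sub>1}" for t
    using that by (rule conv_norm_cong) (auto simp: indicator_def)
  have fin': "AE t in lebesgue. conv_norm ?D f t < \<infinity>"
    using *(2) by (simp add: conv_norm_def)
  then have "AE t in M. conv_norm ?D f t < \<infinity>"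
    by (subst AE_restrict_space_iff) (auto elim: eventually_mono)
  then show "AE t in M. conv_norm w f t < \<infinity>"
    using AE_space by eventually_elim (simp add: eq)
  have meas: "conv_norm ?D f \<in> borel_measurable borel"
    using *(1) by (simp add: conv_norm_def[abs_def])
  then have "conv_norm ?D f \<in> borel_measurable M"
    by (auto intro!: measurable_restrict_space1 measurable_completion)
  then have "conv_norm w f \<in> borel_measurable M"
    by (subst measurable_cong[of _ _ "conv_norm ?D f"]) (auto simp: eq)
  then have sm: "strongly_measurable M (\<lambda>t. enn2real (conv_norm w f t))"
    by (intro strongly_measurable_if_borel_measurable) measurable
  have "(\<integral>\<^sup>+t. ennreal (norm (enn2real (conv_norm w f t)) powr p) \<partial>M)
      = (\<integral>\<^sup>+t. ennreal (enn2real (conv_norm ?D f t) powr p) \<partial>M)"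
    by (rule nn_integral_cong) (simp add: eq)
  also have "\<dots> \<le> (\<integral>\<^sup>+t. ennreal (enn2real (conv_norm ?D f t) powr p) \<partial>lebesgue)"
    by (subst nn_integral_restrict_space) (auto intro!: nn_integral_mono simp: indicator_def)
  also have "\<dots> \<le> ennreal (m powr p) * (\<integral>\<^sup>+s. ennreal (norm (f s) powr p) \<partial>M)"
    using *(3) by (simp add: conv_norm_def pow)
  also have "\<dots> \<le> ennreal (m powr p) * ennreal (?N powr p)"
    by (intro mult_left_mono nn_integral_powr_le_Lp_norm f) auto
  also have "\<dots> = ennreal ((m * ?N) powr p)"
    using m(2) by (simp add: powr_mult ennreal_mult)
  finally have bound: "(\<integral>\<^sup>+t. ennreal (norm (enn2real (conv_norm w f t)) powr p) \<partial>M) \<le> ennreal ((m * ?N) powr p)" .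
  have mN: "0 \<le> m * ?N" using m(2) by simp
  show "(\<lambda>t. enn2real (conv_norm w f t)) \<in> Lp_functions M p"
    "Lp_norm M p (\<lambda>t. enn2real (conv_norm w f t)) \<le> m * Lp_norm M p f"
    using Lp_norm_leI[OF sm mN bound] by auto
qed

text \<open>
  The integral over \<open>[t\<^sub>0, t]\<close> is an integral over the whole line, because the truncated kernel
  vanishes for \<open>s > t\<close> and the extension of \<open>f\<close> for \<open>s < t\<^sub>0\<close>.
\<close>

lemma has_Bochner_integral_RL:
  fixes f :: "real \<Rightarrow> 'a::banach"
  assumes fm: "strongly_measurable M f" and t: "t \<in> {t\<^sub>0..t\<^sub>1}" and \<beta>: "0 < \<beta>"
    and fin: "conv_norm (tpower (\<beta> - 1)) f t < \<infinity>"
  shows "has_Bochner_integral lebesgue (\<lambda>s. tpower (\<beta> - 1) (t - s) *\<^sub>R zero_ext f s)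
    (Gamma \<beta> *\<^sub>R RL_integral \<beta> t\<^sub>0 f t)"
proof -
  let ?g = "\<lambda>s. tpower (\<beta> - 1) (t - s) *\<^sub>R zero_ext f s"
  let ?r = "\<lambda>s. (t - s) powr (\<beta> - 1) *\<^sub>R f s"
  have g: "indicat_real {t\<^sub>0..t} s *\<^sub>R ?r s = ?g s" for s
    using t by (auto simp: indicator_def zero_ext_def tpower_eq_powr)
  have gm: "strongly_measurable lebesgue ?g"
  proof (rule strongly_measurable_scaleR[OF _ strongly_measurable_zero_ext[OF fm]])
    have "(\<lambda>s. tpower (\<beta> - 1) (t - s)) \<in> borel_measurable lebesgue"
      by (intro measurable_completion) measurable
    then show "strongly_measurable lebesgue (\<lambda>s. tpower (\<beta> - 1) (t - s))"
      by (rule strongly_measurable_if_borel_measurable)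
  qed
  have gfin: "(\<integral>\<^sup>+s. ennreal (norm (?g s)) \<partial>lebesgue) < \<infinity>"
    using fin by (simp add: conv_norm_def)
  have "Bochner_integral (lebesgue_on {t\<^sub>0..t}) ?r = Bochner_integral lebesgue ?g"
    by (rule Bochner_integral_restrict_space[OF complete_measure_lebesgue, of "{t\<^sub>0..t}" ?r,
          unfolded g, OF _ gm gfin]) simp
  then have "Gamma \<beta> *\<^sub>R RL_integral \<beta> t\<^sub>0 f t = Bochner_integral lebesgue ?g"
    using Gamma_real_pos[OF \<beta>] by (simp add: RL_integral_def)
  then show ?thesis
    using has_Bochner_integral_if_finite_norm[OF complete_measure_lebesgue gm gfin] by simp
qed

text \<open>
  The kernel of \<open>J\<^sup>1\<^sup>+\<^sup>\<alpha>\<close> is bounded on bounded sets. So \<open>J\<^sup>1\<^sup>+\<^sup>\<alpha> f\<close> is defined at every point,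
  while \<open>J\<^sup>\<alpha> f\<close> is defined only almost everywhere.
\<close>

lemma conv_norm_bounded_kernel_finite:
  assumes f: "f \<in> Lp_functions M p" and t: "t \<in> {t\<^sub>0..t\<^sub>1}"
  shows "conv_norm (tpower \<alpha>) f t < \<infinity>"
proof -
  have fm: "strongly_measurable M f" using f by (simp add: Lp_functions_iff)
  have "0 < Lp_norm M p f + 1" by (rule add_nonneg_pos) auto
  then have "(\<integral>\<^sup>+s. ennreal (norm (f s)) \<partial>M) < \<infinity>"
    using nn_integral_norm_le_Lp_norm[OF f _ _ emeasure_M, of "Lp_norm M p f + 1"]
    by (auto intro: order_le_less_trans)
  then have L1: "(\<integral>\<^sup>+s. ennreal (norm (zero_ext f s)) \<partial>lebesgue) < \<infinity>"
    using nn_integral_zero_ext[of ennreal f] by simp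
  have "conv_norm (tpower \<alpha>) f t \<le> (\<integral>\<^sup>+s. ennreal (tpower \<alpha> T) * ennreal (norm (zero_ext f s)) \<partial>lebesgue)"
    unfolding conv_norm_def
  proof (rule nn_integral_mono)
    fix s
    have "tpower \<alpha> (t - s) * norm (zero_ext f s) \<le> tpower \<alpha> T * norm (zero_ext f s)"
    proof (cases "s \<in> {t\<^sub>0..t\<^sub>1}")
      case True
      then show ?thesis using t \<alpha> by (intro mult_right_mono tpower_mono) auto
    qed (simp add: zero_ext_def)
    then show "ennreal (tpower \<alpha> (t - s) * norm (zero_ext f s)) \<le> ennreal (tpower \<alpha> T) * ennreal (norm (zero_ext f s))"
      by (simp add: ennreal_leI flip: ennreal_mult)
  qed
  also have "\<dots> = ennreal (tpower \<alpha> T) * (\<integral>\<^sup>+s. ennreal (norm (zero_ext f s)) \<partial>lebesgue)"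
    by (rule nn_integral_cmult[OF measurable_compose[OF measurable_norm_zero_ext[OF fm] measurable_ennreal]])
  also have "\<dots> < \<infinity>" using L1 by (simp add: ennreal_mult_less_top)
  finally show ?thesis .
qed

lemma has_Bochner_integral_RL_next_order:
  fixes f :: "real \<Rightarrow> 'a::banach"
  assumes f: "f \<in> Lp_functions M p" and t: "t \<in> {t\<^sub>0..t\<^sub>1}"
  shows "has_Bochner_integral lebesgue (\<lambda>s. tpower \<alpha> (t - s) *\<^sub>R zero_ext f s)
    ((\<alpha> * Gamma \<alpha>) *\<^sub>R RL_integral (1 + \<alpha>) t\<^sub>0 f t)"
proof -
  have "Gamma (1 + \<alpha>) = \<alpha> * Gamma \<alpha>"
    using Gamma_plus1[of \<alpha>] \<alpha> nonpos_Ints_nonpos[of \<alpha>] by (auto simp: add.commute)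
  then show ?thesis
    using has_Bochner_integral_RL[of f t "1 + \<alpha>"] f t \<alpha> conv_norm_bounded_kernel_finite[OF f t]
    by (simp add: Lp_functions_iff)
qed

lemma RL_integral_next_order_diff:
  fixes f g :: "real \<Rightarrow> 'a::banach"
  assumes f: "f \<in> Lp_functions M p" and g: "g \<in> Lp_functions M p" and t: "t \<in> {t\<^sub>0..t\<^sub>1}"
  shows "RL_integral (1 + \<alpha>) t\<^sub>0 (\<lambda>s. f s - g s) t = RL_integral (1 + \<alpha>) t\<^sub>0 f t - RL_integral (1 + \<alpha>) t\<^sub>0 g t"
proof -
  have "has_Bochner_integral lebesgue (\<lambda>s. tpower \<alpha> (t - s) *\<^sub>R zero_ext (\<lambda>s. f s - g s) s)
     ((\<alpha> * Gamma \<alpha>) *\<^sub>R (RL_integral (1 + \<alpha>) t\<^sub>0 f t - RL_integral (1 + \<alpha>) t\<^sub>0 g t))"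
    using has_Bochner_integral_scaleR_add[OF complete_measure_lebesgue has_Bochner_integral_RL_next_order[OF f t]
        has_Bochner_integral_RL_next_order[OF g t], of 1 "-1"]
    by (simp add: zero_ext_def scaleR_diff_right)
  from has_Bochner_integral_unique[OF complete_measure_lebesgue this has_Bochner_integral_RL_next_order[OF Lp_diff[OF f g] t]]
  show ?thesis using \<alpha> Gamma_real_pos[OF \<alpha>] by simp
qed

lemma AE_Abel_convolution_finite:
  assumes f: "f \<in> Lp_functions M p"
  shows "AE t in M. conv_norm (tpower (\<alpha> - 1)) f t < \<infinity>"
    and "(\<lambda>t. enn2real (conv_norm (tpower (\<alpha> - 1)) f t)) \<in> Lp_functions M p"
proof -
  have "(\<integral>\<^sup>+x. ennreal (tpower (\<alpha> - 1) x * indicator {-T..T} x) \<partial>lborel)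
      = (\<integral>\<^sup>+x. ennreal (tpower (\<alpha> - 1) x) * indicator {0..T} x \<partial>lborel)"
    using t01 by (intro nn_integral_cong) (auto simp: indicator_def)
  also have "\<dots> = ennreal (tpower \<alpha> T / \<alpha>)"
    using \<alpha> t01 by (intro nn_integral_tpower) auto
  finally have m: "(\<integral>\<^sup>+x. ennreal (tpower (\<alpha> - 1) x * indicator {-T..T} x) \<partial>lborel)
      \<le> ennreal (tpower \<alpha> T / \<alpha>)" by simp
  have "0 < tpower \<alpha> T / \<alpha>" using \<alpha> t01 by (simp add: tpower_eq_powr)
  from conv_norm_Lp(1,2)[OF f _ _ m this]
  show "AE t in M. conv_norm (tpower (\<alpha> - 1)) f t < \<infinity>"
    "(\<lambda>t. enn2real (conv_norm (tpower (\<alpha> - 1)) f t)) \<in> Lp_functions M p" by auto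
qed

lemma AE_RL_integral_diff:
  fixes f g :: "real \<Rightarrow> 'a::banach"
  assumes f: "f \<in> Lp_functions M p" and g: "g \<in> Lp_functions M p"
  shows "AE t in M. RL_integral \<alpha> t\<^sub>0 (\<lambda>s. f s - g s) t = RL_integral \<alpha> t\<^sub>0 f t - RL_integral \<alpha> t\<^sub>0 g t"
  using AE_Abel_convolution_finite(1)[OF f] AE_Abel_convolution_finite(1)[OF g] AE_Abel_convolution_finite(1)[OF Lp_diff[OF f g]] AE_space
proof eventually_elim
  case (elim t)
  have sm: "strongly_measurable M f" "strongly_measurable M g" "strongly_measurable M (\<lambda>s. f s - g s)"
    using f g Lp_diff[OF f g] by (auto simp: Lp_functions_iff)
  have t: "t \<in> {t\<^sub>0..t\<^sub>1}" using elim by simp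
  have "has_Bochner_integral lebesgue (\<lambda>s. tpower (\<alpha> - 1) (t - s) *\<^sub>R zero_ext (\<lambda>s. f s - g s) s)
     (Gamma \<alpha> *\<^sub>R (RL_integral \<alpha> t\<^sub>0 f t - RL_integral \<alpha> t\<^sub>0 g t))"
    using has_Bochner_integral_scaleR_add[OF complete_measure_lebesgue
        has_Bochner_integral_RL[OF sm(1) t \<alpha> elim(1)] has_Bochner_integral_RL[OF sm(2) t \<alpha> elim(2)], of 1 "-1"]
    by (simp add: zero_ext_def scaleR_diff_right)
  from has_Bochner_integral_unique[OF complete_measure_lebesgue this has_Bochner_integral_RL[OF sm(3) t \<alpha> elim(3)]]
  show ?case using Gamma_real_pos[OF \<alpha>] by simp
qed

definition gap_error :: "real \<Rightarrow> (real \<Rightarrow> 'a::real_normed_vector) \<Rightarrow> real \<Rightarrow> real" where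
  "gap_error h f t = enn2real (conv_norm (kernel_gap \<alpha> h) f t) / Gamma \<alpha>"

text \<open>
  The central estimate: a difference quotient of \<open>J\<^sup>1\<^sup>+\<^sup>\<alpha> f\<close> near \<open>t\<close> is close to \<open>J\<^sup>\<alpha> f(t)\<close>,
  because both are integrals of \<open>f\<close> against kernels whose distance is controlled by
  \<open>kernel_gap\<close>.
\<close>

lemma RL_average_close:
  fixes f :: "real \<Rightarrow> 'a::banach"
  assumes f: "f \<in> Lp_functions M p" and t: "t \<in> {t\<^sub>0..t\<^sub>1}" and a: "a \<in> {t\<^sub>0..t\<^sub>1}" and b: "b \<in> {t\<^sub>0..t\<^sub>1}"
    and h: "0 < h" "h / 2 \<le> b - a" "\<bar>a - t\<bar> \<le> h" "\<bar>b - t\<bar> \<le> h"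
    and fin: "conv_norm (tpower (\<alpha> - 1)) f t < \<infinity>" "conv_norm (kernel_gap \<alpha> h) f t < \<infinity>"
  shows "norm (RL_integral \<alpha> t\<^sub>0 f t
      - (1 / (b - a)) *\<^sub>R (RL_integral (1 + \<alpha>) t\<^sub>0 f b - RL_integral (1 + \<alpha>) t\<^sub>0 f a)) \<le> gap_error h f t"
proof -
  let ?J = "RL_integral \<alpha> t\<^sub>0 f t" and ?A = "RL_integral (1 + \<alpha>) t\<^sub>0 f a" and ?B = "RL_integral (1 + \<alpha>) t\<^sub>0 f b"
  let ?c = "1 / (\<alpha> * (b - a))"
  let ?K = "\<lambda>s. tpower (\<alpha> - 1) (t - s) - (tpower \<alpha> (b - s) - tpower \<alpha> (a - s)) / (\<alpha> * (b - a))"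
  let ?d = "?J - (1 / (b - a)) *\<^sub>R (?B - ?A)"
  have fm: "strongly_measurable M f" using f by (simp add: Lp_functions_iff)
  have G: "0 < Gamma \<alpha>" by (rule Gamma_real_pos[OF \<alpha>])
  have "has_Bochner_integral lebesgue (\<lambda>s. ?K s *\<^sub>R zero_ext f s) (Gamma \<alpha> *\<^sub>R ?d)"
  proof -
    have "has_Bochner_integral lebesgue
      (\<lambda>s. ?c *\<^sub>R (tpower \<alpha> (b - s) *\<^sub>R zero_ext f s) + (- ?c) *\<^sub>R (tpower \<alpha> (a - s) *\<^sub>R zero_ext f s))
      (?c *\<^sub>R (\<alpha> * Gamma \<alpha>) *\<^sub>R ?B + (- ?c) *\<^sub>R (\<alpha> * Gamma \<alpha>) *\<^sub>R ?A)"
      by (intro has_Bochner_integral_scaleR_add complete_measure_lebesgue has_Bochner_integral_RL_next_order f a b)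
    from has_Bochner_integral_scaleR_add[OF complete_measure_lebesgue has_Bochner_integral_RL[OF fm t \<alpha> fin(1)] this, of 1 "-1"]
    have *: "has_Bochner_integral lebesgue
      (\<lambda>s. 1 *\<^sub>R (tpower (\<alpha> - 1) (t - s) *\<^sub>R zero_ext f s) + (- 1) *\<^sub>R
        (?c *\<^sub>R (tpower \<alpha> (b - s) *\<^sub>R zero_ext f s) + (- ?c) *\<^sub>R (tpower \<alpha> (a - s) *\<^sub>R zero_ext f s)))
      (1 *\<^sub>R Gamma \<alpha> *\<^sub>R ?J + (- 1) *\<^sub>R
        (?c *\<^sub>R (\<alpha> * Gamma \<alpha>) *\<^sub>R ?B + (- ?c) *\<^sub>R (\<alpha> * Gamma \<alpha>) *\<^sub>R ?A))" .
    have 1: "1 *\<^sub>R (tpower (\<alpha> - 1) (t - s) *\<^sub>R zero_ext f s) + (- 1) *\<^sub>R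
        (?c *\<^sub>R (tpower \<alpha> (b - s) *\<^sub>R zero_ext f s) + (- ?c) *\<^sub>R (tpower \<alpha> (a - s) *\<^sub>R zero_ext f s))
        = ?K s *\<^sub>R zero_ext f s" for s
      by (simp add: scaleR_diff_left diff_divide_distrib)
    have 2: "1 *\<^sub>R Gamma \<alpha> *\<^sub>R ?J + (- 1) *\<^sub>R
        (?c *\<^sub>R (\<alpha> * Gamma \<alpha>) *\<^sub>R ?B + (- ?c) *\<^sub>R (\<alpha> * Gamma \<alpha>) *\<^sub>R ?A) = Gamma \<alpha> *\<^sub>R ?d"
      using \<alpha> by (simp add: scaleR_diff_right)
    show ?thesis using * unfolding 1 2 .
  qed
  from norm_Bochner_integral_le[OF complete_measure_lebesgue this]
  have "ennreal (Gamma \<alpha> * norm ?d) \<le> (\<integral>\<^sup>+s. ennreal (norm (?K s *\<^sub>R zero_ext f s)) \<partial>lebesgue)"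
    using G by simp
  also have "\<dots> \<le> conv_norm (kernel_gap \<alpha> h) f t"
    unfolding conv_norm_def
  proof (intro nn_integral_mono ennreal_leI)
    fix s
    have "\<bar>?K s\<bar> \<le> kernel_gap \<alpha> h (t - s)" by (intro kernel_average_close \<alpha> h)
    then show "norm (?K s *\<^sub>R zero_ext f s) \<le> kernel_gap \<alpha> h (t - s) * norm (zero_ext f s)"
      by (simp only: norm_scaleR mult_right_mono norm_ge_zero)
  qed
  also have "\<dots> = ennreal (enn2real (conv_norm (kernel_gap \<alpha> h) f t))"
    using fin(2) by simp
  finally have "Gamma \<alpha> * norm ?d \<le> enn2real (conv_norm (kernel_gap \<alpha> h) f t)"
    by simp
  then show ?thesis using G by (simp add: gap_error_def pos_le_divide_eq mult.commute)
qed

lemma gap_error_Lp: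
  assumes f: "f \<in> Lp_functions M p" and h: "0 < h" "h \<le> T"
  shows "AE t in M. conv_norm (kernel_gap \<alpha> h) f t < \<infinity>"
    and "gap_error h f \<in> Lp_functions M p"
    and "Lp_norm M p (gap_error h f) \<le> kernel_gap_mass \<alpha> T h / Gamma \<alpha> * Lp_norm M p f"
proof -
  note * = conv_norm_Lp[OF f kernel_gap_measurable kernel_gap_nonneg[OF \<alpha> h(1)]
      nn_integral_kernel_gap_le[OF \<alpha> h] kernel_gap_mass_pos[OF \<alpha> h(1)]]
  have G: "0 < Gamma \<alpha>" by (rule Gamma_real_pos[OF \<alpha>])
  show "AE t in M. conv_norm (kernel_gap \<alpha> h) f t < \<infinity>" by (rule *(1))
  define c where "c t = enn2real (conv_norm (kernel_gap \<alpha> h) f t)" for t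
  have gap: "gap_error h f = (\<lambda>t. c t / Gamma \<alpha>)" by (simp add: c_def gap_error_def[abs_def])
  have [measurable]: "c \<in> borel_measurable M"
    using *(2) unfolding c_def by (intro borel_measurable_if_strongly_measurable) (simp add: Lp_functions_iff)
  have sm: "strongly_measurable M (gap_error h f)"
    unfolding gap by (intro strongly_measurable_if_borel_measurable) measurable
  have "(\<integral>\<^sup>+t. ennreal (norm (gap_error h f t) powr p) \<partial>M)
    = (\<integral>\<^sup>+t. ennreal ((1 / Gamma \<alpha>) powr p) * ennreal (norm (c t) powr p) \<partial>M)"
    using G by (intro nn_integral_cong) (simp add: gap powr_divide ennreal_mult[symmetric])
  also have "\<dots> = ennreal ((1 / Gamma \<alpha>) powr p) * (\<integral>\<^sup>+t. ennreal (norm (c t) powr p) \<partial>M)"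
    by (intro nn_integral_cmult) measurable
  also have "\<dots> \<le> ennreal ((1 / Gamma \<alpha>) powr p) * ennreal ((kernel_gap_mass \<alpha> T h * Lp_norm M p f) powr p)"
    unfolding c_def by (intro mult_left_mono nn_integral_powr_le_Lp_norm *) auto
  also have "\<dots> = ennreal ((kernel_gap_mass \<alpha> T h / Gamma \<alpha> * Lp_norm M p f) powr p)"
    using G kernel_gap_mass_pos[OF \<alpha> h(1)] by (simp add: powr_mult powr_divide ennreal_mult[symmetric] less_imp_le)
  finally have bound: "(\<integral>\<^sup>+t. ennreal (norm (gap_error h f t) powr p) \<partial>M)
    \<le> ennreal ((kernel_gap_mass \<alpha> T h / Gamma \<alpha> * Lp_norm M p f) powr p)" .
  have "0 \<le> kernel_gap_mass \<alpha> T h / Gamma \<alpha> * Lp_norm M p f"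
    using G kernel_gap_mass_pos[OF \<alpha> h(1), of T] by simp
  from Lp_norm_leI[OF sm this bound]
  show "gap_error h f \<in> Lp_functions M p"
    "Lp_norm M p (gap_error h f) \<le> kernel_gap_mass \<alpha> T h / Gamma \<alpha> * Lp_norm M p f" by auto
qed


section \<open>Approximation by step functions\<close>

definition node :: "nat \<Rightarrow> real \<Rightarrow> real" where
  "node n x = t\<^sub>0 + T / real n * x"

text \<open>
  The mean value of \<open>J\<^sup>\<alpha> f\<close> over the middle half of the \<open>k\<close>-th of \<open>n\<close> cells, written as a
  difference quotient of \<open>J\<^sup>1\<^sup>+\<^sup>\<alpha> f\<close>. With the middle half instead of the whole cell, the end
  points are interior points of \<open>[t\<^sub>0, t\<^sub>1]\<close> also for the first and the last cell.
\<close>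

definition cell_average :: "nat \<Rightarrow> (real \<Rightarrow> 'a::real_normed_vector) \<Rightarrow> int \<Rightarrow> 'a" where
  "cell_average n f k = (1 / (node n (k + 3/4) - node n (k + 1/4))) *\<^sub>R
     (RL_integral (1 + \<alpha>) t\<^sub>0 f (node n (k + 3/4)) - RL_integral (1 + \<alpha>) t\<^sub>0 f (node n (k + 1/4)))"

definition cell :: "nat \<Rightarrow> real \<Rightarrow> int" where
  "cell n t = \<lfloor>(t - t\<^sub>0) / (T / real n)\<rfloor>"

lemma node_inside:
  assumes "0 < x" "x < real n"
  shows "t\<^sub>0 < node n x" "node n x < t\<^sub>1"
proof -
  have n: "0 < real n" using assms by linarith
  then have h: "0 < T / real n" using t01 by simp
  have "0 < T / real n * x" using h assms(1) by (rule mult_pos_pos)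
  moreover have "T / real n * x < T / real n * real n" using assms(2) h by (rule mult_strict_left_mono)
  moreover have "T / real n * real n = T" using n by simp
  ultimately show "t\<^sub>0 < node n x" "node n x < t\<^sub>1" unfolding node_def by linarith+
qed

lemma cell_bounds:
  assumes "t\<^sub>0 \<le> t" "t < t\<^sub>1" "0 < n"
  shows "0 \<le> cell n t" "cell n t < int n" "node n (cell n t) \<le> t" "t \<le> node n (cell n t + 1)"
proof -
  let ?h = "T / real n"
  have h: "0 < ?h" using assms t01 by simp
  show "0 \<le> cell n t" using assms h by (simp add: cell_def)
  have "(t - t\<^sub>0) / ?h < real n" using assms t01 by (simp add: field_simps)
  then show "cell n t < int n" by (simp add: cell_def floor_less_iff)
  have k: "of_int (cell n t) \<le> (t - t\<^sub>0) / ?h" "(t - t\<^sub>0) / ?h < of_int (cell n t) + 1"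
    unfolding cell_def by linarith+
  from k(1) h have "of_int (cell n t) * ?h \<le> t - t\<^sub>0" by (simp only: pos_le_divide_eq)
  then show "node n (cell n t) \<le> t" by (simp add: node_def mult.commute)
  from k(2) h have "t - t\<^sub>0 < (of_int (cell n t) + 1) * ?h" by (simp only: pos_divide_less_eq)
  then show "t \<le> node n (cell n t + 1)" by (simp add: node_def mult.commute)
qed

lemma mesh_bounds: "0 < n \<Longrightarrow> 0 < T / real n" "0 < n \<Longrightarrow> T / real n \<le> T"
  using t01 frac_le[of T T 1 "real n"] by auto

lemma cell_average_close:
  fixes f :: "real \<Rightarrow> 'a::banach"
  assumes f: "f \<in> Lp_functions M p" and n: "0 < n"
  shows "AE t in M. cell n t \<in> {0..<int n} \<and>
    norm (RL_integral \<alpha> t\<^sub>0 f t - cell_average n f (cell n t)) \<le> gap_error (T / real n) f t"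
proof -
  let ?h = "T / real n"
  note h = mesh_bounds[OF n]
  \<comment> \<open>The point \<open>t\<^sub>1\<close> lies in no cell, since the cells are closed on the left only.\<close>
  have "AE t in lebesgue. t \<noteq> t\<^sub>1" by (rule AE_completion[OF AE_lborel_singleton])
  then have "AE t in M. t \<noteq> t\<^sub>1" by (subst AE_restrict_space_iff) auto
  then show ?thesis
    using AE_Abel_convolution_finite(1)[OF f] gap_error_Lp(1)[OF f h] AE_space
  proof eventually_elim
    case (elim t)
    then have t: "t\<^sub>0 \<le> t" "t < t\<^sub>1" by auto
    note c = cell_bounds[OF t n]
    let ?a = "node n (cell n t + 1/4)" and ?b = "node n (cell n t + 3/4)"
    have c': "0 \<le> real_of_int (cell n t)" "real_of_int (cell n t) + 1 \<le> real n" using c(1,2) by linarith+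
    have ab: "?a \<in> {t\<^sub>0..t\<^sub>1}" "?b \<in> {t\<^sub>0..t\<^sub>1}"
      using node_inside[of "cell n t + 1/4" n] node_inside[of "cell n t + 3/4" n] c' by auto
    have eq: "node n (x + y) = node n x + ?h * y" for x y by (simp add: node_def distrib_left)
    have "y * (3/4) - y * (1/4) = y / 2" for y :: real by simp
    then have ba: "?b - ?a = ?h / 2" unfolding eq by (metis add_diff_cancel_left)
    have c4: "t \<le> node n (cell n t) + ?h" using c(4) by (simp add: node_def distrib_left)
    have near: "\<bar>x + y * (1/4) - t\<bar> \<le> y" "\<bar>x + y * (3/4) - t\<bar> \<le> y"
      if "x \<le> t" "t \<le> x + y" "0 < y" for x y :: real
      using that by linarith+
    have "\<bar>?a - t\<bar> \<le> ?h" "\<bar>?b - t\<bar> \<le> ?h"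
      unfolding eq by (rule near[OF c(3) c4 h(1)])+
    then have "norm (RL_integral \<alpha> t\<^sub>0 f t - cell_average n f (cell n t)) \<le> gap_error ?h f t"
      unfolding cell_average_def using elim t h ba
      by (intro RL_average_close[OF f _ ab]) auto
    then show ?case using c by simp
  qed
qed

lemma simple_function_cell: "0 < n \<Longrightarrow> simple_function M (\<lambda>t. g (cell n t))"
proof -
  assume n: "0 < n"
  have m: "cell n \<in> measurable M (count_space UNIV)"
  proof (intro measurable_restrict_space1 measurable_completion)
    show "cell n \<in> measurable lborel (count_space UNIV)"
      unfolding cell_def[abs_def] by measurable
  qed
  have "cell n ` space M \<subseteq> {0..int n}"
  proof safe
    fix t assume t: "t \<in> space M"
    show "cell n t \<in> {0..int n}"
    proof (cases "t = t\<^sub>1")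
      case True
      then show ?thesis using t01 by (simp add: cell_def)
    next
      case False
      then show ?thesis using t cell_bounds[of t n] n by auto
    qed
  qed
  then have "finite (cell n ` space M)" by (rule finite_subset) simp
  with m have "simple_function M (cell n)" by (simp add: simple_function_eq_measurable)
  then show ?thesis by (rule simple_function_compose1)
qed

lemma kernel_gap_mass_mesh_tendsto_0: "(\<lambda>n. kernel_gap_mass \<alpha> T (T / real (Suc n))) \<longlonglongrightarrow> 0"
  by (intro kernel_gap_mass_tendsto_0 \<alpha> LIMSEQ_Suc[of "\<lambda>n. T / real n"] lim_const_over_n)

lemma fine_mesh_exists:
  assumes "0 \<le> C" "0 < e"
  obtains n where "0 < n" "kernel_gap_mass \<alpha> T (T / real n) / Gamma \<alpha> * C < e"
proof -
  have "(\<lambda>n. kernel_gap_mass \<alpha> T (T / real (Suc n)) / Gamma \<alpha> * C) \<longlonglongrightarrow> 0 / Gamma \<alpha> * C"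
    using Gamma_real_pos[OF \<alpha>] by (intro tendsto_intros kernel_gap_mass_mesh_tendsto_0) auto
  then have "eventually (\<lambda>n. kernel_gap_mass \<alpha> T (T / real (Suc n)) / Gamma \<alpha> * C < e) sequentially"
    using assms by (intro order_tendstoD) auto
  then show ?thesis using that[of "Suc n" for n] by (auto simp: eventually_sequentially)
qed

text \<open>
  Strong measurability holds because \<open>J\<^sup>\<alpha> f\<close> is almost everywhere the limit of the step
  functions given by the cell averages, along meshes for which the error bounds decrease
  rapidly. The bound for the norm is Young's inequality.
\<close>

lemma RL_integral_in_Lp:
  fixes f :: "real \<Rightarrow> 'a::banach"
  assumes f: "f \<in> Lp_functions M p"
  shows "RL_integral \<alpha> t\<^sub>0 f \<in> Lp_functions M p"
proof -
  have G: "0 < Gamma \<alpha>" by (rule Gamma_real_pos[OF \<alpha>])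
  have fm: "strongly_measurable M f" using f by (simp add: Lp_functions_iff)
  have "\<exists>n>0. kernel_gap_mass \<alpha> T (T / real n) / Gamma \<alpha> * Lp_norm M p f < 1 * (1/4) ^ k" for k
    using fine_mesh_exists[of "Lp_norm M p f" "1 * (1/4) ^ k"] by auto
  then obtain n where n: "\<And>k. 0 < n k"
    "\<And>k. kernel_gap_mass \<alpha> T (T / real (n k)) / Gamma \<alpha> * Lp_norm M p f < 1 * (1/4) ^ k"
    by metis
  let ?e = "\<lambda>k. gap_error (T / real (n k)) f"
  have small: "AE t in M. eventually (\<lambda>k. norm (?e k t) \<le> (1/2) ^ k) sequentially"
  proof (rule AE_eventually_small_if_fast[where C=1])
    fix k
    note * = gap_error_Lp[OF f mesh_bounds[OF n(1)[of k]]]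
    show "?e k \<in> Lp_functions M p" by (rule *)
    show "Lp_norm M p (?e k) \<le> 1 * (1/4) ^ k" using *(3) n(2)[of k] by linarith
  qed
  have close: "AE t in M. \<forall>k. norm (RL_integral \<alpha> t\<^sub>0 f t - cell_average (n k) f (cell (n k) t)) \<le> ?e k t"
    unfolding AE_all_countable
  proof
    fix k
    show "AE t in M. norm (RL_integral \<alpha> t\<^sub>0 f t - cell_average (n k) f (cell (n k) t)) \<le> ?e k t"
      using cell_average_close[OF f n(1)[of k]] by eventually_elim simp
  qed
  have sm: "strongly_measurable M (RL_integral \<alpha> t\<^sub>0 f)"
    unfolding strongly_measurable_def
  proof (intro exI conjI allI)
    show "simple_function M (\<lambda>t. cell_average (n k) f (cell (n k) t))" for k
      by (rule simple_function_cell[OF n(1)])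
    show "AE t in M. (\<lambda>k. cell_average (n k) f (cell (n k) t)) \<longlonglongrightarrow> RL_integral \<alpha> t\<^sub>0 f t"
      using small close
    proof eventually_elim
      case (elim t)
      have "(\<lambda>k. cell_average (n k) f (cell (n k) t) - RL_integral \<alpha> t\<^sub>0 f t) \<longlonglongrightarrow> 0"
      proof (rule Lim_null_comparison)
        show "(\<lambda>k. (1/2::real) ^ k) \<longlonglongrightarrow> 0" by (intro LIMSEQ_power_zero) simp
        show "\<forall>\<^sub>F k in sequentially. norm (cell_average (n k) f (cell (n k) t) - RL_integral \<alpha> t\<^sub>0 f t) \<le> (1/2) ^ k"
          using elim(1)
        proof eventually_elim
          case (elim k)
          then show ?case using \<open>\<forall>k. _\<close>[rule_format, of k] by (simp add: norm_minus_commute)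
        qed
      qed
      then show ?case by (rule LIM_zero_cancel)
    qed
  qed
  let ?c = "\<lambda>t. enn2real (conv_norm (tpower (\<alpha> - 1)) f t)"
  have cL: "(\<lambda>t. ?c t) \<in> Lp_functions M p" by (rule AE_Abel_convolution_finite(2)[OF f])
  have cm: "strongly_measurable M (\<lambda>t. ?c t)" using cL by (simp add: Lp_functions_iff)
  have gL: "(\<lambda>t. (1 / Gamma \<alpha>) *\<^sub>R ?c t) \<in> Lp_functions M p"
  proof -
    have "norm ((1 / Gamma \<alpha>) *\<^sub>R ?c t) powr p = (1 / Gamma \<alpha>) powr p * norm (?c t) powr p" for t
      using G by (simp add: powr_divide)
    moreover have "integrable M (\<lambda>t. norm (?c t) powr p)" using cL by (simp add: Lp_functions_def)
    moreover have "strongly_measurable M (\<lambda>t. (1 / Gamma \<alpha>) *\<^sub>R ?c t)"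
      by (rule strongly_measurable_scaleR[OF strongly_measurable_simple_function cm]) simp
    ultimately show ?thesis
      unfolding Lp_functions_def by (simp only: mem_Collect_eq Bochner_Integration.integrable_mult_right simp_thms)
  qed
  show ?thesis
  proof (rule Lp_norm_mono_AE(1)[OF gL sm])
    show "AE t in M. norm (RL_integral \<alpha> t\<^sub>0 f t) \<le> norm ((1 / Gamma \<alpha>) *\<^sub>R ?c t)"
      using AE_Abel_convolution_finite(1)[OF f] AE_space
    proof eventually_elim
      case (elim t)
      then have t: "t \<in> {t\<^sub>0..t\<^sub>1}" by simp
      have "ennreal (norm (Gamma \<alpha> *\<^sub>R RL_integral \<alpha> t\<^sub>0 f t)) \<le> conv_norm (tpower (\<alpha> - 1)) f t"
        using norm_Bochner_integral_le[OF complete_measure_lebesgue has_Bochner_integral_RL[OF fm t \<alpha> elim(1)]]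
        by (simp add: conv_norm_def)
      also have "\<dots> = ennreal (?c t)" using elim by simp
      finally have "Gamma \<alpha> * norm (RL_integral \<alpha> t\<^sub>0 f t) \<le> ?c t" using G by simp
      then show ?case using G by (simp add: field_simps)
    qed
  qed
qed

lemma Lp_norm_RL_le_if_cell_averages_le:
  fixes f :: "real \<Rightarrow> 'a::banach"
  assumes f: "f \<in> Lp_functions M p" and n: "0 < n" and \<delta>: "0 \<le> \<delta>"
    and le: "\<And>k. 0 \<le> k \<Longrightarrow> k < int n \<Longrightarrow> norm (cell_average n f k) \<le> \<delta>"
  shows "Lp_norm M p (RL_integral \<alpha> t\<^sub>0 f)
    \<le> kernel_gap_mass \<alpha> T (T / real n) / Gamma \<alpha> * Lp_norm M p f + \<delta> * T powr (1 / p)"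
proof -
  note gap = gap_error_Lp[OF f mesh_bounds[OF n]]
  have const: "(\<lambda>_. \<delta>) \<in> Lp_functions M p"
    by (auto simp: Lp_functions_iff emeasure_M_Icc ennreal_mult_less_top intro: strongly_measurable_simple_function)
  have "Lp_norm M p (RL_integral \<alpha> t\<^sub>0 f) \<le> Lp_norm M p (gap_error (T / real n) f) + Lp_norm M p (\<lambda>_. \<delta>)"
  proof (rule Lp_norm_triangle(2)[OF gap(2) const])
    show "strongly_measurable M (RL_integral \<alpha> t\<^sub>0 f)"
      using RL_integral_in_Lp[OF f] by (simp add: Lp_functions_iff)
    show "AE t in M. norm (RL_integral \<alpha> t\<^sub>0 f t) \<le> norm (gap_error (T / real n) f t) + norm \<delta>"
      using cell_average_close[OF f n]
    proof eventually_elim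
      case (elim t)
      have "norm (cell_average n f (cell n t)) \<le> \<delta>" using elim by (intro le) auto
      moreover have "norm (RL_integral \<alpha> t\<^sub>0 f t) \<le> norm (RL_integral \<alpha> t\<^sub>0 f t - cell_average n f (cell n t))
          + norm (cell_average n f (cell n t))"
        by (metis add.commute norm_triangle_sub)
      ultimately show ?case
        using elim[THEN conjunct2] abs_ge_self[of "gap_error (T / real n) f t"] abs_ge_self[of \<delta>]
        unfolding real_norm_def by linarith
    qed
  qed
  also have "Lp_norm M p (\<lambda>_. \<delta>) = \<delta> * T powr (1 / p)"
  proof -
    have "measure M {t\<^sub>0..t\<^sub>1} = T" using t01 emeasure_M_Icc by (simp add: measure_def)
    then have "(\<integral>t. norm \<delta> powr p \<partial>M) = T * \<delta> powr p"
      using \<delta> t01 by simp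
    then have "Lp_norm M p (\<lambda>_. \<delta>) = (T * \<delta> powr p) powr (1 / p)"
      by (simp only: Lp_norm_def)
    also have "\<dots> = T powr (1 / p) * (\<delta> powr p) powr (1 / p)"
      using t01 by (intro powr_mult)
    finally show ?thesis using \<delta> p by (simp add: powr_powr mult.commute)
  qed
  finally show ?thesis using gap(3) by linarith
qed

text \<open>
  On each cell of a subdivision of \<open>[a, b]\<close> the difference quotient of \<open>J\<^sup>1\<^sup>+\<^sup>\<alpha> f\<close> is bounded by
  the norm of \<open>J\<^sup>\<alpha> f\<close> plus the error bound. Integrating over the cells and summing up, the
  increment over \<open>[a, b]\<close> is bounded by the \<open>L\<^sup>1\<close> norm of this sum, and the error disappears as
  the subdivision is refined.
\<close>

lemma norm_RL_increment_le_Lp_norm: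
  fixes f :: "real \<Rightarrow> 'a::banach"
  assumes f: "f \<in> Lp_functions M p" and ab: "t\<^sub>0 \<le> a" "a < b" "b \<le> t\<^sub>1"
  shows "norm (RL_integral (1 + \<alpha>) t\<^sub>0 f b - RL_integral (1 + \<alpha>) t\<^sub>0 f a)
    \<le> (1 + (p - 1) * T) / p * Lp_norm M p (RL_integral \<alpha> t\<^sub>0 f)"
proof -
  let ?J = "RL_integral (1 + \<alpha>) t\<^sub>0 f" and ?R = "RL_integral \<alpha> t\<^sub>0 f"
  define C where "C = (1 + (p - 1) * T) / p"
  have C: "0 < C" unfolding C_def using p t01 by (intro divide_pos_pos add_pos_nonneg) auto
  have R: "?R \<in> Lp_functions M p" by (rule RL_integral_in_Lp[OF f])
  have est: "norm (?J b - ?J a) \<le> C * c" if c: "Lp_norm M p ?R < c" for c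
  proof -
    have "(\<lambda>n. (b - a) / real (Suc n)) \<longlonglongrightarrow> 0"
      by (intro LIMSEQ_Suc[of "\<lambda>n. (b - a) / real n"] lim_const_over_n)
    then have "(\<lambda>n. kernel_gap_mass \<alpha> T ((b - a) / real (Suc n)) / Gamma \<alpha> * Lp_norm M p f) \<longlonglongrightarrow> 0 / Gamma \<alpha> * Lp_norm M p f"
      using Gamma_real_pos[OF \<alpha>] by (intro tendsto_intros kernel_gap_mass_tendsto_0 \<alpha>) auto
    then have "eventually (\<lambda>n. kernel_gap_mass \<alpha> T ((b - a) / real (Suc n)) / Gamma \<alpha> * Lp_norm M p f < c - Lp_norm M p ?R) sequentially"
      using c by (intro order_tendstoD) auto
    then obtain m where m: "kernel_gap_mass \<alpha> T ((b - a) / real (Suc m)) / Gamma \<alpha> * Lp_norm M p f < c - Lp_norm M p ?R"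
      by (auto simp: eventually_sequentially)
    define n where "n = Suc m"
    define h where "h = (b - a) / real n"
    define x where "x k = a + h * real k" for k
    have "0 < n" by (simp add: n_def)
    then have h: "0 < h" "h \<le> T" "h * real n = b - a"
      using ab frac_le[of "b - a" "b - a" 1 "real n"] by (auto simp: h_def)
    have x0: "x 0 = a" "x n = b" using h by (auto simp: x_def)
    have xS: "x (Suc k) = x k + h" for k by (simp add: x_def algebra_simps)
    have xin: "x k \<in> {t\<^sub>0..t\<^sub>1}" if "k \<le> n" for k
    proof -
      have "h * real k \<le> h * real n" using h(1) that by (intro mult_left_mono) auto
      moreover have "0 \<le> h * real k" using h(1) by simp
      ultimately have "t\<^sub>0 \<le> x k" "x k \<le> t\<^sub>1" using h(3) ab unfolding x_def by linarith+
      then show ?thesis by simp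
    qed
    note gap = gap_error_Lp[OF f h(1,2)]
    let ?u = "\<lambda>t. norm (?R t) + gap_error h f t"
    have "(\<lambda>t. norm (?R t)) \<in> borel_measurable M"
      using R by (intro borel_measurable_norm_strongly_measurable) (simp add: Lp_functions_iff)
    moreover have "gap_error h f \<in> borel_measurable M"
      using gap(2) by (intro borel_measurable_if_strongly_measurable) (simp add: Lp_functions_iff)
    ultimately have um': "?u \<in> borel_measurable M" by (rule borel_measurable_add)
    then have um: "strongly_measurable M ?u" by (rule strongly_measurable_if_borel_measurable)
    have gap0: "0 \<le> gap_error h f t" for t
      using Gamma_real_pos[OF \<alpha>] by (simp add: gap_error_def)
    have u: "?u \<in> Lp_functions M p" "Lp_norm M p ?u \<le> Lp_norm M p ?R + Lp_norm M p (gap_error h f)"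
    proof -
      have "AE t in M. norm (?u t) \<le> norm (?R t) + norm (gap_error h f t)"
        by (intro AE_I2) (simp add: gap0)
      from Lp_norm_triangle[OF R gap(2) um this]
      show "?u \<in> Lp_functions M p" "Lp_norm M p ?u \<le> Lp_norm M p ?R + Lp_norm M p (gap_error h f)" by blast+
    qed
    have uc: "Lp_norm M p ?u \<le> c" using u(2) gap(3) m by (simp add: h_def n_def)
    have cpos: "0 < c" using c Lp_norm_nonneg[of M p ?R] by linarith
    have cellk: "ennreal (norm (?J (x (Suc k)) - ?J (x k)))
        \<le> (\<integral>\<^sup>+t. ennreal (?u t) * indicator {x k..<x (Suc k)} t \<partial>M)" if k: "k < n" for k
    proof -
      let ?d = "norm (?J (x (Suc k)) - ?J (x k))"
      have sub: "{x k..<x (Suc k)} \<subseteq> {t\<^sub>0..t\<^sub>1}" using xin[of k] xin[of "Suc k"] k by auto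
      have em: "emeasure M {x k..<x (Suc k)} = ennreal h"
        using sub h by (simp add: emeasure_restrict_space xS)
      have setsM: "{x k..<x (Suc k)} \<in> sets M"
        using sub by (simp add: sets_restrict_space_iff)
      have "ennreal ?d = ennreal (?d / h) * emeasure M {x k..<x (Suc k)}"
        using h by (simp add: em ennreal_mult[symmetric])
      also have "\<dots> = (\<integral>\<^sup>+t. ennreal (?d / h) * indicator {x k..<x (Suc k)} t \<partial>M)"
        by (rule nn_integral_cmult_indicator[symmetric, OF setsM])
      also have "\<dots> \<le> (\<integral>\<^sup>+t. ennreal (?u t) * indicator {x k..<x (Suc k)} t \<partial>M)"
      proof (rule nn_integral_mono_AE, use AE_Abel_convolution_finite(1)[OF f] gap(1) AE_space in eventually_elim)
        fix t assume fin: "conv_norm (tpower (\<alpha> - 1)) f t < \<infinity>" "conv_norm (kernel_gap \<alpha> h) f t < \<infinity>"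
          and t: "t \<in> space M"
        show "ennreal (?d / h) * indicator {x k..<x (Suc k)} t \<le> ennreal (?u t) * indicator {x k..<x (Suc k)} t"
        proof (cases "t \<in> {x k..<x (Suc k)}")
          case True
          have "norm (?R t - (1 / (x (Suc k) - x k)) *\<^sub>R (?J (x (Suc k)) - ?J (x k))) \<le> gap_error h f t"
            using True t h k by (intro RL_average_close f xin fin) (auto simp: xS)
          then have "norm ((1 / h) *\<^sub>R (?J (x (Suc k)) - ?J (x k))) \<le> norm (?R t) + gap_error h f t"
            using norm_triangle_ineq2[of "(1 / h) *\<^sub>R (?J (x (Suc k)) - ?J (x k))" "?R t"]
            by (simp add: xS norm_minus_commute)
          then have "?d / h \<le> ?u t" using h by simp
          then show ?thesis by (intro mult_right_mono ennreal_leI) auto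
        qed simp
      qed
      finally show ?thesis .
    qed
    have "?J b - ?J a = (\<Sum>k<n. ?J (x (Suc k)) - ?J (x k))"
      using sum_lessThan_telescope[of "\<lambda>k. ?J (x k)" n] x0 by simp
    then have "ennreal (norm (?J b - ?J a)) \<le> ennreal (\<Sum>k<n. norm (?J (x (Suc k)) - ?J (x k)))"
      by (simp add: ennreal_leI norm_sum)
    also have "\<dots> = (\<Sum>k<n. ennreal (norm (?J (x (Suc k)) - ?J (x k))))"
      by simp
    also have "\<dots> \<le> (\<Sum>k<n. \<integral>\<^sup>+t. ennreal (?u t) * indicator {x k..<x (Suc k)} t \<partial>M)"
      by (intro sum_mono cellk) simp
    also have "\<dots> = (\<integral>\<^sup>+t. (\<Sum>k<n. ennreal (?u t) * indicator {x k..<x (Suc k)} t) \<partial>M)"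
    proof (rule nn_integral_sum[symmetric])
      fix k assume "k \<in> {..<n}"
      then have "{x k..<x (Suc k)} \<subseteq> {t\<^sub>0..t\<^sub>1}" using xin[of k] xin[of "Suc k"] by auto
      then have "{x k..<x (Suc k)} \<in> sets M" by (simp add: sets_restrict_space_iff)
      then show "(\<lambda>t. ennreal (?u t) * indicator {x k..<x (Suc k)} t) \<in> borel_measurable M"
        by (intro borel_measurable_times_ennreal borel_measurable_indicator
            measurable_compose[OF um' measurable_ennreal])
    qed
    also have "\<dots> \<le> (\<integral>\<^sup>+t. ennreal (norm (?u t)) \<partial>M)"
    proof (rule nn_integral_mono)
      fix t
      have "(\<Sum>k<n. indicator {x k..<x (Suc k)} t) = (indicator {x 0..<x n} t :: ennreal)" for n
      proof (induction n)
        case (Suc n)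
        have "x 0 \<le> x n" "x n \<le> x (Suc n)" using h by (auto simp: x_def xS)
        then show ?case using Suc by (auto simp: indicator_def)
      qed simp
      then have "(\<Sum>k<n. indicator {x k..<x (Suc k)} t) \<le> (1::ennreal)"
        by (simp add: indicator_def)
      then have "ennreal (?u t) * (\<Sum>k<n. indicator {x k..<x (Suc k)} t) \<le> ennreal (?u t) * 1"
        by (intro mult_left_mono) auto
      then show "(\<Sum>k<n. ennreal (?u t) * indicator {x k..<x (Suc k)} t) \<le> ennreal (norm (?u t))"
        using gap0[of t] by (simp add: sum_distrib_left)
    qed
    also have "\<dots> \<le> ennreal (C * c)"
      unfolding C_def by (rule nn_integral_norm_le_Lp_norm[OF u(1) uc cpos emeasure_M])
    finally have "ennreal (norm (?J b - ?J a)) \<le> ennreal (C * c)" .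
    moreover have "0 \<le> C * c" using C cpos by (intro mult_nonneg_nonneg) auto
    ultimately show ?thesis using ennreal_le_iff by blast
  qed
  show ?thesis unfolding C_def[symmetric]
  proof (rule field_le_epsilon)
    fix e :: real assume e: "0 < e"
    have "norm (?J b - ?J a) \<le> C * (Lp_norm M p ?R + e / C)"
      using divide_pos_pos[OF e C] by (intro est) linarith
    also have "\<dots> = C * Lp_norm M p ?R + e" using C by (simp add: distrib_left)
    finally show "norm (?J b - ?J a) \<le> C * Lp_norm M p ?R + e" .
  qed
qed

end


section \<open>Total boundedness and compactness\<close>

text \<open>
  Points with the same code have close images, so one image for every code forms a finite net.
  This avoids centers outside the image.
\<close>

lemma (in Metric_space) mtotally_bounded_image_if_finite_codes:
  fixes g :: "'b \<Rightarrow> 'a"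
  assumes "g ` F \<subseteq> M"
    and codes: "\<And>e. 0 < e \<Longrightarrow> \<exists>c :: 'b \<Rightarrow> 'c. finite (c ` F) \<and> (\<forall>u\<in>F. \<forall>v\<in>F. c u = c v \<longrightarrow> d (g u) (g v) < e)"
  shows "mtotally_bounded (g ` F)"
  unfolding mtotally_bounded_def
proof (intro allI impI)
  fix e :: real assume "0 < e"
  from codes[OF this] obtain c :: "'b \<Rightarrow> 'c" where c: "finite (c ` F)"
      "\<And>u v. u \<in> F \<Longrightarrow> v \<in> F \<Longrightarrow> c u = c v \<Longrightarrow> d (g u) (g v) < e"
    by blast
  let ?K = "(\<lambda>k. g (inv_into F c k)) ` c ` F"
  have "g u \<in> (\<Union>x\<in>?K. mball x e)" if u: "u \<in> F" for u
  proof -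
    have *: "inv_into F c (c u) \<in> F" "c (inv_into F c (c u)) = c u"
      by (rule inv_into_into[OF imageI[OF u]], rule f_inv_into_f[OF imageI[OF u]])
    from c(2)[OF this(1) u this(2)] have "g u \<in> mball (g (inv_into F c (c u))) e"
      using * u assms(1) unfolding in_mball by blast
    then show ?thesis by (rule UN_I[OF imageI[OF imageI[OF u]]])
  qed
  moreover have "?K \<subseteq> g ` F"
    using inv_into_into[of _ c F] by blast
  ultimately show "\<exists>K. finite K \<and> K \<subseteq> g ` F \<and> g ` F \<subseteq> (\<Union>x\<in>K. mball x e)"
    using c(1) by (intro exI[of _ ?K] conjI) auto
qed

lemma compact_closure_iff_mtotally_bounded:
  fixes S :: "'a::complete_space set"
  shows "compact (closure S) \<longleftrightarrow> Met_TC.mtotally_bounded S"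
proof -
  have "Met_TC.mcomplete TYPE('a)"
    unfolding Met_TC.mcomplete_def
    by (simp add: MCauchy_iff_Cauchy limitin_iff_tendsto Cauchy_convergent_iff convergent_def)
  then show ?thesis
    using Met_TC.mtotally_bounded_eq_compact_closure_of[of S] by simp
qed

context RL_setting
begin

lemma RL_operator_in_Lp_space:
  fixes u :: "(real \<Rightarrow> 'a::banach) set"
  assumes "u \<in> Lp_space M p"
  shows "RL_operator p t\<^sub>0 t\<^sub>1 \<alpha> u \<in> Lp_space M p"
  unfolding RL_operator_def using assms by (intro Lp_class_in_Lp_space RL_integral_in_Lp Lp_rep_in_Lp)

lemma Lp_dist_RL_operator:
  fixes u v :: "(real \<Rightarrow> 'a::banach) set"
  assumes u: "u \<in> Lp_space M p" and v: "v \<in> Lp_space M p"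
  shows "Lp_dist M p (RL_operator p t\<^sub>0 t\<^sub>1 \<alpha> u) (RL_operator p t\<^sub>0 t\<^sub>1 \<alpha> v)
    = Lp_norm M p (RL_integral \<alpha> t\<^sub>0 (\<lambda>s. Lp_rep u s - Lp_rep v s))"
proof -
  note U = Lp_rep_in_Lp(1)[OF u] and V = Lp_rep_in_Lp(1)[OF v]
  note d = Lp_diff[OF RL_integral_in_Lp[OF U] RL_integral_in_Lp[OF V]]
  have "Lp_dist M p (RL_operator p t\<^sub>0 t\<^sub>1 \<alpha> u) (RL_operator p t\<^sub>0 t\<^sub>1 \<alpha> v)
    = Lp_norm M p (\<lambda>t. RL_integral \<alpha> t\<^sub>0 (Lp_rep u) t - RL_integral \<alpha> t\<^sub>0 (Lp_rep v) t)"
    unfolding RL_operator_def by (intro Lp_dist_Lp_class RL_integral_in_Lp U V)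
  also have "\<dots> = Lp_norm M p (RL_integral \<alpha> t\<^sub>0 (\<lambda>s. Lp_rep u s - Lp_rep v s))"
  proof (rule Lp_norm_cong_AE)
    show "strongly_measurable M (RL_integral \<alpha> t\<^sub>0 (\<lambda>s. Lp_rep u s - Lp_rep v s))"
      using RL_integral_in_Lp[OF Lp_diff[OF U V]] by (simp add: Lp_functions_iff)
    show "strongly_measurable M (\<lambda>t. RL_integral \<alpha> t\<^sub>0 (Lp_rep u) t - RL_integral \<alpha> t\<^sub>0 (Lp_rep v) t)"
      using d by (simp add: Lp_functions_iff)
    show "AE t in M. norm (RL_integral \<alpha> t\<^sub>0 (Lp_rep u) t - RL_integral \<alpha> t\<^sub>0 (Lp_rep v) t)
      = norm (RL_integral \<alpha> t\<^sub>0 (\<lambda>s. Lp_rep u s - Lp_rep v s) t)"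
      using AE_RL_integral_diff[OF U V] by eventually_elim simp
  qed
  finally show ?thesis .
qed

definition RL_increment :: "real \<Rightarrow> real \<Rightarrow> (real \<Rightarrow> 'a::real_normed_vector) set \<Rightarrow> 'a" where
  "RL_increment a b u = RL_integral (1 + \<alpha>) t\<^sub>0 (Lp_rep u) b - RL_integral (1 + \<alpha>) t\<^sub>0 (Lp_rep u) a"

lemma RL_increment_diff:
  fixes u v :: "(real \<Rightarrow> 'a::banach) set"
  assumes u: "u \<in> Lp_space M p" and v: "v \<in> Lp_space M p"
    and "a \<in> {t\<^sub>0..t\<^sub>1}" "b \<in> {t\<^sub>0..t\<^sub>1}"
  shows "RL_increment a b u - RL_increment a b v
    = RL_integral (1 + \<alpha>) t\<^sub>0 (\<lambda>s. Lp_rep u s - Lp_rep v s) b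
      - RL_integral (1 + \<alpha>) t\<^sub>0 (\<lambda>s. Lp_rep u s - Lp_rep v s) a"
  using assms by (simp add: RL_increment_def RL_integral_next_order_diff Lp_rep_in_Lp)

lemma dist_RL_increment_le:
  fixes u v :: "(real \<Rightarrow> 'a::banach) set"
  assumes u: "u \<in> Lp_space M p" and v: "v \<in> Lp_space M p" and ab: "t\<^sub>0 \<le> a" "a < b" "b \<le> t\<^sub>1"
  shows "dist (RL_increment a b u) (RL_increment a b v)
    \<le> (1 + (p - 1) * T) / p * Lp_dist M p (RL_operator p t\<^sub>0 t\<^sub>1 \<alpha> u) (RL_operator p t\<^sub>0 t\<^sub>1 \<alpha> v)"
  unfolding dist_norm Lp_dist_RL_operator[OF u v]
  using norm_RL_increment_le_Lp_norm[OF Lp_diff[OF Lp_rep_in_Lp(1)[OF u] Lp_rep_in_Lp(1)[OF v]] ab]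
    RL_increment_diff[OF u v, of a b] ab by simp

text \<open>
  The code of \<open>u\<close> is a point near its image under \<open>J\<^sup>\<alpha>\<close>, taken from a finite net.
\<close>

lemma compact_increments_if_compact_image:
  fixes F :: "(real \<Rightarrow> 'a::banach) set set"
  assumes F: "F \<subseteq> Lp_space M p" and ab: "t\<^sub>0 \<le> a" "a < b" "b \<le> t\<^sub>1"
    and tb: "Metric_space.mtotally_bounded (Lp_space M p) (Lp_dist M p) (RL_operator p t\<^sub>0 t\<^sub>1 \<alpha> ` F)"
  shows "compact (closure (RL_increment a b ` F))"
proof -
  interpret L: Metric_space "Lp_space M p :: (real \<Rightarrow> 'a) set set" "Lp_dist M p"
    by (rule Metric_space_Lp)
  let ?A = "RL_operator p t\<^sub>0 t\<^sub>1 \<alpha> :: (real \<Rightarrow> 'a) set \<Rightarrow> _"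
  define C where "C = (1 + (p - 1) * T) / p"
  have C: "0 < C" unfolding C_def using p t01 by (intro divide_pos_pos add_pos_nonneg) auto
  have "Met_TC.mtotally_bounded (RL_increment a b ` F)"
  proof (rule Met_TC.mtotally_bounded_image_if_finite_codes)
    fix e :: real assume "0 < e"
    then have "0 < e / (2 * C)" using C by (intro divide_pos_pos mult_pos_pos) simp_all
    then obtain K where K: "finite K" "?A ` F \<subseteq> (\<Union>x\<in>K. L.mball x (e / (2 * C)))"
      using tb unfolding L.mtotally_bounded_def by metis
    then have "\<forall>u\<in>F. \<exists>x\<in>K. ?A u \<in> L.mball x (e / (2 * C))" by blast
    then obtain c where c: "\<And>u. u \<in> F \<Longrightarrow> c u \<in> K" "\<And>u. u \<in> F \<Longrightarrow> ?A u \<in> L.mball (c u) (e / (2 * C))"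
      by metis
    have "dist (RL_increment a b u) (RL_increment a b v) < e" if "u \<in> F" "v \<in> F" "c u = c v" for u v
    proof -
      have uv: "u \<in> Lp_space M p" "v \<in> Lp_space M p" using F that by auto
      have m: "c u \<in> Lp_space M p" "?A u \<in> Lp_space M p" "?A v \<in> Lp_space M p"
        "Lp_dist M p (c u) (?A u) < e / (2 * C)" "Lp_dist M p (c u) (?A v) < e / (2 * C)"
        using c(2)[OF that(1)] c(2)[OF that(2)] that(3) by (auto simp: L.in_mball)
      have "Lp_dist M p (?A u) (?A v) \<le> Lp_dist M p (?A u) (c u) + Lp_dist M p (c u) (?A v)"
        by (intro L.triangle m)
      also have "\<dots> < e / (2 * C) + e / (2 * C)"
        using m(4,5) L.commute[of "?A u" "c u"] by linarith
      also have "\<dots> = e / C" by simp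
      finally have "C * Lp_dist M p (?A u) (?A v) < C * (e / C)"
        using C by (intro mult_strict_left_mono)
      also have "\<dots> = e" using C by simp
      finally show ?thesis using dist_RL_increment_le[OF uv ab, folded C_def] by linarith
    qed
    moreover have "finite (c ` F)" using K(1) c(1) by (auto intro: finite_subset)
    ultimately show "\<exists>c :: _ \<Rightarrow> (real \<Rightarrow> 'a) set. finite (c ` F) \<and> (\<forall>u\<in>F. \<forall>v\<in>F. c u = c v \<longrightarrow>
        dist (RL_increment a b u) (RL_increment a b v) < e)" by (intro exI[of _ c]) auto
  qed simp
  then show ?thesis by (simp add: compact_closure_iff_mtotally_bounded)
qed

text \<open>
  The code of \<open>u\<close> lists, for each cell of a sufficiently fine mesh, a point from a finite net
  near the increment of \<open>J\<^sup>1\<^sup>+\<^sup>\<alpha> u\<close> over the middle half of the cell.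
\<close>

lemma totally_bounded_image_if_compact_increments:
  fixes F :: "(real \<Rightarrow> 'a::banach) set set"
  assumes F: "Metric_space.mbounded (Lp_space M p) (Lp_dist M p) F"
    and cpt: "\<And>a b. t\<^sub>0 < a \<Longrightarrow> a < b \<Longrightarrow> b < t\<^sub>1 \<Longrightarrow> compact (closure (RL_increment a b ` F))"
  shows "Metric_space.mtotally_bounded (Lp_space M p) (Lp_dist M p) (RL_operator p t\<^sub>0 t\<^sub>1 \<alpha> ` F)"
proof -
  interpret L: Metric_space "Lp_space M p :: (real \<Rightarrow> 'a) set set" "Lp_dist M p"
    by (rule Metric_space_Lp)
  have FL: "F \<subseteq> Lp_space M p" using F by (rule L.mbounded_subset_mspace)
  obtain B where B: "0 \<le> B" "\<And>u v. u \<in> F \<Longrightarrow> v \<in> F \<Longrightarrow> Lp_dist M p u v \<le> B"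
    using F unfolding L.mbounded_alt
    by (metis L.nonneg order_trans max.cobounded1 max.cobounded2)
  show ?thesis
  proof (rule L.mtotally_bounded_image_if_finite_codes)
    show "RL_operator p t\<^sub>0 t\<^sub>1 \<alpha> ` F \<subseteq> Lp_space M p"
      using FL RL_operator_in_Lp_space by blast
    fix e :: real assume e: "0 < e"
    obtain n where n: "0 < n" "kernel_gap_mass \<alpha> T (T / real n) / Gamma \<alpha> * B < e / 2"
      using fine_mesh_exists[OF B(1), of "e / 2"] e by auto
    define \<delta> where "\<delta> = e / (4 * T powr (1 / p))"
    have Tp: "0 < T powr (1 / p)" using t01 by simp
    have \<delta>: "0 < \<delta>" "\<delta> * T powr (1 / p) = e / 4" using e Tp by (auto simp: \<delta>_def)
    let ?lo = "\<lambda>k::int. node n (k + 1/4)" and ?hi = "\<lambda>k::int. node n (k + 3/4)"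
    \<comment> \<open>Increments within \<open>r k\<close> of the same point give cell averages that differ by at most \<open>\<delta>\<close>.\<close>
    define r where "r k = \<delta> * (?hi k - ?lo k) / 2" for k
    have gap: "0 < ?hi k - ?lo k" for k
    proof -
      have "y * (1/4) < y * (3/4)" if "0 < y" for y :: real using that by simp
      from this[OF mesh_bounds(1)[OF n(1)]] show ?thesis unfolding node_def distrib_left by linarith
    qed
    have r: "0 < r k" for k unfolding r_def using \<delta>(1) gap[of k] by simp
    have inside: "t\<^sub>0 < ?lo k" "?hi k < t\<^sub>1" if "0 \<le> k" "k < int n" for k
    proof -
      have "0 \<le> real_of_int k" "real_of_int k + 1 \<le> real n" using that by linarith+
      then show "t\<^sub>0 < ?lo k" "?hi k < t\<^sub>1" by (auto intro!: node_inside)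
    qed
    define I :: "int \<Rightarrow> (real \<Rightarrow> 'a) set \<Rightarrow> 'a" where "I k = RL_increment (?lo k) (?hi k)" for k
    have "\<exists>K. finite K \<and> (\<forall>u\<in>F. \<exists>x\<in>K. I k u \<in> ball x (r k))"
      if k: "k \<in> {0..<int n}" for k
    proof -
      let ?S = "closure (I k ` F)"
      have "compact ?S"
        using inside[of k] k gap[of k] unfolding I_def by (intro cpt) auto
      then have "\<exists>K. finite K \<and> ?S \<subseteq> (\<Union>x\<in>K. ball x (r k))"
        using r[of k] unfolding compact_eq_totally_bounded[of ?S] by simp
      then obtain K where K: "finite K" "?S \<subseteq> (\<Union>x\<in>K. ball x (r k))" by auto
      have "\<exists>x\<in>K. I k u \<in> ball x (r k)" if "u \<in> F" for u
      proof -
        have "I k u \<in> ?S"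
          by (rule subsetD[OF closure_subset imageI[OF that]])
        from subsetD[OF K(2) this] show ?thesis by (rule UN_E) blast
      qed
      then show ?thesis using K(1) by (intro exI[of _ K]) auto
    qed
    note nets = this
    define K where "K k = (SOME K. finite K \<and> (\<forall>u\<in>F. \<exists>x\<in>K. I k u \<in> ball x (r k)))" for k
    have K: "finite (K k)" "\<And>u. u \<in> F \<Longrightarrow> \<exists>x\<in>K k. I k u \<in> ball x (r k)" if "k \<in> {0..<int n}" for k
      using someI_ex[OF nets[OF that]] unfolding K_def by blast+
    define y where "y k u = (SOME x. x \<in> K k \<and> I k u \<in> ball x (r k))" for k u
    have y: "y k u \<in> K k" "I k u \<in> ball (y k u) (r k)"
      if "k \<in> {0..<int n}" "u \<in> F" for k u
    proof -
      have "\<exists>x. x \<in> K k \<and> I k u \<in> ball x (r k)"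
        using K(2)[OF that] by blast
      from someI_ex[OF this]
      show "y k u \<in> K k" "I k u \<in> ball (y k u) (r k)"
        unfolding y_def by blast+
    qed
    define c where "c u = (\<lambda>k\<in>{0..<int n}. y k u)" for u
    have "c ` F \<subseteq> (\<Pi>\<^sub>E k\<in>{0..<int n}. K k)" using y(1) by (auto simp: c_def)
    moreover have "finite (\<Pi>\<^sub>E k\<in>{0..<int n}. K k)" using K(1) by (intro finite_PiE) auto
    ultimately have "finite (c ` F)" by (rule finite_subset)
    moreover have "Lp_dist M p (RL_operator p t\<^sub>0 t\<^sub>1 \<alpha> u) (RL_operator p t\<^sub>0 t\<^sub>1 \<alpha> v) < e"
      if uv: "u \<in> F" "v \<in> F" "c u = c v" for u v
    proof -
      have uvL: "u \<in> Lp_space M p" "v \<in> Lp_space M p" using FL uv by auto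
      let ?w = "\<lambda>s. Lp_rep u s - Lp_rep v s"
      have w: "?w \<in> Lp_functions M p" by (intro Lp_diff Lp_rep_in_Lp uvL)
      have "norm (cell_average n ?w k) \<le> \<delta>" if k: "0 \<le> k" "k < int n" for k
      proof -
        have k': "k \<in> {0..<int n}" using k by simp
        have "y k u = y k v" using fun_cong[OF uv(3), of k] k' by (simp add: c_def)
        then have "dist (I k u) (I k v) < r k + r k"
          using y(2)[OF k' uv(1)] y(2)[OF k' uv(2)]
            dist_triangle2[of "I k u" "I k v" "y k v"]
          by (simp add: dist_commute)
        moreover have "I k u - I k v
          = RL_integral (1 + \<alpha>) t\<^sub>0 ?w (?hi k) - RL_integral (1 + \<alpha>) t\<^sub>0 ?w (?lo k)"
          using inside[OF k] gap[of k] unfolding I_def by (intro RL_increment_diff uvL) auto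
        ultimately have "norm (RL_integral (1 + \<alpha>) t\<^sub>0 ?w (?hi k) - RL_integral (1 + \<alpha>) t\<^sub>0 ?w (?lo k))
          \<le> \<delta> * (?hi k - ?lo k)"
          by (simp add: dist_norm r_def)
        then show ?thesis using gap[of k] by (simp add: cell_average_def pos_divide_le_eq)
      qed
      then have "Lp_norm M p (RL_integral \<alpha> t\<^sub>0 ?w)
        \<le> kernel_gap_mass \<alpha> T (T / real n) / Gamma \<alpha> * Lp_norm M p ?w + \<delta> * T powr (1 / p)"
        using \<delta>(1) by (intro Lp_norm_RL_le_if_cell_averages_le w n) auto
      also have "\<dots> \<le> kernel_gap_mass \<alpha> T (T / real n) / Gamma \<alpha> * B + e / 4"
        unfolding \<delta>(2) using B(2)[OF uv(1,2)] kernel_gap_mass_pos[OF \<alpha> mesh_bounds(1)[OF n(1)], of T] Gamma_real_pos[OF \<alpha>]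
        by (intro add_mono mult_left_mono) (auto simp: Lp_dist_eq_Lp_norm)
      also have "\<dots> < e" using n(2) e by linarith
      finally show ?thesis by (simp add: Lp_dist_RL_operator[OF uvL])
    qed
    ultimately show "\<exists>c :: _ \<Rightarrow> int \<Rightarrow> 'a. finite (c ` F) \<and> (\<forall>u\<in>F. \<forall>v\<in>F. c u = c v \<longrightarrow>
        Lp_dist M p (RL_operator p t\<^sub>0 t\<^sub>1 \<alpha> u) (RL_operator p t\<^sub>0 t\<^sub>1 \<alpha> v) < e)"
      by (intro exI[of _ c]) auto
  qed
qed

end

theorem theorem15:
  fixes t\<^sub>0 t\<^sub>1 p \<alpha> :: real
  defines "L \<equiv> Lp_space (lebesgue_on {t\<^sub>0..t\<^sub>1}) p :: (real \<Rightarrow> 'a::banach) set set"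
    and "dL \<equiv> Lp_dist (lebesgue_on {t\<^sub>0..t\<^sub>1}) p"
  assumes "t\<^sub>0 < t\<^sub>1" and "1 \<le> p" and "0 < \<alpha>"
  shows "compact_operator L dL L dL (RL_operator p t\<^sub>0 t\<^sub>1 \<alpha>) \<longleftrightarrow>
    (\<forall>F s\<^sub>0 s\<^sub>1. Metric_space.mbounded L dL F \<and> t\<^sub>0 < s\<^sub>0 \<and> s\<^sub>0 < s\<^sub>1 \<and> s\<^sub>1 < t\<^sub>1 \<longrightarrow>
       compact (closure
         {RL_integral (1 + \<alpha>) t\<^sub>0 (Lp_rep f) s\<^sub>1 - RL_integral (1 + \<alpha>) t\<^sub>0 (Lp_rep f) s\<^sub>0 | f. f \<in> F}))"
proof -
  interpret RL_setting t\<^sub>0 t\<^sub>1 p \<alpha> using assms(3-5) by unfold_locales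
  interpret L: Metric_space L dL unfolding L_def dL_def by (rule Metric_space_Lp)
  let ?A = "RL_operator p t\<^sub>0 t\<^sub>1 \<alpha> :: (real \<Rightarrow> 'a) set \<Rightarrow> _"
  have maps: "?A \<in> L \<rightarrow> L" unfolding L_def using RL_operator_in_Lp_space by blast
  have compact_iff: "compactin L.mtopology (L.mtopology closure_of (?A ` F)) \<longleftrightarrow> L.mtotally_bounded (?A ` F)"
    if "L.mbounded F" for F
  proof -
    have "L.mcomplete" unfolding L_def dL_def by (rule mcomplete_Lp)
    moreover have "?A ` F \<subseteq> L" using maps L.mbounded_subset_mspace[OF that] by blast
    ultimately show ?thesis by (simp add: L.mtotally_bounded_eq_compact_closure_of)
  qed
  have incr: "{RL_integral (1 + \<alpha>) t\<^sub>0 (Lp_rep f) s\<^sub>1 - RL_integral (1 + \<alpha>) t\<^sub>0 (Lp_rep f) s\<^sub>0 | f. f \<in> F}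
      = RL_increment s\<^sub>0 s\<^sub>1 ` F" for s\<^sub>0 s\<^sub>1 and F :: "(real \<Rightarrow> 'a) set set"
    by (auto simp: RL_increment_def)
  show ?thesis unfolding incr
  proof
    assume "compact_operator L dL L dL ?A"
    then have tb: "L.mtotally_bounded (?A ` F)" if "L.mbounded F" for F
      using that compact_iff by (auto simp: compact_operator_def)
    show "\<forall>F s\<^sub>0 s\<^sub>1. L.mbounded F \<and> t\<^sub>0 < s\<^sub>0 \<and> s\<^sub>0 < s\<^sub>1 \<and> s\<^sub>1 < t\<^sub>1 \<longrightarrow>
       compact (closure (RL_increment s\<^sub>0 s\<^sub>1 ` F))"
    proof (intro allI impI)
      fix F s\<^sub>0 s\<^sub>1 assume F: "L.mbounded F \<and> t\<^sub>0 < s\<^sub>0 \<and> s\<^sub>0 < s\<^sub>1 \<and> s\<^sub>1 < t\<^sub>1"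
      then show "compact (closure (RL_increment s\<^sub>0 s\<^sub>1 ` F))"
        using tb[of F] L.mbounded_subset_mspace[of F] compact_increments_if_compact_image[of F s\<^sub>0 s\<^sub>1]
        unfolding L_def dL_def by simp
    qed
  next
    assume *: "\<forall>F s\<^sub>0 s\<^sub>1. L.mbounded F \<and> t\<^sub>0 < s\<^sub>0 \<and> s\<^sub>0 < s\<^sub>1 \<and> s\<^sub>1 < t\<^sub>1 \<longrightarrow>
       compact (closure (RL_increment s\<^sub>0 s\<^sub>1 ` F))"
    have "L.mtotally_bounded (?A ` F)" if "L.mbounded F" for F
    proof -
      have "Metric_space.mtotally_bounded (Lp_space M p) (Lp_dist M p) (?A ` F)"
      proof (rule totally_bounded_image_if_compact_increments)
        show "Metric_space.mbounded (Lp_space M p) (Lp_dist M p) F"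
          using that unfolding L_def dL_def .
        show "compact (closure (RL_increment a b ` F))" if "t\<^sub>0 < a" "a < b" "b < t\<^sub>1" for a b
          using * that \<open>L.mbounded F\<close> by blast
      qed
      then show ?thesis unfolding L_def dL_def .
    qed
    then show "compact_operator L dL L dL ?A"
      using maps compact_iff by (simp add: compact_operator_def)
  qed
qed

end
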